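(* Let $T:X\to X$ be a non-singular piecewise invertible map with respect to the partition $\mathcal P=\{O_h\}_{h\in\mathcal H}$, satisfying uniform expansion, bounded distortion and controlled complexity (all as defined in the context). Then there exist a refinement $\mathcal P'$ of $\mathcal P$ into open sets (mod $0$) and a function $\tau:X\to\mathbb Z^+$, constant on elements of $\mathcal P'$, such that: (a) the map $G=T^{\tau}:X\to X$, $G(x)=T^{\tau(x)}(x)$, is a Gibbs-Markov map (with respect to $\mathcal P'$) with finitely many images; (b) there exist $\kappa\in(0,1)$ and a constant $C<\infty$ such that $\mathbf m(\{x\in X:\tau(x)>n\})\le C\kappa^n$ for all $n\in\mathbb N$.
   Context: **Setting.** $\mathbb R^d$ carries the Euclidean metric $\mathbf d$ and Lebesgue measure $\mathbf m$. For $A\subset\mathbb R^d$, $\operatorname{cl}A$ is the closure, $\partial A=\operatorname{cl}A\cap\operatorname{cl}(\mathbb R^d\setminus A)$, and $\partial_\varepsilon A=\{x\in A:\mathbf d(x,\partial A)<\varepsilon\}$. $X\subset\mathbb R^d$ is a bounded open set with $\sup_{\varepsilon>0}\mathbf m(\partial_\varepsilon X)/\varepsilon<\infty$. $T$ is a non-singular piecewise invertible map on $X$ with respect to a countable partition $\mathcal P=\{O_h\}_{h\in\mathcal H}$: the $O_h$ are pairwise disjoint nonempty open subsets of $X$ with $\mathbf m(X\setminus\bigcup_h O_h)=0$, and each $T|_{O_h}:O_h\to T(O_h)\subset X$ is a homeomorphism onto its image which is non-singular with non-singular inverse (i.e. $(T|_{O_h})_*(\mathbf m|_{O_h})$ is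 equivalent to $\mathbf m|_{T(O_h)}$). The symbol $h$ also denotes the inverse branch $h:T(O_h)\to O_h$. $\mathcal H^n$ is the set of inverse branches of $T^n$ ($n\in\mathbb N$), with corresponding partition $\mathcal P^n=\{O_h\}_{h\in\mathcal H^n}$ and $h:T^n(O_h)\to O_h$. $Jh=d(\mathbf m\circ h)/d\mathbf m$. **Uniform expansion.** There exist $\varepsilon_1>0$ and $\Lambda\in(0,1)$ such that for every $h\in\mathcal H$, $\mathbf d(h(x),h(y))\le\Lambda\,\mathbf d(x,y)$ for all $x,y\in T(O_h)$ with $\mathbf d(x,y)\le\varepsilon_1$. **Bounded distortion.** There exist $\alpha\in(0,1]$, $\tilde D\ge0$ such that for all $h\in\mathcal H$ and $x,y\in T(O_h)$, $Jh(x)\le e^{\tilde D\,\mathbf d(x,y)^\alpha}Jh(y)$. **Controlled complexity.** There exist $n_0\in\mathbb N$, $\varepsilon_2>0$ and $0\le\sigma<\Lambda^{-n_0}-1$ such that for every (nonempty) open set $I\subset X$ with $\operatorname{diam}I\le\varepsilon_2$ and every $0<\varepsilon<\varepsilon_2$, $$\sum_{h\in\mathcal H^{n_0},\ \mathbf m(I\cap O_h)>0}\frac{\mathbf m\big(h(\partial_\varepsilon T^{n_0}(I\cap O_h))\setminus\partial_{\Lambda^{n_0}\varepsilon}I\big)}{\mathbf m(\partial_{\Lambda^{n_0}\varepsilon}I)}\le\sigma;$$ moreover there is $\bar C<\infty$ such that for every integer $1\le r<n_0$, and all such $I$ and $\varepsilon$, $$\sum_{h\in\mathcal H^{r},\ \mathbf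 m(I\cap O_h)>0}\frac{\mathbf m\big(h(\partial_\varepsilon T^{r}(I\cap O_h))\setminus\partial_{\Lambda^{r}\varepsilon}I\big)}{\mathbf m(\partial_{\Lambda^{r}\varepsilon}I)}\le\bar C.$$ **Partitions and Gibbs-Markov maps.** A refinement of $\mathcal P$ into open sets (mod $0$) is a countable family of pairwise disjoint nonempty open sets, each contained in an element of $\mathcal P$, whose union has full measure in $X$. Let $Y\subset X$ be open and $\mathcal Q$ a countable (mod $0$)-partition of $Y$ into open sets. A map $G:Y\to Y$ (defined a.e.) is Gibbs-Markov with respect to $\mathcal Q$ if: for each $a\in\mathcal Q$, $G:a\to G(a)$ is a non-singular homeomorphism with non-singular inverse $g_a:G(a)\to a$; $G(a)$ is (mod $0$) a union of elements of $\mathcal Q$; $G$ has uniform expansion, i.e. there are $\varepsilon'>0$, $\Lambda'\in(0,1)$ such that for all $a$, $\mathbf d(g_a(x),g_a(y))\le\Lambda'\mathbf d(x,y)$ for $x,y\in G(a)$ with $\mathbf d(x,y)\le\varepsilon'$; and $G$ has bounded distortion, i.e. there are $\alpha'\in(0,1]$, $D'\ge0$ such that for all $a$ and $x,y\in G(a)$, $Jg_a(x)\le e^{D'\mathbf d(x,y)^{\alpha'}}Jg_a(y)$. It has finitely many images if $\{G(a):a\in\mathcal Q\}$ is a finite collection of sets. *)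

theory Defs
  imports "HOL-Analysis.Analysis"
begin

text \<open>The set \<open>\<partial>\<^sub>\<epsilon> A\<close> of points of \<open>A\<close> at distance less than \<open>\<epsilon>\<close> from the boundary. It is only
  used for bounded sets, whose frontier is nonempty unless they are empty, so the convention
  \<open>infdist x {} = 0\<close> plays no role.\<close>

definition inner_collar :: "real \<Rightarrow> 'a::euclidean_space set \<Rightarrow> 'a set" where
  "inner_collar \<epsilon> A = {x \<in> A. infdist x (frontier A) < \<epsilon>}"

definition open_partition_mod0 :: "'a::euclidean_space set \<Rightarrow> 'a set set \<Rightarrow> bool" where
  "open_partition_mod0 X P \<longleftrightarrow>
     countable P \<and> disjoint P \<and>
     (\<forall>A\<in>P. open A \<and> A \<noteq> {} \<and> A \<subseteq> X) \<and>
     X - \<Union>P \<in> null_sets lebesgue"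

definition open_refinement_mod0 :: "'a::euclidean_space set \<Rightarrow> 'a set set \<Rightarrow> 'a set set \<Rightarrow> bool" where
  "open_refinement_mod0 X P P' \<longleftrightarrow>
     open_partition_mod0 X P' \<and> (\<forall>a\<in>P'. \<exists>A\<in>P. a \<subseteq> A)"

text \<open>Equivalence of the push-forward of \<open>m|\<^sub>A\<close> under \<open>T|\<^sub>A\<close> with \<open>m\<close> restricted to \<open>T(A)\<close>. For the
  injective maps considered below this is non-singularity of both \<open>T|\<^sub>A\<close> and its inverse. The
  Borel sigma-algebra is used so that continuity of \<open>T|\<^sub>A\<close> suffices for measurability.\<close>

definition nonsingular_on :: "'a::euclidean_space set \<Rightarrow> ('a \<Rightarrow> 'a) \<Rightarrow> bool" where
  "nonsingular_on A T \<longleftrightarrow>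
     (let \<mu> = restrict_space lborel (T ` A);
          \<nu> = distr (restrict_space lborel A) (restrict_space borel (T ` A)) T
      in absolutely_continuous \<mu> \<nu> \<and> absolutely_continuous \<nu> \<mu>)"

definition nonsingular_homeo_on :: "'a::euclidean_space set \<Rightarrow> ('a \<Rightarrow> 'a) \<Rightarrow> bool" where
  "nonsingular_homeo_on A T \<longleftrightarrow>
     homeomorphism A (T ` A) T (inv_into A T) \<and> nonsingular_on A T"

text \<open>Since the elements of \<open>P\<close> are nonempty and pairwise disjoint, they serve as their own
  indices: the inverse branch belonging to \<open>A \<in> P\<close> is \<open>inv_into A T\<close> on \<open>T ` A\<close>. The map is a total
  function; no regularity is required off \<open>\<Union>P\<close>.\<close>

definition piecewise_invertible :: "'a::euclidean_space set \<Rightarrow> 'a set set \<Rightarrow> ('a \<Rightarrow> 'a) \<Rightarrow> bool" where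
  "piecewise_invertible X P T \<longleftrightarrow>
     open_partition_mod0 X P \<and> T ` X \<subseteq> X \<and> (\<forall>A\<in>P. nonsingular_homeo_on A T)"

text \<open>The partition \<open>P\<^sup>n\<close> into domains of the branches of \<open>T\<^sup>n\<close>; the inverse branch of \<open>T\<^sup>n\<close> onto
  \<open>A \<in> P\<^sup>n\<close> is \<open>inv_into A (T ^^ n)\<close>.\<close>

definition cylinders :: "'a set \<Rightarrow> 'a set set \<Rightarrow> ('a \<Rightarrow> 'a) \<Rightarrow> nat \<Rightarrow> 'a set set" where
  "cylinders X P T n =
     {A. A \<noteq> {} \<and> (\<exists>c. (\<forall>i<n. c i \<in> P) \<and> A = {x \<in> X. \<forall>i<n. (T ^^ i) x \<in> c i})}"

definition uniform_expansion :: "'a::euclidean_space set set \<Rightarrow> ('a \<Rightarrow> 'a) \<Rightarrow> real \<Rightarrow> real \<Rightarrow> bool" where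
  "uniform_expansion P T \<epsilon> \<Lambda> \<longleftrightarrow>
     0 < \<epsilon> \<and> 0 < \<Lambda> \<and> \<Lambda> < 1 \<and>
     (\<forall>A\<in>P. \<forall>x\<in>T ` A. \<forall>y\<in>T ` A. dist x y \<le> \<epsilon> \<longrightarrow>
        dist (inv_into A T x) (inv_into A T y) \<le> \<Lambda> * dist x y)"

text \<open>\<open>J\<close> is a version on \<open>D\<close> of the Radon-Nikodym derivative of \<open>m \<circ> h\<close> with respect to \<open>m\<close>.\<close>

definition is_jacobian :: "'a::euclidean_space set \<Rightarrow> ('a \<Rightarrow> 'a) \<Rightarrow> ('a \<Rightarrow> real) \<Rightarrow> bool" where
  "is_jacobian D h J \<longleftrightarrow>
     J \<in> borel_measurable (restrict_space borel D) \<and> (\<forall>x\<in>D. 0 \<le> J x) \<and>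
     (\<forall>B\<in>sets borel. B \<subseteq> D \<longrightarrow>
        emeasure lebesgue (h ` B) = (\<integral>\<^sup>+x\<in>B. ennreal (J x) \<partial>lebesgue))"

text \<open>Jacobians are determined only up to null sets; the pointwise distortion estimate is required
  of some version.\<close>

definition bounded_distortion :: "'a::euclidean_space set set \<Rightarrow> ('a \<Rightarrow> 'a) \<Rightarrow> real \<Rightarrow> real \<Rightarrow> bool" where
  "bounded_distortion P T \<alpha> D \<longleftrightarrow>
     0 < \<alpha> \<and> \<alpha> \<le> 1 \<and> 0 \<le> D \<and>
     (\<forall>A\<in>P. \<exists>J. is_jacobian (T ` A) (inv_into A T) J \<and>
        (\<forall>x\<in>T ` A. \<forall>y\<in>T ` A. J x \<le> exp (D * dist x y powr \<alpha>) * J y))"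

definition complexity_sum ::
  "'a::euclidean_space set \<Rightarrow> 'a set set \<Rightarrow> ('a \<Rightarrow> 'a) \<Rightarrow> real \<Rightarrow> nat \<Rightarrow> 'a set \<Rightarrow> real \<Rightarrow> ennreal" where
  "complexity_sum X P T \<Lambda> n I \<epsilon> =
     (\<Sum>\<^sub>\<infinity>A\<in>{A \<in> cylinders X P T n. emeasure lebesgue (I \<inter> A) > 0}.
        emeasure lebesgue
          (inv_into A (T ^^ n) ` inner_collar \<epsilon> ((T ^^ n) ` (I \<inter> A)) - inner_collar (\<Lambda> ^ n * \<epsilon>) I)
        / emeasure lebesgue (inner_collar (\<Lambda> ^ n * \<epsilon>) I))"

definition controlled_complexity ::
  "'a::euclidean_space set \<Rightarrow> 'a set set \<Rightarrow> ('a \<Rightarrow> 'a) \<Rightarrow> real \<Rightarrow> bool" where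
  "controlled_complexity X P T \<Lambda> \<longleftrightarrow>
     (\<exists>n\<^sub>0 \<epsilon>\<^sub>2 \<sigma>. 0 < \<epsilon>\<^sub>2 \<and> 0 \<le> \<sigma> \<and> \<sigma> < 1 / \<Lambda> ^ n\<^sub>0 - 1 \<and>
        (\<forall>I \<epsilon>. open I \<and> I \<noteq> {} \<and> I \<subseteq> X \<and> diameter I \<le> \<epsilon>\<^sub>2 \<and> 0 < \<epsilon> \<and> \<epsilon> < \<epsilon>\<^sub>2 \<longrightarrow>
           complexity_sum X P T \<Lambda> n\<^sub>0 I \<epsilon> \<le> ennreal \<sigma>) \<and>
        (\<exists>C::real. \<forall>r I \<epsilon>. 1 \<le> r \<and> r < n\<^sub>0 \<and>
           open I \<and> I \<noteq> {} \<and> I \<subseteq> X \<and> diameter I \<le> \<epsilon>\<^sub>2 \<and> 0 < \<epsilon> \<and> \<epsilon> < \<epsilon>\<^sub>2 \<longrightarrow>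
           complexity_sum X P T \<Lambda> r I \<epsilon> \<le> ennreal C))"

definition Gibbs_Markov :: "'a::euclidean_space set \<Rightarrow> 'a set set \<Rightarrow> ('a \<Rightarrow> 'a) \<Rightarrow> bool" where
  "Gibbs_Markov Y Q G \<longleftrightarrow>
     open Y \<and> open_partition_mod0 Y Q \<and>
     (\<forall>a\<in>Q. G ` a \<subseteq> Y \<and> nonsingular_homeo_on a G \<and>
        (\<exists>R\<subseteq>Q. sym_diff (G ` a) (\<Union>R) \<in> null_sets lebesgue)) \<and>
     (\<exists>\<epsilon> \<Lambda>. uniform_expansion Q G \<epsilon> \<Lambda>) \<and>
     (\<exists>\<alpha> D. bounded_distortion Q G \<alpha> D)"

end

theory Submission
  imports Defs
begin

text \<open>
  Pieces of \<open>X\<close> are iterated in lockstep; the image of a piece after \<open>n\<close> steps carries the push-forward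
  of Lebesgue measure, whose density has uniformly bounded distortion, and \<open>collar\<close> is the set of points
  of the pieces whose image lies within \<open>\<epsilon>\<close> of the boundary of the image of their piece. Fix \<open>\<beta> < 1\<close>
  close to 1 and let \<open>B\<close> bound the mass of the collars divided by \<open>\<epsilon>\<^sup>\<beta>\<close>, and \<open>M\<close> the total mass.
  Controlled complexity gives \<open>B \<mapsto> \<theta> B\<close> with \<open>\<theta> < 1\<close> in \<open>n\<^sub>0\<close> steps for pieces with small images.
  Afterwards the images are cut into small cells again, along spheres whose radii are chosen for each
  piece such that little mass lies near the cuts; this costs only a multiple of \<open>M\<close>. Thus
  \<open>B \<mapsto> \<theta>\<^sup>N B + A M\<close> after \<open>N n\<^sub>0\<close> steps.

  Now fix a finite partition of \<open>X\<close> into cells of diameter less than \<open>\<delta>\<close>. A point whose image has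
  distance at least \<open>\<delta>\<close> to the boundary of its image piece lies in a cell contained in that image piece,
  and is stopped there; all but \<open>(\<theta>\<^sup>N B + A M) \<delta>\<^sup>\<beta>\<close> of the mass is. Only images containing a full cell
  are cut for this purpose. Such images have Lebesgue measure bounded below, so by bounded
  distortion the cut again costs only a multiple of \<open>M\<close>. Choosing first \<open>\<delta>\<close>, then \<open>\<eta>\<close> small and \<open>N\<close>
  large, \<open>M + \<eta> B\<close> is halved by each such round, which gives the exponential tail; all images under
  the induced map are among the finitely many cells, and the process is started from the cells.
\<close>

section \<open>Branches and their distortion\<close>

text \<open>Cutting must cost no more than a multiple of the mass, yet the image of a piece may be
  tiny, so its volume gives no uniform control of a fixed cut. Hence two kinds of cuts: spheres
  adapted to the push-forward of each single piece, and fixed cells used only in images of volume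
  bounded below.

  A radius is found by averaging. To be good at all scales at once it must control the sum over k of
  2^(k \<beta>) times the mass within 2^(-k) of the sphere, and the average of this sum is finite
  because \<beta> < 1. The strict inequality in controlled complexity, (1 + \<sigma>) \<Lambda>^n <
  1 for \<open>n = n\<^sub>0\<close>, leaves room for the lost exponent and for the distortion
  factor, which tends to 1 with the diameter of the images.

  The order of the constants is forced: the volume bound of the cells, and with it the cost of
  stopping, deteriorates as \<delta> shrinks, so \<eta> has to come after \<delta>. Starting from
  the cells yields the Markov property: every element of the final partition lies in one cell, and
  each image is a cell.\<close>

definition pullback_density :: "'a::euclidean_space set \<Rightarrow> ('a \<Rightarrow> 'a) \<Rightarrow> ('a \<Rightarrow> real) \<Rightarrow> bool" where
  "pullback_density W f J \<longleftrightarrow>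
     J \<in> borel_measurable borel \<and> (\<forall>y. 0 \<le> J y) \<and>
     (\<forall>B\<in>sets borel. emeasure lborel (W \<inter> f -` B) = (\<integral>\<^sup>+y. ennreal (J y) * indicator B y \<partial>lborel))"

text \<open>\<open>f\<close> is the expanding map on \<open>W\<close>; \<open>l\<close> and
  \<open>a\<close> are the contraction factor and distortion constant of its inverse, whose Jacobian
  is the density \<open>J\<close> of the push-forward of Lebesgue measure on \<open>W\<close>.
  Phrasing everything by preimages avoids carrying an inverse map. Both estimates are confined to
  image points at distance at most \<open>e\<close>, the range in which contraction is available for
  composing branches.\<close>

definition branch :: "real \<Rightarrow> real \<Rightarrow> real \<Rightarrow> real \<Rightarrow> 'a::euclidean_space set \<Rightarrow> ('a \<Rightarrow> 'a) \<Rightarrow> bool" where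
  "branch e \<alpha> l a W f \<longleftrightarrow>
     open W \<and> continuous_on W f \<and> inj_on f W \<and>
     (\<forall>B\<in>sets borel. B \<subseteq> f ` W \<longrightarrow> (emeasure lborel B = 0 \<longleftrightarrow> emeasure lborel (W \<inter> f -` B) = 0)) \<and>
     (\<forall>x\<in>W. \<forall>y\<in>W. dist (f x) (f y) \<le> e \<longrightarrow> dist x y \<le> l * dist (f x) (f y)) \<and>
     (\<exists>J. pullback_density W f J \<and>
        (\<forall>x\<in>f ` W. \<forall>y\<in>f ` W. dist x y \<le> e \<longrightarrow> J x \<le> exp (a * dist x y powr \<alpha>) * J y))"

lemma branchD:
  assumes "branch e \<alpha> l a W f"
  shows "open W" "continuous_on W f" "inj_on f W" "open (f ` W)"
proof -
  show 1: "open W" "continuous_on W f" "inj_on f W" using assms unfolding branch_def by simp_all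
  show "open (f ` W)" by (rule invariance_of_domain[OF 1(2,1,3)])
qed

lemma pullback_densityD:
  assumes "pullback_density W f J"
  shows "J \<in> borel_measurable borel" "0 \<le> J y"
    "B \<in> sets borel \<Longrightarrow> emeasure lborel (W \<inter> f -` B) = (\<integral>\<^sup>+y. ennreal (J y) * indicator B y \<partial>lborel)"
  using assms unfolding pullback_density_def by simp_all

lemma branchE:
  assumes "branch e \<alpha> l a W f"
  obtains J where "pullback_density W f J"
    "\<And>x y. x \<in> f ` W \<Longrightarrow> y \<in> f ` W \<Longrightarrow> dist x y \<le> e \<Longrightarrow> J x \<le> exp (a * dist x y powr \<alpha>) * J y"
proof -
  from assms obtain J where "pullback_density W f J \<and>
        (\<forall>x\<in>f ` W. \<forall>y\<in>f ` W. dist x y \<le> e \<longrightarrow> J x \<le> exp (a * dist x y powr \<alpha>) * J y)"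
    unfolding branch_def by (elim conjE exE) blast
  then show thesis by (intro that[of J]) blast+
qed

lemma branch_null_iff:
  assumes "branch e \<alpha> l a W f" "B \<in> sets borel" "B \<subseteq> f ` W"
  shows "emeasure lborel B = 0 \<longleftrightarrow> emeasure lborel (W \<inter> f -` B) = 0"
  using assms unfolding branch_def by simp

lemma branch_contracts:
  assumes "branch e \<alpha> l a W f" "x \<in> W" "y \<in> W" "dist (f x) (f y) \<le> e"
  shows "dist x y \<le> l * dist (f x) (f y)"
  using assms unfolding branch_def by simp

lemma branchI:
  assumes "open W" "continuous_on W f" "inj_on f W"
    and "\<And>B. B \<in> sets borel \<Longrightarrow> B \<subseteq> f ` W \<Longrightarrow> emeasure lborel B = 0 \<longleftrightarrow> emeasure lborel (W \<inter> f -` B) = 0"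
    and "\<And>x y. x \<in> W \<Longrightarrow> y \<in> W \<Longrightarrow> dist (f x) (f y) \<le> e \<Longrightarrow> dist x y \<le> l * dist (f x) (f y)"
    and "pullback_density W f J"
    and "\<And>x y. x \<in> f ` W \<Longrightarrow> y \<in> f ` W \<Longrightarrow> dist x y \<le> e \<Longrightarrow> J x \<le> exp (a * dist x y powr \<alpha>) * J y"
  shows "branch e \<alpha> l a W f"
  unfolding branch_def using assms by (intro conjI ballI impI exI[of _ J])

lemma open_Int_vimage:
  assumes "open W" "continuous_on W f" "open B"
  shows "open (W \<inter> f -` B)"
  using assms continuous_open_preimage by blast

lemma borel_Int_vimage:
  fixes f :: "'a::euclidean_space \<Rightarrow> 'a"
  assumes "open W" "continuous_on W f" "B \<in> sets borel"
  shows "W \<inter> f -` B \<in> sets borel"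
proof -
  have "f \<in> borel_measurable (restrict_space borel W)"
    using assms borel_measurable_continuous_on_restrict by blast
  then have "f -` B \<inter> space (restrict_space borel W) \<in> sets (restrict_space borel W)"
    using assms(3) by (rule measurable_sets)
  then show ?thesis
    using assms(1) by (simp add: space_restrict_space sets_restrict_space_iff Int_commute)
qed

lemma inv_into_image_eq:
  assumes "inj_on f W" "B \<subseteq> f ` W"
  shows "inv_into W f ` B = W \<inter> f -` B"
proof
  show "inv_into W f ` B \<subseteq> W \<inter> f -` B"
    using assms(2) by (auto simp: inv_into_into f_inv_into_f subset_iff)
  show "W \<inter> f -` B \<subseteq> inv_into W f ` B"
    using assms(1) by (auto intro!: image_eqI[where x="f _"] simp: inv_into_f_f)
qed

text \<open>Openness of \<open>W\<close> and of its image identifies the measurable sets of the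
  restricted spaces with Borel subsets, so absolute continuity in both directions becomes a
  statement about preimages.\<close>

lemma nonsingular_on_iff:
  fixes f :: "'a::euclidean_space \<Rightarrow> 'a"
  assumes W: "open W" "continuous_on W f" "open (f ` W)"
  shows "nonsingular_on W f \<longleftrightarrow>
    (\<forall>B\<in>sets borel. B \<subseteq> f ` W \<longrightarrow> (emeasure lborel B = 0 \<longleftrightarrow> emeasure lborel (W \<inter> f -` B) = 0))"
proof -
  let ?\<mu> = "restrict_space lborel (f ` W)"
  let ?\<nu> = "distr (restrict_space lborel W) (restrict_space borel (f ` W)) f"
  have m: "f \<in> measurable (restrict_space lborel W) (restrict_space borel (f ` W))"
  proof (rule measurable_restrict_space2)
    show "f \<in> borel_measurable (restrict_space lborel W)"
      using borel_measurable_continuous_on_restrict[OF W(2)]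
      by (simp add: measurable_def space_restrict_space sets_restrict_space)
  qed (auto simp: space_restrict_space)
  have s: "B \<in> sets ?\<mu> \<longleftrightarrow> B \<in> sets borel \<and> B \<subseteq> f ` W"
    "B \<in> sets ?\<nu> \<longleftrightarrow> B \<in> sets borel \<and> B \<subseteq> f ` W" for B
    using W by (auto simp: sets_restrict_space_iff)
  have em: "emeasure ?\<mu> B = emeasure lborel B" if "B \<subseteq> f ` W" for B
    using that W by (simp add: emeasure_restrict_space)
  have en: "emeasure ?\<nu> B = emeasure lborel (W \<inter> f -` B)" if "B \<subseteq> f ` W" "B \<in> sets borel" for B
  proof -
    have "emeasure ?\<nu> B = emeasure (restrict_space lborel W) (f -` B \<inter> space (restrict_space lborel W))"
      by (rule emeasure_distr[OF m]) (use that s in auto)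
    also have "\<dots> = emeasure lborel (W \<inter> f -` B)"
      using W by (simp add: space_restrict_space emeasure_restrict_space Int_commute)
    finally show ?thesis .
  qed
  have nm: "B \<in> null_sets ?\<mu> \<longleftrightarrow> B \<in> sets borel \<and> B \<subseteq> f ` W \<and> emeasure lborel B = 0" for B
    unfolding null_sets_def mem_Collect_eq s using em[of B] by (metis (no_types))
  have nn: "B \<in> null_sets ?\<nu> \<longleftrightarrow> B \<in> sets borel \<and> B \<subseteq> f ` W \<and> emeasure lborel (W \<inter> f -` B) = 0" for B
    unfolding null_sets_def mem_Collect_eq s using en[of B] by (metis (no_types))
  show ?thesis
  proof
    assume "nonsingular_on W f"
    then have "null_sets ?\<mu> \<subseteq> null_sets ?\<nu>" "null_sets ?\<nu> \<subseteq> null_sets ?\<mu>"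
      unfolding nonsingular_on_def Let_def absolutely_continuous_def by simp_all
    then have "B \<in> null_sets ?\<mu> \<longleftrightarrow> B \<in> null_sets ?\<nu>" for B by blast
    then show "\<forall>B\<in>sets borel. B \<subseteq> f ` W \<longrightarrow> (emeasure lborel B = 0 \<longleftrightarrow> emeasure lborel (W \<inter> f -` B) = 0)"
      unfolding nm nn by blast
  next
    assume "\<forall>B\<in>sets borel. B \<subseteq> f ` W \<longrightarrow> (emeasure lborel B = 0 \<longleftrightarrow> emeasure lborel (W \<inter> f -` B) = 0)"
    then have "B \<in> null_sets ?\<mu> \<longleftrightarrow> B \<in> null_sets ?\<nu>" for B unfolding nm nn by blast
    then have "null_sets ?\<mu> = null_sets ?\<nu>" by blast
    then show "nonsingular_on W f" unfolding nonsingular_on_def Let_def absolutely_continuous_def by simp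
  qed
qed

lemma branch_subset:
  assumes b: "branch e \<alpha> l a W f" and U: "open U" "U \<subseteq> W"
  shows "branch e \<alpha> l a U f"
proof -
  note bD = branchD[OF b]
  have fU: "continuous_on U f" "inj_on f U"
    using U(2) bD continuous_on_subset inj_on_subset by blast+
  have fUo: "open (f ` U)" by (rule invariance_of_domain[OF fU(1) U(1) fU(2)])
  \<comment> \<open>By injectivity the points of \<open>W\<close> with image in f(U) are those of
    \<open>U\<close>, so the density for \<open>U\<close> is that of \<open>W\<close> cut off
    outside f(U).\<close>
  have eq: "U \<inter> f -` B = W \<inter> f -` (B \<inter> f ` U)" for B
    using U bD(3) by (auto simp: inj_on_def)
  from b obtain J where J: "pullback_density W f J"
    "\<And>x y. x \<in> f ` W \<Longrightarrow> y \<in> f ` W \<Longrightarrow> dist x y \<le> e \<Longrightarrow> J x \<le> exp (a * dist x y powr \<alpha>) * J y"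
    by (rule branchE) blast
  let ?J = "\<lambda>y. J y * indicator (f ` U) y"
  have pd: "pullback_density U f ?J"
    unfolding pullback_density_def
  proof (intro conjI ballI allI)
    show "?J \<in> borel_measurable borel"
      using J(1) fUo unfolding pullback_density_def by (intro borel_measurable_times borel_measurable_indicator) auto
    show "0 \<le> ?J y" for y using J(1) unfolding pullback_density_def by simp
    fix B :: "'a set" assume "B \<in> sets borel"
    then have "emeasure lborel (W \<inter> f -` (B \<inter> f ` U)) = (\<integral>\<^sup>+y. ennreal (J y) * indicator (B \<inter> f ` U) y \<partial>lborel)"
      using fUo by (intro pullback_densityD(3)[OF J(1)]) simp
    also have "\<dots> = (\<integral>\<^sup>+y. ennreal (?J y) * indicator B y \<partial>lborel)"
      by (intro nn_integral_cong) (auto simp: indicator_def)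
    finally show "emeasure lborel (U \<inter> f -` B) = (\<integral>\<^sup>+y. ennreal (?J y) * indicator B y \<partial>lborel)"
      using eq by simp
  qed
  show ?thesis
  proof (rule branchI[OF U(1) fU _ _ pd])
    show "?J x \<le> exp (a * dist x y powr \<alpha>) * ?J y" if "x \<in> f ` U" "y \<in> f ` U" "dist x y \<le> e" for x y
    proof -
      have "x \<in> f ` W" "y \<in> f ` W" using that U by auto
      then show ?thesis using J(2)[of x y] that by simp
    qed
    show "emeasure lborel B = 0 \<longleftrightarrow> emeasure lborel (U \<inter> f -` B) = 0" if B: "B \<in> sets borel" "B \<subseteq> f ` U" for B
    proof -
      have "U \<inter> f -` B = W \<inter> f -` B" using eq[of B] B by (simp add: Int_absorb2)
      moreover have "B \<subseteq> f ` W" using B U by auto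
      ultimately show ?thesis using branch_null_iff[OF b B(1)] by simp
    qed
    show "dist x y \<le> l * dist (f x) (f y)" if "x \<in> U" "y \<in> U" "dist (f x) (f y) \<le> e" for x y
      using branch_contracts[OF b] that U(2) by blast
  qed
qed

text \<open>Change of variables: the defining property identifies the push-forward of Lebesgue
  measure on \<open>W\<close> with the measure of density \<open>J\<close>, against which every
  \<open>u\<close> can be integrated.\<close>

lemma pullback_density_integral:
  assumes W: "open W" "continuous_on W f" and J: "pullback_density W f J"
    and u: "u \<in> borel_measurable borel"
  shows "(\<integral>\<^sup>+x. u (f x) * indicator W x \<partial>lborel) = (\<integral>\<^sup>+y. ennreal (J y) * u y \<partial>lborel)"
proof -
  have [measurable]: "J \<in> borel_measurable borel"
    using J unfolding pullback_density_def by blast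
  note [measurable] = u
  have m [measurable]: "f \<in> measurable (restrict_space lborel W) borel"
    using borel_measurable_continuous_on_restrict[OF W(2)]
    by (simp add: measurable_def space_restrict_space sets_restrict_space)
  have "distr (restrict_space lborel W) borel f = density lborel (\<lambda>y. ennreal (J y))"
  proof (rule measure_eqI)
    fix B assume "B \<in> sets (distr (restrict_space lborel W) borel f)"
    then have B [measurable]: "B \<in> sets borel" by simp
    have "emeasure (distr (restrict_space lborel W) borel f) B = emeasure lborel (W \<inter> f -` B)"
      using W by (simp add: emeasure_distr space_restrict_space emeasure_restrict_space Int_commute)
    also have "\<dots> = emeasure (density lborel (\<lambda>y. ennreal (J y))) B"
      using J B unfolding pullback_density_def by (simp add: emeasure_density)
    finally show "emeasure (distr (restrict_space lborel W) borel f) B = \<dots>" .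
  qed simp
  moreover have "(\<integral>\<^sup>+x. u (f x) * indicator W x \<partial>lborel) = (\<integral>\<^sup>+x. u (f x) \<partial>restrict_space lborel W)"
    using W by (simp add: nn_integral_restrict_space)
  moreover have "\<dots> = (\<integral>\<^sup>+y. u y \<partial>distr (restrict_space lborel W) borel f)"
    by (simp add: nn_integral_distr)
  moreover have "(\<integral>\<^sup>+y. u y \<partial>density lborel (\<lambda>y. ennreal (J y))) = (\<integral>\<^sup>+y. ennreal (J y) * u y \<partial>lborel)"
    by (simp add: nn_integral_density)
  ultimately show ?thesis by simp
qed

text \<open>Chain rule. Image points of \<open>g\<close> at distance d come from points at distance
  at most \<open>l'\<close> d, so the distortion of \<open>f\<close> enters as
  \<open>a * l' powr \<alpha>\<close>; the condition \<open>l' \<le> 1\<close> keeps these points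
  within \<open>e\<close>, where the estimates for \<open>f\<close> apply.\<close>

lemma branch_comp:
  assumes f: "branch e \<alpha> l a W f" and g: "branch e \<alpha> l' a' V g" and V: "f ` W \<subseteq> V"
    and l: "0 \<le> l'" "l' \<le> 1" "0 \<le> l" "0 \<le> a" "0 \<le> \<alpha>"
  shows "branch e \<alpha> (l * l') (a' + a * l' powr \<alpha>) W (g \<circ> f)"
proof -
  note fD = branchD[OF f]
  have g': "branch e \<alpha> l' a' (f ` W) g" using branch_subset[OF g fD(4) V] .
  note gD = branchD[OF g']
  obtain J where J: "pullback_density W f J"
    "\<And>x y. x \<in> f ` W \<Longrightarrow> y \<in> f ` W \<Longrightarrow> dist x y \<le> e \<Longrightarrow> J x \<le> exp (a * dist x y powr \<alpha>) * J y"
    using f by (rule branchE) blast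
  obtain H where H: "pullback_density (f ` W) g H"
    "\<And>x y. x \<in> g ` f ` W \<Longrightarrow> y \<in> g ` f ` W \<Longrightarrow> dist x y \<le> e \<Longrightarrow> H x \<le> exp (a' * dist x y powr \<alpha>) * H y"
    using g' by (rule branchE) blast
  note ns = branch_null_iff[OF f] and ns' = branch_null_iff[OF g']
  note ex = branch_contracts[OF f] and ex' = branch_contracts[OF g']
  have Jm [measurable]: "J \<in> borel_measurable borel" and J0: "\<And>y. 0 \<le> J y"
    and Hm [measurable]: "H \<in> borel_measurable borel" and H0: "\<And>y. 0 \<le> H y"
    using J(1) H(1) unfolding pullback_density_def by auto
  define k where "k = inv_into (f ` W) g"
  have k: "k (g y) = y" if "y \<in> f ` W" for y using that gD(3) unfolding k_def by simp
  have kc: "continuous_on (g ` f ` W) k"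
    by (rule continuous_on_inverse_open[OF fD(4) gD(2)]) (auto simp: k)
  \<comment> \<open>The Jacobian of the composed inverse, \<open>k\<close> being the inverse of
    \<open>g\<close>; it is set to 0 off the image, where \<open>k\<close> has no meaning.\<close>
  define JJ where "JJ z = (if z \<in> g ` f ` W then J (k z) * H z else 0)" for z
  let ?V = "g ` f ` W"
  have Jk: "(\<lambda>z. if z \<in> ?V then J (k z) else 0) \<in> borel_measurable borel"
  proof -
    have "k \<in> measurable (restrict_space borel ?V) borel"
      using borel_measurable_continuous_on_restrict[OF kc] .
    then have "(\<lambda>z. J (k z)) \<in> borel_measurable (restrict_space borel ?V)"
      using Jm by (rule measurable_compose)
    then show ?thesis using gD(4) by (simp add: measurable_restrict_space_iff)
  qed
  have JJm [measurable]: "JJ \<in> borel_measurable borel"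
  proof -
    have "JJ = (\<lambda>z. (if z \<in> ?V then J (k z) else 0) * H z)" unfolding JJ_def by auto
    then show ?thesis using Jk Hm by simp
  qed
  have exc: "\<forall>x\<in>W. \<forall>y\<in>W. dist ((g \<circ> f) x) ((g \<circ> f) y) \<le> e \<longrightarrow> dist x y \<le> l * l' * dist ((g \<circ> f) x) ((g \<circ> f) y)"
  proof (intro ballI impI)
    fix x y assume xy: "x \<in> W" "y \<in> W" "dist ((g \<circ> f) x) ((g \<circ> f) y) \<le> e"
    then have 1: "dist (f x) (f y) \<le> l' * dist (g (f x)) (g (f y))" using ex'[of "f x" "f y"] by auto
    also have "\<dots> \<le> 1 * dist (g (f x)) (g (f y))" using l by (intro mult_right_mono) auto
    finally have "dist (f x) (f y) \<le> e" using xy by simp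
    then have "dist x y \<le> l * dist (f x) (f y)" using ex xy by simp
    also have "\<dots> \<le> l * (l' * dist (g (f x)) (g (f y)))" using 1 l by (intro mult_left_mono) auto
    finally show "dist x y \<le> l * l' * dist ((g \<circ> f) x) ((g \<circ> f) y)" by (simp add: mult.assoc)
  qed
  have pd: "pullback_density W (g \<circ> f) JJ"
    unfolding pullback_density_def
  proof (intro conjI ballI allI)
    show "0 \<le> JJ z" for z unfolding JJ_def using J0 H0 by simp
    fix B :: "'a set" assume B: "B \<in> sets borel"
    let ?u = "\<lambda>z. ennreal (if z \<in> ?V then J (k z) else 0) * indicator B z"
    have um: "?u \<in> borel_measurable borel" using Jk B by measurable
    have "W \<inter> (g \<circ> f) -` B = W \<inter> f -` (f ` W \<inter> g -` B)" by auto
    then have "emeasure lborel (W \<inter> (g \<circ> f) -` B) = (\<integral>\<^sup>+y. ennreal (J y) * indicator (f ` W \<inter> g -` B) y \<partial>lborel)"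
      using pullback_densityD(3)[OF J(1) borel_Int_vimage[OF fD(4) gD(2) B]] by simp
    also have "\<dots> = (\<integral>\<^sup>+y. ?u (g y) * indicator (f ` W) y \<partial>lborel)"
      by (intro nn_integral_cong) (auto simp: indicator_def k)
    also have "\<dots> = (\<integral>\<^sup>+z. ennreal (H z) * ?u z \<partial>lborel)"
      by (rule pullback_density_integral[OF fD(4) gD(2) H(1) um])
    also have "\<dots> = (\<integral>\<^sup>+z. ennreal (JJ z) * indicator B z \<partial>lborel)"
      by (intro nn_integral_cong)
        (auto simp: indicator_def JJ_def ennreal_mult[OF J0 H0] mult.commute[of "ennreal (H _)"])
    finally show "emeasure lborel (W \<inter> (g \<circ> f) -` B) = \<dots>" .
  qed (rule JJm)
  have dist: "\<forall>x\<in>(g \<circ> f) ` W. \<forall>y\<in>(g \<circ> f) ` W. dist x y \<le> e \<longrightarrow> JJ x \<le> exp ((a' + a * l' powr \<alpha>) * dist x y powr \<alpha>) * JJ y"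
  proof (intro ballI impI)
    fix x y assume "x \<in> (g \<circ> f) ` W" "y \<in> (g \<circ> f) ` W" and d: "dist x y \<le> e"
    then obtain u v where u: "u \<in> f ` W" "x = g u" and v: "v \<in> f ` W" "y = g v" by auto
    have 1: "dist u v \<le> l' * dist x y" using ex'[OF u(1) v(1)] d u v by simp
    also have "\<dots> \<le> 1 * dist x y" using l by (intro mult_right_mono) auto
    finally have "dist u v \<le> e" using d by simp
    then have "J u \<le> exp (a * dist u v powr \<alpha>) * J v" using J(2)[OF u(1) v(1)] by simp
    also have "\<dots> \<le> exp (a * (l' powr \<alpha> * dist x y powr \<alpha>)) * J v"
    proof -
      have "dist u v powr \<alpha> \<le> (l' * dist x y) powr \<alpha>" using 1 l by (intro powr_mono2) auto
      also have "\<dots> = l' powr \<alpha> * dist x y powr \<alpha>" using l by (simp add: powr_mult)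
      finally have "a * dist u v powr \<alpha> \<le> a * (l' powr \<alpha> * dist x y powr \<alpha>)" using l by (intro mult_left_mono) auto
      then show ?thesis using J0 by (intro mult_right_mono) auto
    qed
    finally have J': "J u \<le> exp (a * (l' powr \<alpha> * dist x y powr \<alpha>)) * J v" .
    have H': "H x \<le> exp (a' * dist x y powr \<alpha>) * H y" using H(2)[of x y] u v d by simp
    have "JJ x = J u * H x" "JJ y = J v * H y" using u v k unfolding JJ_def by auto
    moreover have "J u * H x \<le> (exp (a * (l' powr \<alpha> * dist x y powr \<alpha>)) * J v) * (exp (a' * dist x y powr \<alpha>) * H y)"
      using J' H' by (rule mult_mono) (simp_all add: J0 H0)
    moreover have "\<dots> = exp ((a' + a * l' powr \<alpha>) * dist x y powr \<alpha>) * (J v * H y)"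
      by (simp add: distrib_right exp_add mult.assoc mult.left_commute)
    ultimately show "JJ x \<le> exp ((a' + a * l' powr \<alpha>) * dist x y powr \<alpha>) * JJ y" by simp
  qed
  have nsc: "\<forall>B\<in>sets borel. B \<subseteq> (g \<circ> f) ` W \<longrightarrow> (emeasure lborel B = 0 \<longleftrightarrow> emeasure lborel (W \<inter> (g \<circ> f) -` B) = 0)"
  proof (intro ballI impI)
    fix B assume B: "B \<in> sets borel" "B \<subseteq> (g \<circ> f) ` W"
    have "emeasure lborel B = 0 \<longleftrightarrow> emeasure lborel (f ` W \<inter> g -` B) = 0"
      using ns'[OF B(1)] B(2) by (auto simp: image_comp)
    also have "\<dots> \<longleftrightarrow> emeasure lborel (W \<inter> f -` (f ` W \<inter> g -` B)) = 0"
      by (rule ns[OF borel_Int_vimage[OF fD(4) gD(2) B(1)]]) simp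
    also have "W \<inter> f -` (f ` W \<inter> g -` B) = W \<inter> (g \<circ> f) -` B" by auto
    finally show "emeasure lborel B = 0 \<longleftrightarrow> emeasure lborel (W \<inter> (g \<circ> f) -` B) = 0" .
  qed
  have "continuous_on W (g \<circ> f)" using fD(2) gD(2) by (rule continuous_on_compose)
  moreover have "inj_on (g \<circ> f) W" using fD(3) gD(3) by (rule comp_inj_on)
  ultimately show ?thesis using fD(1) exc pd dist nsc by (intro branchI[of W _ _ _ JJ]) blast+
qed

lemma branch_id:
  assumes "open W" "0 \<le> a"
  shows "branch e \<alpha> 1 a W (\<lambda>x. x)"
proof -
  have "pullback_density W (\<lambda>x. x) (indicator W)"
    unfolding pullback_density_def
  proof (intro conjI ballI allI)
    show "indicat_real W \<in> borel_measurable borel" using assms by simp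
    fix B :: "'a set" assume "B \<in> sets borel"
    have "(\<integral>\<^sup>+y. ennreal (indicat_real W y) * indicator B y \<partial>lborel) = (\<integral>\<^sup>+y. indicator (W \<inter> B) y \<partial>lborel)"
      by (intro nn_integral_cong) (auto simp: indicator_def)
    then show "emeasure lborel (W \<inter> (\<lambda>x. x) -` B) = (\<integral>\<^sup>+y. ennreal (indicat_real W y) * indicator B y \<partial>lborel)"
      using \<open>B \<in> sets borel\<close> assms by simp
  qed simp
  moreover have "\<forall>x\<in>W. \<forall>y\<in>W. dist x y \<le> e \<longrightarrow> indicat_real W x \<le> exp (a * dist x y powr \<alpha>) * indicator W y"
    using assms by simp
  ultimately show ?thesis
    unfolding branch_def using assms by (auto simp: Int_absorb1)
qed

lemma branch_weaken:
  assumes "branch e \<alpha> l a W f" "l \<le> l'"  "a \<le> a'"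
  shows "branch e \<alpha> l' a' W f"
proof -
  obtain J where J: "pullback_density W f J"
    "\<And>x y. x \<in> f ` W \<Longrightarrow> y \<in> f ` W \<Longrightarrow> dist x y \<le> e \<Longrightarrow> J x \<le> exp (a * dist x y powr \<alpha>) * J y"
    using assms(1) by (rule branchE) blast
  have "J x \<le> exp (a' * dist x y powr \<alpha>) * J y" if "x \<in> f ` W" "y \<in> f ` W" "dist x y \<le> e" for x y
  proof -
    have "0 \<le> J y" using J(1) unfolding pullback_density_def by blast
    then have "exp (a * dist x y powr \<alpha>) * J y \<le> exp (a' * dist x y powr \<alpha>) * J y"
      using assms(3) by (intro mult_right_mono) (auto intro: mult_right_mono)
    then show ?thesis using J(2)[OF that] by linarith
  qed
  moreover have "dist x y \<le> l' * dist (f x) (f y)" if "x \<in> W" "y \<in> W" "dist (f x) (f y) \<le> e" for x y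
    using branch_contracts[OF assms(1) that] mult_right_mono[OF assms(2), of "dist (f x) (f y)"] by simp
  ultimately show ?thesis
    using branchD[OF assms(1)] branch_null_iff[OF assms(1)] J(1) by (intro branchI[of W f _ _ J])
qed

lemma branch_cong:
  assumes b: "branch e \<alpha> l a W f" and eq: "\<And>x. x \<in> W \<Longrightarrow> f x = g x"
  shows "branch e \<alpha> l a W g"
proof -
  obtain J where J: "pullback_density W f J"
    "\<And>x y. x \<in> f ` W \<Longrightarrow> y \<in> f ` W \<Longrightarrow> dist x y \<le> e \<Longrightarrow> J x \<le> exp (a * dist x y powr \<alpha>) * J y"
    using b by (rule branchE) blast
  have pre: "W \<inter> g -` B = W \<inter> f -` B" for B using eq by auto
  have im: "g ` W = f ` W" using eq by auto
  have "pullback_density W g J" using J(1) unfolding pullback_density_def pre .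
  moreover have "continuous_on W g" using branchD(2)[OF b] eq by (simp cong: continuous_on_cong)
  moreover have "inj_on g W" using branchD(3)[OF b] eq by (simp cong: inj_on_cong)
  moreover have "emeasure lborel B = 0 \<longleftrightarrow> emeasure lborel (W \<inter> g -` B) = 0" if "B \<in> sets borel" "B \<subseteq> g ` W" for B
    using branch_null_iff[OF b that(1)] that(2) unfolding pre im by simp
  moreover have "dist x y \<le> l * dist (g x) (g y)" if "x \<in> W" "y \<in> W" "dist (g x) (g y) \<le> e" for x y
    using branch_contracts[OF b, of x y] that eq by simp
  ultimately show ?thesis
    using branchD(1)[OF b] J(2) unfolding im[symmetric] by (intro branchI[of W g e l J])
qed

text \<open>\<open>is_jacobian\<close> tests subsets of the image in the completed measure,
  \<open>pullback_density\<close> all Borel sets in \<open>lborel\<close>. As \<open>J\<close>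
  vanishes off the image and preimages are Borel, the corresponding sides of the two identities
  agree.\<close>

lemma is_jacobian_iff:
  fixes f :: "'a::euclidean_space \<Rightarrow> 'a"
  assumes W: "open W" "continuous_on W f" "inj_on f W"
    and J: "J \<in> borel_measurable borel" "\<And>y. 0 \<le> J y" "\<And>y. y \<notin> f ` W \<Longrightarrow> J y = 0"
  shows "is_jacobian (f ` W) (inv_into W f) J \<longleftrightarrow> pullback_density W f J"
proof -
  have fW: "open (f ` W)" using W invariance_of_domain by blast
  have Jr: "J \<in> borel_measurable (restrict_space borel (f ` W))"
    using J(1) by (rule measurable_restrict_space1)
  have eq: "emeasure lebesgue (inv_into W f ` (B \<inter> f ` W)) = emeasure lborel (W \<inter> f -` B)"
    "(\<integral>\<^sup>+x\<in>(B \<inter> f ` W). ennreal (J x) \<partial>lebesgue) = (\<integral>\<^sup>+y. ennreal (J y) * indicator B y \<partial>lborel)"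
    if B: "B \<in> sets borel" for B
  proof -
    have "inv_into W f ` (B \<inter> f ` W) = W \<inter> f -` B"
      using inv_into_image_eq[OF W(3), of "B \<inter> f ` W"] by auto
    then show "emeasure lebesgue (inv_into W f ` (B \<inter> f ` W)) = emeasure lborel (W \<inter> f -` B)"
      using borel_Int_vimage[OF W(1,2) B] by simp
    show "(\<integral>\<^sup>+x\<in>(B \<inter> f ` W). ennreal (J x) \<partial>lebesgue) = (\<integral>\<^sup>+y. ennreal (J y) * indicator B y \<partial>lborel)"
      unfolding nn_integral_completion
      by (intro nn_integral_cong) (use J(3) in \<open>auto simp: indicator_def\<close>)
  qed
  show ?thesis
  proof
    assume L: "is_jacobian (f ` W) (inv_into W f) J"
    have "emeasure lborel (W \<inter> f -` B) = (\<integral>\<^sup>+y. ennreal (J y) * indicator B y \<partial>lborel)"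
      if B: "B \<in> sets borel" for B
    proof -
      have "B \<inter> f ` W \<in> sets borel" using B fW by simp
      then have "emeasure lebesgue (inv_into W f ` (B \<inter> f ` W)) = (\<integral>\<^sup>+x\<in>(B \<inter> f ` W). ennreal (J x) \<partial>lebesgue)"
        using L unfolding is_jacobian_def by blast
      then show ?thesis using eq[OF B] by simp
    qed
    then show "pullback_density W f J" unfolding pullback_density_def using J by blast
  next
    assume R: "pullback_density W f J"
    have "emeasure lebesgue (inv_into W f ` B) = (\<integral>\<^sup>+x\<in>B. ennreal (J x) \<partial>lebesgue)"
      if B: "B \<in> sets borel" "B \<subseteq> f ` W" for B
      using eq[OF B(1)] R B unfolding pullback_density_def by (simp add: Int_absorb2)
    then show "is_jacobian (f ` W) (inv_into W f) J" unfolding is_jacobian_def using J Jr by blast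
  qed
qed

lemma branch_of_piece:
  assumes A: "open A" "nonsingular_homeo_on A T"
    and ex: "\<And>x y. x \<in> T ` A \<Longrightarrow> y \<in> T ` A \<Longrightarrow> dist x y \<le> e \<Longrightarrow>
      dist (inv_into A T x) (inv_into A T y) \<le> l * dist x y"
    and J: "is_jacobian (T ` A) (inv_into A T) J"
      "\<And>x y. x \<in> T ` A \<Longrightarrow> y \<in> T ` A \<Longrightarrow> J x \<le> exp (a * dist x y powr \<alpha>) * J y"
  shows "branch e \<alpha> l a A T"
proof -
  have h: "homeomorphism A (T ` A) T (inv_into A T)" and ns: "nonsingular_on A T"
    using A(2) unfolding nonsingular_homeo_on_def by auto
  have c: "continuous_on A T" and inv: "\<And>x. x \<in> A \<Longrightarrow> inv_into A T (T x) = x"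
    using h unfolding homeomorphism_def by auto
  have inj: "inj_on T A" using inv by (metis inj_on_inverseI)
  have TA: "open (T ` A)" using invariance_of_domain A(1) c inj by blast
  define H where "H y = (if y \<in> T ` A then J y else 0)" for y
  have Hm: "H \<in> borel_measurable borel"
    using J(1) TA measurable_restrict_space_iff[of "T ` A" borel 0 borel J]
    unfolding H_def is_jacobian_def by simp
  have H0: "0 \<le> H y" for y using J(1) unfolding H_def is_jacobian_def by auto
  have "is_jacobian (T ` A) (inv_into A T) H"
  proof -
    have "H \<in> borel_measurable (restrict_space borel (T ` A))"
      using Hm by (rule measurable_restrict_space1)
    moreover have "(\<integral>\<^sup>+x\<in>B. ennreal (H x) \<partial>lebesgue) = (\<integral>\<^sup>+x\<in>B. ennreal (J x) \<partial>lebesgue)" if "B \<subseteq> T ` A" for B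
      by (intro nn_integral_cong) (use that in \<open>auto simp: H_def indicator_def\<close>)
    ultimately show ?thesis using J(1) H0 unfolding is_jacobian_def by auto
  qed
  then have "pullback_density A T H"
    using is_jacobian_iff[OF A(1) c inj Hm H0] unfolding H_def by simp
  moreover have "\<forall>x\<in>T ` A. \<forall>y\<in>T ` A. dist x y \<le> e \<longrightarrow> H x \<le> exp (a * dist x y powr \<alpha>) * H y"
    using J(2) unfolding H_def by auto
  moreover have "\<forall>x\<in>A. \<forall>y\<in>A. dist (T x) (T y) \<le> e \<longrightarrow> dist x y \<le> l * dist (T x) (T y)"
    using ex inv by fastforce
  ultimately show ?thesis
    using A(1) c inj ns nonsingular_on_iff[OF A(1) c TA] by (intro branchI[of A T _ _ H]) blast+
qed

text \<open>When the image has diameter at most \<open>e\<close>, the local estimates of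
  \<open>branch\<close> hold for all pairs of its points, which is what the distortion condition of
  a Gibbs-Markov map requires.\<close>

lemma piece_of_branch:
  assumes b: "branch e \<alpha> l a W f" and d: "\<And>x y. x \<in> f ` W \<Longrightarrow> y \<in> f ` W \<Longrightarrow> dist x y \<le> e"
  shows "nonsingular_homeo_on W f"
    and "\<forall>x\<in>f ` W. \<forall>y\<in>f ` W. dist (inv_into W f x) (inv_into W f y) \<le> l * dist x y"
    and "\<exists>J. is_jacobian (f ` W) (inv_into W f) J \<and>
        (\<forall>x\<in>f ` W. \<forall>y\<in>f ` W. J x \<le> exp (a * dist x y powr \<alpha>) * J y)"
proof -
  note bD = branchD[OF b]
  have inv: "\<And>x. x \<in> W \<Longrightarrow> inv_into W f (f x) = x" using bD(3) by simp
  have ns: "nonsingular_on W f"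
    using branch_null_iff[OF b] nonsingular_on_iff[OF bD(1,2,4)] by simp
  have "continuous_on (f ` W) (inv_into W f)"
    by (rule continuous_on_inverse_open[OF bD(1,2)]) (auto simp: inv)
  then have "homeomorphism W (f ` W) f (inv_into W f)"
    using bD inv by (intro homeomorphismI) auto
  then show "nonsingular_homeo_on W f" using ns unfolding nonsingular_homeo_on_def by blast
  show "\<forall>x\<in>f ` W. \<forall>y\<in>f ` W. dist (inv_into W f x) (inv_into W f y) \<le> l * dist x y"
    using branch_contracts[OF b] d inv by auto
  obtain J where J: "pullback_density W f J"
    "\<And>x y. x \<in> f ` W \<Longrightarrow> y \<in> f ` W \<Longrightarrow> J x \<le> exp (a * dist x y powr \<alpha>) * J y"
    using b by (rule branchE) (use d in blast)
  define H where "H y = (if y \<in> f ` W then J y else 0)" for y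
  have Jm [measurable]: "J \<in> borel_measurable borel" and J0: "\<And>y. 0 \<le> J y"
    using J(1) unfolding pullback_density_def by auto
  have Hm: "H \<in> borel_measurable borel" unfolding H_def
    using bD(4) by (intro measurable_If_set Jm) auto
  have H0: "0 \<le> H y" for y using J0 unfolding H_def by auto
  have "pullback_density W f H" unfolding pullback_density_def
  proof (intro conjI ballI allI Hm H0)
    fix B :: "'a set" assume B: "B \<in> sets borel"
    have "W \<inter> f -` B = W \<inter> f -` (B \<inter> f ` W)" by auto
    then have "emeasure lborel (W \<inter> f -` B) = (\<integral>\<^sup>+y. ennreal (J y) * indicator (B \<inter> f ` W) y \<partial>lborel)"
      using pullback_densityD(3)[OF J(1), of "B \<inter> f ` W"] B bD(4) by simp
    also have "\<dots> = (\<integral>\<^sup>+y. ennreal (H y) * indicator B y \<partial>lborel)"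
      by (intro nn_integral_cong) (auto simp: H_def indicator_def)
    finally show "emeasure lborel (W \<inter> f -` B) = \<dots>" .
  qed
  then have "is_jacobian (f ` W) (inv_into W f) H"
    using is_jacobian_iff[OF bD(1-3) Hm H0] unfolding H_def by simp
  then show "\<exists>J. is_jacobian (f ` W) (inv_into W f) J \<and>
        (\<forall>x\<in>f ` W. \<forall>y\<in>f ` W. J x \<le> exp (a * dist x y powr \<alpha>) * J y)"
    using J(2) by (intro exI[of _ H]) (auto simp: H_def)
qed

text \<open>Integrating J(x) \<le> K J(y) over x in \<open>B\<close> and y in \<open>C\<close>: up
  to the factor K, preimages occupy the same proportions as the sets themselves. The product form
  avoids dividing extended reals.\<close>

lemma branch_distortion:
  assumes b: "branch e \<alpha> l a W f" and a: "0 \<le> a" "0 \<le> \<alpha>"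
    and d: "\<And>x y. x \<in> f ` W \<Longrightarrow> y \<in> f ` W \<Longrightarrow> dist x y \<le> r" "r \<le> e"
    and B: "B \<in> sets borel" "B \<subseteq> f ` W" and C: "C \<in> sets borel" "C \<subseteq> f ` W"
  shows "emeasure lborel (W \<inter> f -` B) * emeasure lborel C
    \<le> ennreal (exp (a * r powr \<alpha>)) * (emeasure lborel B * emeasure lborel (W \<inter> f -` C))"
proof -
  note bD = branchD[OF b]
  let ?K = "exp (a * r powr \<alpha>)"
  obtain J where J: "pullback_density W f J"
    "\<And>x y. x \<in> f ` W \<Longrightarrow> y \<in> f ` W \<Longrightarrow> dist x y \<le> e \<Longrightarrow> J x \<le> exp (a * dist x y powr \<alpha>) * J y"
    using b by (rule branchE) blast
  have Jm [measurable]: "J \<in> borel_measurable borel" and J0: "\<And>y. 0 \<le> J y"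
    using J(1) unfolding pullback_density_def by auto
  have JK: "J x \<le> ?K * J y" if "x \<in> f ` W" "y \<in> f ` W" for x y
  proof -
    have "dist x y powr \<alpha> \<le> r powr \<alpha>" using d(1)[OF that] a by (intro powr_mono2) auto
    then have "exp (a * dist x y powr \<alpha>) * J y \<le> ?K * J y"
      using J0 a by (intro mult_right_mono) (auto intro: mult_left_mono)
    moreover have "J x \<le> exp (a * dist x y powr \<alpha>) * J y"
      using J(2)[OF that] d that by (meson order_trans)
    ultimately show ?thesis by linarith
  qed
  have eq: "emeasure lborel (W \<inter> f -` B) = (\<integral>\<^sup>+y. ennreal (J y) * indicator B y \<partial>lborel)"
    if "B \<in> sets borel" for B using that J(1) unfolding pullback_density_def by blast
  have x: "ennreal (J x) * emeasure lborel C \<le> ennreal ?K * emeasure lborel (W \<inter> f -` C)" if "x \<in> B" for x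
  proof -
    have "ennreal (J x) * emeasure lborel C = (\<integral>\<^sup>+y. ennreal (J x) * indicator C y \<partial>lborel)"
      using C by (simp add: nn_integral_cmult_indicator)
    also have "\<dots> \<le> (\<integral>\<^sup>+y. ennreal ?K * (ennreal (J y) * indicator C y) \<partial>lborel)"
    proof (intro nn_integral_mono)
      fix y
      have "ennreal (J x) \<le> ennreal ?K * ennreal (J y)" if "y \<in> C"
        using JK[of x y] \<open>x \<in> B\<close> that B C J0 by (auto simp: ennreal_mult[symmetric] intro!: ennreal_leI)
      then show "ennreal (J x) * indicator C y \<le> ennreal ?K * (ennreal (J y) * indicator C y)"
        by (auto simp: indicator_def)
    qed
    also have "\<dots> = ennreal ?K * emeasure lborel (W \<inter> f -` C)"
      using C by (subst nn_integral_cmult) (auto simp: eq)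
    finally show ?thesis .
  qed
  have "emeasure lborel (W \<inter> f -` B) * emeasure lborel C
      = (\<integral>\<^sup>+x. (ennreal (J x) * indicator B x) * emeasure lborel C \<partial>lborel)"
    using B by (subst nn_integral_multc) (auto simp: eq)
  also have "\<dots> \<le> (\<integral>\<^sup>+x. (ennreal ?K * emeasure lborel (W \<inter> f -` C)) * indicator B x \<partial>lborel)"
    by (intro nn_integral_mono) (auto simp: indicator_def x)
  also have "\<dots> = (ennreal ?K * emeasure lborel (W \<inter> f -` C)) * emeasure lborel B"
    using B by (simp add: nn_integral_cmult_indicator)
  finally show ?thesis by (simp add: mult.commute mult.left_commute)
qed

text \<open>A Lebesgue null set need not be Borel, so it is first enclosed in a Borel null set,
  whose preimage is measured by the density.\<close>

lemma branch_null:
  assumes b: "branch e \<alpha> l a W f" and Z: "Z \<in> null_sets lebesgue"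
  shows "W \<inter> f -` Z \<in> null_sets lebesgue"
proof -
  note bD = branchD[OF b]
  obtain Z' where Z': "Z \<subseteq> Z'" "Z' \<in> null_sets lborel"
    using Z by (auto simp: null_sets_completion_iff2)
  obtain J where J: "pullback_density W f J" using b by (rule branchE) blast
  have "emeasure lborel (W \<inter> f -` Z') = (\<integral>\<^sup>+y. ennreal (J y) * indicator Z' y \<partial>lborel)"
    using Z'(2) by (intro pullback_densityD(3)[OF J]) auto
  also have "\<dots> = 0" using Z'(2) by (rule nn_integral_null_set)
  finally have n: "W \<inter> f -` Z' \<in> null_sets lborel"
    using borel_Int_vimage[OF bD(1,2), of Z'] Z'(2) by (simp add: null_sets_def)
  have sub: "W \<inter> f -` Z \<subseteq> W \<inter> f -` Z'" using Z'(1) by auto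
  show ?thesis by (rule null_sets_completion_subset[OF sub null_sets_completionI[OF n]])
qed

section \<open>Cells with thin boundaries\<close>

text \<open>The second factor is what averaging over the interval from \<open>a\<close> to
  \<open>b\<close> yields, the first is the price of rounding a width up to a power of 1/2.\<close>

definition thin_const :: "real \<Rightarrow> real \<Rightarrow> real \<Rightarrow> real" where
  "thin_const \<beta> a b = 2 powr \<beta> * (4 / ((1 - 2 powr (\<beta> - 1)) * (b - a)))"

lemma thin_const_nonneg: "\<beta> < 1 \<Longrightarrow> a < b \<Longrightarrow> 0 \<le> thin_const \<beta> a b"
proof -
  assume "\<beta> < 1" "a < b"
  moreover have "2 powr (\<beta> - 1) < 2 powr 0" using \<open>\<beta> < 1\<close> by (intro powr_less_mono) auto
  ultimately show ?thesis unfolding thin_const_def by simp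
qed

text \<open>Averaging over t: by Fubini the mass within r of level t integrates over all t to 2 r
  times the total mass. Weighting the width 2^(-k) by 2^(k \<beta>) and summing over k leaves a
  geometric series of ratio 2^(\<beta> - 1) < 1, so some t in the interval is good for all dyadic
  widths at once; other widths are rounded up.\<close>

lemma exists_thin_level:
  fixes \<mu> :: "'b measure" and \<phi> :: "'b \<Rightarrow> real"
  assumes \<mu>: "finite_measure \<mu>" and \<phi> [measurable]: "\<phi> \<in> borel_measurable \<mu>"
    and ab: "a < b" and \<beta>: "0 < \<beta>" "\<beta> < 1"
  obtains t where "a < t" "t < b"
    "\<And>\<epsilon>. 0 < \<epsilon> \<Longrightarrow> \<epsilon> \<le> 1 \<Longrightarrow> emeasure \<mu> {y \<in> space \<mu>. \<bar>\<phi> y - t\<bar> < \<epsilon>}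
        \<le> ennreal (thin_const \<beta> a b * \<epsilon> powr \<beta>) * emeasure \<mu> (space \<mu>)"
proof -
  interpret \<mu>: finite_measure \<mu> by (rule \<mu>)
  interpret P: pair_sigma_finite \<mu> "lborel :: real measure" ..
  define m where "m = measure \<mu> (space \<mu>)"
  have m: "emeasure \<mu> (space \<mu>) = ennreal m" "0 \<le> m"
    unfolding m_def by (simp_all add: \<mu>.emeasure_eq_measure)
  define q :: real where "q = 2 powr (\<beta> - 1)"
  have "2 powr (\<beta> - 1) < 2 powr (0::real)" using \<beta> by (intro powr_less_mono) auto
  then have q: "0 < q" "q < 1" unfolding q_def by auto
  define h where "h r t = emeasure \<mu> {y \<in> space \<mu>. \<bar>\<phi> y - t\<bar> < r}" for r t :: real
  have h_eq: "h r t = (\<integral>\<^sup>+y. indicator {z. \<bar>fst z - snd z\<bar> < r} (\<phi> y, t) \<partial>\<mu>)" for r t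
  proof -
    have "h r t = (\<integral>\<^sup>+y. indicator {y \<in> space \<mu>. \<bar>\<phi> y - t\<bar> < r} y \<partial>\<mu>)"
      unfolding h_def by simp
    also have "\<dots> = (\<integral>\<^sup>+y. indicator {z. \<bar>fst z - snd z\<bar> < r} (\<phi> y, t) \<partial>\<mu>)"
      by (intro nn_integral_cong) (auto simp: indicator_def)
    finally show ?thesis .
  qed
  have [measurable]: "{z::real \<times> real. \<bar>fst z - snd z\<bar> < r} \<in> sets borel" for r :: real
  proof -
    have "open {z::real \<times> real. \<bar>fst z - snd z\<bar> < r}"
      by (intro open_Collect_less continuous_intros)
    then show ?thesis by simp
  qed
  have im: "(\<lambda>(y, t). indicator {z. \<bar>fst z - snd z\<bar> < r} (\<phi> y, t) :: ennreal) \<in> borel_measurable (\<mu> \<Otimes>\<^sub>M lborel)" for r :: real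
  proof -
    have "(\<lambda>z. (\<phi> (fst z), snd z)) \<in> borel_measurable (\<mu> \<Otimes>\<^sub>M (lborel :: real measure))"
      by (intro borel_measurable_Pair) measurable
    then have "(\<lambda>z. indicator {z. \<bar>fst z - snd z\<bar> < r} (\<phi> (fst z), snd z) :: ennreal) \<in> borel_measurable (\<mu> \<Otimes>\<^sub>M lborel)"
      by (rule measurable_compose) simp
    then show ?thesis by (simp add: case_prod_beta')
  qed
  have hm [measurable]: "h r \<in> borel_measurable borel" for r
  proof -
    have "(\<lambda>t. \<integral>\<^sup>+y. indicator {z. \<bar>fst z - snd z\<bar> < r} (\<phi> y, t) \<partial>\<mu>) \<in> borel_measurable lborel"
      by (rule \<mu>.borel_measurable_nn_integral) (use measurable_pair_swap[OF im[of r]] in \<open>simp add: case_prod_beta'\<close>)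
    then show ?thesis unfolding h_eq[abs_def] by simp
  qed
  have hint: "(\<integral>\<^sup>+t. h r t \<partial>lborel) = ennreal (2 * r * m)" if "0 < r" for r
  proof -
    have "(\<integral>\<^sup>+t. h r t \<partial>lborel) = (\<integral>\<^sup>+y. (\<integral>\<^sup>+t. indicator {z. \<bar>fst z - snd z\<bar> < r} (\<phi> y, t) \<partial>lborel) \<partial>\<mu>)"
      unfolding h_eq using P.Fubini[OF im[of r]] by simp
    also have "\<dots> = (\<integral>\<^sup>+y. ennreal (2 * r) \<partial>\<mu>)"
    proof (intro nn_integral_cong)
      fix y
      have "(\<integral>\<^sup>+t. indicator {z. \<bar>fst z - snd z\<bar> < r} (\<phi> y, t) \<partial>lborel) = (\<integral>\<^sup>+t. indicator {\<phi> y - r <..< \<phi> y + r} t \<partial>lborel)"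
        by (intro nn_integral_cong) (auto simp: indicator_def)
      also have "\<dots> = ennreal (2 * r)" using that by simp
      finally show "(\<integral>\<^sup>+t. indicator {z. \<bar>fst z - snd z\<bar> < r} (\<phi> y, t) \<partial>lborel) = ennreal (2 * r)" .
    qed
    also have "\<dots> = ennreal (2 * r * m)" using that m by (simp add: ennreal_mult)
    finally show ?thesis .
  qed
  define g where "g t = (\<Sum>k. ennreal (2 powr (k * \<beta>)) * h ((1/2)^k) t)" for t
  have gint: "(\<integral>\<^sup>+t. g t \<partial>lborel) = ennreal (2 * m / (1 - q))"
  proof -
    have "(\<integral>\<^sup>+t. g t \<partial>lborel) = (\<Sum>k. ennreal (2 powr (k * \<beta>)) * ennreal (2 * (1/2)^k * m))"
      unfolding g_def by (simp add: nn_integral_suminf nn_integral_cmult hint)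
    also have "\<dots> = (\<Sum>k. ennreal (2 * m * q ^ k))"
    proof -
      have "ennreal (2 powr (k * \<beta>)) * ennreal (2 * (1/2)^k * m) = ennreal (2 * m * q ^ k)" for k :: nat
      proof -
        have "q ^ k = 2 powr (real k * (\<beta> - 1))" 
          using q(1) powr_realpow[of q k] unfolding q_def by (simp add: powr_powr mult.commute)
        also have "\<dots> = 2 powr (k * \<beta>) * (1/2)^k"
          by (simp add: right_diff_distrib powr_diff powr_realpow power_one_over)
        finally show ?thesis using m by (simp add: ennreal_mult[symmetric] mult_ac)
      qed
      then show ?thesis by simp
    qed
    also have "\<dots> = ennreal (\<Sum>k. 2 * m * q ^ k)"
      using q m by (intro suminf_ennreal2) (auto intro: summable_mult summable_geometric)
    also have "(\<Sum>k. 2 * m * q ^ k) = 2 * m / (1 - q)"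
      using q by (simp add: suminf_mult suminf_geometric summable_geometric)
    finally show ?thesis .
  qed
  \<comment> \<open>Twice the total integral of \<open>g\<close> divided by the length of the
    interval: for positive mass \<open>g\<close> cannot stay above it throughout.\<close>
  define K where "K = 4 * m / ((1 - q) * (b - a))"
  have K0: "0 \<le> K" unfolding K_def using q m ab by simp
  \<comment> \<open>Doubling gives a contradiction only for positive mass; for mass 0 every level
    will do.\<close>
  have "\<exists>t. a < t \<and> t < b \<and> (m = 0 \<or> g t \<le> ennreal K)"
  proof (cases "m = 0")
    case True
    then show ?thesis using ab dense[of a b] by blast
  next
    case False
    then have m0: "0 < m" using m by simp
    show ?thesis
    proof (rule ccontr)
      assume "\<not> ?thesis"
      then have gt: "\<And>t. a < t \<Longrightarrow> t < b \<Longrightarrow> ennreal K \<le> g t" using False by (meson linear)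
      have "ennreal (K * (b - a)) = (\<integral>\<^sup>+t. ennreal K * indicator {a<..<b} t \<partial>lborel)"
        using K0 ab by (simp add: nn_integral_cmult_indicator ennreal_mult)
      also have "\<dots> \<le> (\<integral>\<^sup>+t. g t \<partial>lborel)"
        by (intro nn_integral_mono) (auto simp: indicator_def gt)
      also have "\<dots> = ennreal (2 * m / (1 - q))" by (rule gint)
      finally have "K * (b - a) \<le> 2 * m / (1 - q)" using q m by (simp add: ennreal_le_iff)
      moreover have "K * (b - a) = 2 * (2 * m / (1 - q))" unfolding K_def using ab by simp
      moreover have "0 < 2 * m / (1 - q)" using m0 q by simp
      ultimately show False by linarith
    qed
  qed
  then obtain t where t: "a < t" "t < b" "m = 0 \<or> g t \<le> ennreal K" by blast
  have "h \<epsilon> t \<le> ennreal (thin_const \<beta> a b * \<epsilon> powr \<beta>) * ennreal m" if \<epsilon>: "0 < \<epsilon>" "\<epsilon> \<le> 1" for \<epsilon>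
  proof (cases "m = 0")
    case True
    have "h \<epsilon> t \<le> emeasure \<mu> (space \<mu>)" unfolding h_def by (intro emeasure_mono) auto
    then show ?thesis using True m by simp
  next
    case False
    then have gK: "g t \<le> ennreal K" using t by simp
    \<comment> \<open>With \<open>n = Suc k\<close> minimal, \<epsilon> lies between 2^(-k-1) and
      2^(-k): the collar is enlarged to the dyadic width 2^(-k), and (2 \<epsilon> 2^k)^\<beta> is
      at least 1.\<close>
    define n where "n = (LEAST n. (1/2::real)^n < \<epsilon>)"
    have ex: "\<exists>n. (1/2::real)^n < \<epsilon>" using \<epsilon> real_arch_pow_inv[of \<epsilon> "1/2"] by auto
    have n: "(1/2)^n < \<epsilon>" unfolding n_def using ex by (rule LeastI_ex)
    have "n \<noteq> 0" using n \<epsilon> by (intro notI) simp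
    then obtain k where k: "n = Suc k" by (cases n) auto
    have k2: "\<epsilon> \<le> (1/2)^k" using not_less_Least[of k "\<lambda>n. (1/2::real)^n < \<epsilon>"] k unfolding n_def by simp
    have k3: "1 \<le> (2 * \<epsilon>) powr \<beta> * 2 powr (k * \<beta>)"
    proof -
      have "1 \<le> (2 * \<epsilon>) * 2 ^ k" using n unfolding k by (simp add: field_simps power_one_over)
      then have "1 powr \<beta> \<le> ((2 * \<epsilon>) * 2 ^ k) powr \<beta>" using \<beta> by (intro powr_mono2) auto
      also have "\<dots> = (2 * \<epsilon>) powr \<beta> * (2 ^ k) powr \<beta>" using \<epsilon> by (simp add: powr_mult)
      also have "(2 ^ k) powr \<beta> = 2 powr (k * \<beta>)" by (simp add: powr_powr[symmetric] powr_realpow)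
      finally show ?thesis by simp
    qed
    have "h \<epsilon> t \<le> h ((1/2)^k) t" unfolding h_def using k2 by (intro emeasure_mono) auto
    also have "\<dots> \<le> ennreal ((2 * \<epsilon>) powr \<beta> * 2 powr (k * \<beta>)) * h ((1/2)^k) t"
      using k3 mult_right_mono[of 1 "ennreal ((2 * \<epsilon>) powr \<beta> * 2 powr (k * \<beta>))" "h ((1/2)^k) t"]
      by (simp add: ennreal_leI)
    also have "\<dots> = ennreal ((2 * \<epsilon>) powr \<beta>) * (ennreal (2 powr (k * \<beta>)) * h ((1/2)^k) t)"
      by (simp add: ennreal_mult mult.assoc)
    also have "\<dots> \<le> ennreal ((2 * \<epsilon>) powr \<beta>) * g t"
    proof (intro mult_left_mono)
      have "(\<Sum>k\<in>{k}. ennreal (2 powr (k * \<beta>)) * h ((1/2)^k) t) \<le> g t"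
        unfolding g_def by (intro sum_le_suminf) auto
      then show "ennreal (2 powr (k * \<beta>)) * h ((1/2)^k) t \<le> g t" by simp
    qed simp
    also have "\<dots> \<le> ennreal ((2 * \<epsilon>) powr \<beta>) * ennreal K" using gK by (intro mult_left_mono) auto
    also have "\<dots> = ennreal (thin_const \<beta> a b * \<epsilon> powr \<beta> * m)"
      using \<epsilon> K0 unfolding thin_const_def K_def q_def
      by (simp add: ennreal_mult[symmetric] powr_mult mult_ac)
    also have "\<dots> = ennreal (thin_const \<beta> a b * \<epsilon> powr \<beta>) * ennreal m"
      using m thin_const_nonneg[OF \<beta>(2) ab] by (simp add: ennreal_mult)
    finally show ?thesis .
  qed
  then show thesis using t that m unfolding h_def by auto
qed

text \<open>Cells may stick out of \<open>X\<close> and may be empty; where they are used, they are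
  intersected with \<open>X\<close> or with an image and empty sets are dropped. The single set
  \<Gamma> contains all cell boundaries, so one estimate near \<Gamma> covers every cell.\<close>

definition cell_system :: "'a::euclidean_space set \<Rightarrow> real \<Rightarrow> 'a set set \<Rightarrow> 'a set \<Rightarrow> bool" where
  "cell_system X s \<C> \<Gamma> \<longleftrightarrow>
     finite \<C> \<and> disjoint \<C> \<and> (\<forall>Q\<in>\<C>. open Q \<and> frontier Q \<subseteq> \<Gamma> \<and> (\<forall>x\<in>Q. \<forall>y\<in>Q. dist x y \<le> s)) \<and>
     X \<subseteq> \<Union>\<C> \<union> \<Gamma> \<and> \<Gamma> \<in> null_sets lebesgue"

lemma cell_systemD:
  assumes "cell_system X s \<C> \<Gamma>"
  shows "finite \<C>" "disjoint \<C>" "Q \<in> \<C> \<Longrightarrow> open Q" "Q \<in> \<C> \<Longrightarrow> frontier Q \<subseteq> \<Gamma>"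
    "Q \<in> \<C> \<Longrightarrow> x \<in> Q \<Longrightarrow> y \<in> Q \<Longrightarrow> dist x y \<le> s" "X \<subseteq> \<Union>\<C> \<union> \<Gamma>" "\<Gamma> \<in> null_sets lebesgue"
  using assms unfolding cell_system_def by simp_all

text \<open>The cells are cut out of finitely many balls. The radii may depend on \<open>\<mu>\<close>, so that no mass
  accumulates near the cuts, but the constant \<open>C\<close> does not.\<close>

lemma cells_exist:
  fixes X :: "'a::euclidean_space set"
  assumes X: "bounded X" and s: "0 < s" and \<beta>: "0 < \<beta>" "\<beta> < 1"
  obtains C :: real where "0 \<le> C"
    "\<And>\<mu> :: 'a measure. finite_measure \<mu> \<Longrightarrow> sets \<mu> = sets borel \<Longrightarrow>
      \<exists>\<C> \<Gamma>. cell_system X s \<C> \<Gamma> \<and>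
        (\<forall>\<epsilon>. 0 < \<epsilon> \<and> \<epsilon> \<le> 1 \<longrightarrow> emeasure \<mu> {y. \<exists>z\<in>\<Gamma>. dist y z < \<epsilon>} \<le> ennreal (C * \<epsilon> powr \<beta>) * emeasure \<mu> UNIV)"
proof -
  have "\<exists>F. finite F \<and> X \<subseteq> (\<Union>x\<in>F. ball x (s/4))"
  proof -
    have "compact (closure X)" using X by simp
    moreover have "closure X \<subseteq> (\<Union>x\<in>closure X. ball x (s/4))" using s by force
    ultimately obtain F where "F \<subseteq> closure X" "finite F" "closure X \<subseteq> (\<Union>x\<in>F. ball x (s/4))"
      using compactE_image[of "closure X" "closure X" "\<lambda>x. ball x (s/4)"] by auto
    then show ?thesis using closure_subset by blast
  qed
  then obtain F where F: "finite F" "X \<subseteq> (\<Union>x\<in>F. ball x (s/4))" by blast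
  obtain x and L :: nat where xL: "F = x ` {i. i < L}" using F(1) finite_imp_nat_seg_image_inj_on by metis
  have L: "{i. i < L} = {..<L}" by auto
  \<comment> \<open>One thin sphere for each of the \<open>L\<close> balls; the covering is chosen
    before any measure is given.\<close>
  define C where "C = real L * thin_const \<beta> (s/4) (s/2)"
  have T0: "0 \<le> thin_const \<beta> (s/4) (s/2)" using thin_const_nonneg[OF \<beta>(2)] s by simp
  have "0 \<le> C" unfolding C_def using T0 by simp
  moreover have "\<exists>\<C> \<Gamma>. cell_system X s \<C> \<Gamma> \<and>
        (\<forall>\<epsilon>. 0 < \<epsilon> \<and> \<epsilon> \<le> 1 \<longrightarrow> emeasure \<mu> {y. \<exists>z\<in>\<Gamma>. dist y z < \<epsilon>} \<le> ennreal (C * \<epsilon> powr \<beta>) * emeasure \<mu> UNIV)"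
    if \<mu>: "finite_measure \<mu>" "sets \<mu> = sets borel" for \<mu> :: "'a measure"
  proof -
    have sp: "space \<mu> = UNIV" using sets_eq_imp_space_eq[OF \<mu>(2)] by simp
    have "\<exists>r. s/4 < r \<and> r < s/2 \<and> (\<forall>\<epsilon>. 0 < \<epsilon> \<and> \<epsilon> \<le> 1 \<longrightarrow> emeasure \<mu> {y. \<bar>dist p y - r\<bar> < \<epsilon>}
        \<le> ennreal (thin_const \<beta> (s/4) (s/2) * \<epsilon> powr \<beta>) * emeasure \<mu> UNIV)" for p
    proof -
      have "(\<lambda>y. dist p y) \<in> borel_measurable borel" by (intro borel_measurable_continuous_onI continuous_intros)
      then have "(\<lambda>y. dist p y) \<in> borel_measurable \<mu>" using \<mu>(2) measurable_cong_sets by blast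
      then show ?thesis
        using s by (elim exists_thin_level[OF \<mu>(1) _ _ \<beta>, of "\<lambda>y. dist p y" "s/4" "s/2"]) (auto simp: sp)
    qed
    then obtain r where r: "\<And>p. s/4 < r p" "\<And>p. r p < s/2"
      "\<And>p \<epsilon>. 0 < \<epsilon> \<Longrightarrow> \<epsilon> \<le> 1 \<Longrightarrow> emeasure \<mu> {y. \<bar>dist p y - r p\<bar> < \<epsilon>}
        \<le> ennreal (thin_const \<beta> (s/4) (s/2) * \<epsilon> powr \<beta>) * emeasure \<mu> UNIV" by metis
    \<comment> \<open>The part of a ball outside all earlier closed balls. Radii above s/4 still
      cover \<open>X\<close>, radii below s/2 keep diameters at most \<open>s\<close>, and every
      boundary point lies on one of the spheres.\<close>
    define c where "c j = ball (x j) (r (x j)) - (\<Union>i<j. cball (x i) (r (x i)))" for j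
    define \<Gamma> where "\<Gamma> = (\<Union>i<L. sphere (x i) (r (x i)))"
    have r0: "0 < r p" for p using r(1)[of p] s by linarith
    have op: "open (c j)" for j unfolding c_def by (intro open_Diff closed_UN) auto
    have fr: "frontier (c j) \<subseteq> \<Gamma>" if "j < L" for j
    proof -
      have "frontier (c j) \<subseteq> frontier (ball (x j) (r (x j))) \<union> frontier (- (\<Union>i<j. cball (x i) (r (x i))))"
        unfolding c_def Diff_eq using frontier_Int_subset by blast
      also have "frontier (- (\<Union>i<j. cball (x i) (r (x i)))) = frontier (\<Union>i<j. cball (x i) (r (x i)))"
        by (rule frontier_complement)
      also have "\<dots> \<subseteq> (\<Union>i<j. frontier (cball (x i) (r (x i))))"
        using frontier_Union_subset[of "(\<lambda>i. cball (x i) (r (x i))) ` {..<j}"] by auto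
      finally have "frontier (c j) \<subseteq> sphere (x j) (r (x j)) \<union> (\<Union>i<j. sphere (x i) (r (x i)))"
        using r0 by auto
      then show ?thesis unfolding \<Gamma>_def using that by fastforce
    qed
    have dj: "c i \<inter> c j = {}" if "i < j" for i j
      using that ball_subset_cball[of "x i" "r (x i)"] unfolding c_def by blast
    have "disjoint (c ` {..<L})"
    proof (rule pairwiseI)
      fix A B assume "A \<in> c ` {..<L}" "B \<in> c ` {..<L}" "A \<noteq> B"
      then obtain i j where "A = c i" "B = c j" "i \<noteq> j" by blast
      then show "disjnt A B" using dj[of i j] dj[of j i] unfolding disjnt_def by (metis Int_commute linorder_neqE_nat)
    qed
    moreover have "X \<subseteq> \<Union>(c ` {..<L}) \<union> \<Gamma>"
    proof
      fix y assume "y \<in> X"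
      then obtain i0 where "i0 < L" "y \<in> ball (x i0) (s/4)" using F(2) unfolding xL by auto
      then have "i0 < L \<and> y \<in> cball (x i0) (r (x i0))" using r(1)[of "x i0"] by simp
      then have ex: "\<exists>i. i < L \<and> y \<in> cball (x i) (r (x i))" by blast
      define j where "j = (LEAST i. i < L \<and> y \<in> cball (x i) (r (x i)))"
      have j: "j < L" "y \<in> cball (x j) (r (x j))" unfolding j_def using LeastI_ex[OF ex] by auto
      have "y \<notin> cball (x i) (r (x i))" if "i < j" for i
        using not_less_Least[of i "\<lambda>i. i < L \<and> y \<in> cball (x i) (r (x i))"] that j(1) unfolding j_def by auto
      then have "y \<in> c j \<or> y \<in> sphere (x j) (r (x j))" using j(2) unfolding c_def by auto
      then show "y \<in> \<Union>(c ` {..<L}) \<union> \<Gamma>" using j(1) unfolding \<Gamma>_def by auto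
    qed
    moreover have "\<forall>u\<in>c j. \<forall>v\<in>c j. dist u v \<le> s" for j
    proof (intro ballI)
      fix u v assume "u \<in> c j" "v \<in> c j"
      then have "dist (x j) u < r (x j)" "dist (x j) v < r (x j)" unfolding c_def by auto
      then show "dist u v \<le> s" using dist_triangle[of u v "x j"] r(2)[of "x j"] by (simp add: dist_commute)
    qed
    moreover have "\<Gamma> \<in> null_sets lebesgue"
      unfolding \<Gamma>_def using negligible_sphere by (intro null_sets_UN') (auto simp: negligible_iff_null_sets)
    moreover have "emeasure \<mu> {y. \<exists>z\<in>\<Gamma>. dist y z < \<epsilon>} \<le> ennreal (C * \<epsilon> powr \<beta>) * emeasure \<mu> UNIV"
      if \<epsilon>: "0 < \<epsilon>" "\<epsilon> \<le> 1" for \<epsilon>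
    proof -
      have opn: "open {y. \<bar>dist p y - r p\<bar> < \<epsilon>}" for p
        by (intro open_Collect_less continuous_intros)
      \<comment> \<open>A point within \<epsilon> of a sphere has distance to the centre within
        \<epsilon> of the radius, which is the event made thin.\<close>
      have "{y. \<exists>z\<in>\<Gamma>. dist y z < \<epsilon>} \<subseteq> (\<Union>i<L. {y. \<bar>dist (x i) y - r (x i)\<bar> < \<epsilon>})"
      proof
        fix y assume "y \<in> {y. \<exists>z\<in>\<Gamma>. dist y z < \<epsilon>}"
        then obtain i z where "i < L" "dist (x i) z = r (x i)" "dist y z < \<epsilon>" unfolding \<Gamma>_def by auto
        moreover have "\<bar>dist (x i) y - dist (x i) z\<bar> \<le> dist y z"
          using dist_triangle[of "x i" y z] dist_triangle[of "x i" z y] by (simp add: dist_commute)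
        ultimately show "y \<in> (\<Union>i<L. {y. \<bar>dist (x i) y - r (x i)\<bar> < \<epsilon>})" by force
      qed
      then have "emeasure \<mu> {y. \<exists>z\<in>\<Gamma>. dist y z < \<epsilon>} \<le> emeasure \<mu> (\<Union>i<L. {y. \<bar>dist (x i) y - r (x i)\<bar> < \<epsilon>})"
        using opn by (intro emeasure_mono) (auto simp: \<mu>(2))
      also have "\<dots> \<le> (\<Sum>i<L. emeasure \<mu> {y. \<bar>dist (x i) y - r (x i)\<bar> < \<epsilon>})"
        using opn by (intro emeasure_subadditive_finite) (auto simp: \<mu>(2))
      also have "\<dots> \<le> (\<Sum>i<L. ennreal (thin_const \<beta> (s/4) (s/2) * \<epsilon> powr \<beta>) * emeasure \<mu> UNIV)"
        using r(3)[OF \<epsilon>] by (intro sum_mono)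
      also have "\<dots> = ennreal (C * \<epsilon> powr \<beta>) * emeasure \<mu> UNIV"
        unfolding C_def using T0 by (simp add: ennreal_mult ennreal_of_nat_eq_real_of_nat mult.assoc)
      finally show ?thesis .
    qed
    ultimately show ?thesis
      using op fr unfolding cell_system_def by (intro exI[of _ "c ` {..<L}"] exI[of _ \<Gamma>]) auto
  qed
  ultimately show thesis by (rule that)
qed

section \<open>Collars of families of pieces\<close>

lemma infdist_less_iff:
  assumes "A \<noteq> {}"
  shows "infdist x A < r \<longleftrightarrow> (\<exists>z\<in>A. dist x z < r)"
proof
  assume "infdist x A < r"
  then show "\<exists>z\<in>A. dist x z < r"
    using assms by (simp add: infdist_notempty cINF_less_iff[OF assms bdd_belowI2[of _ 0]])
next
  assume "\<exists>z\<in>A. dist x z < r"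
  then show "infdist x A < r" using infdist_le le_less_trans by blast
qed

lemma frontier_nonempty:
  fixes S :: "'a::euclidean_space set"
  assumes "S \<noteq> {}" "bounded S"
  shows "frontier S \<noteq> {}"
  using assms not_bounded_UNIV frontier_eq_empty by metis

lemma open_inner_collar:
  assumes "open I"
  shows "open (inner_collar \<delta> I)"
proof -
  have "inner_collar \<delta> I = I \<inter> {y. infdist y (frontier I) < \<delta>}" unfolding inner_collar_def by auto
  moreover have "open {y. infdist y (frontier I) < \<delta>}" by (intro open_Collect_less continuous_intros)
  ultimately show ?thesis using assms by auto
qed

lemma emeasure_open_pos:
  fixes S :: "'a::euclidean_space set"
  assumes "open S" "S \<noteq> {}"
  shows "0 < emeasure lborel S"
proof -
  have "\<not> negligible S" using open_not_negligible assms by blast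
  then have "emeasure lebesgue S \<noteq> 0"
    using assms(1) by (auto simp: negligible_iff_null_sets null_sets_def)
  then show ?thesis using assms(1) by (simp add: zero_less_iff_neq_zero)
qed

lemma ennreal_sum_le_infsum:
  fixes f :: "'b \<Rightarrow> ennreal"
  assumes "finite B" "B \<subseteq> A"
  shows "sum f B \<le> infsum f A"
proof -
  have "infsum f B \<le> infsum f A"
    using assms(2) by (intro infsum_mono_neutral nonneg_summable_on_complete) auto
  then show ?thesis using assms(1) by simp
qed

text \<open>The complexity condition bounds an \<open>infsum\<close>, hence all finite partial sums;
  this passes from them to a countable union.\<close>

lemma emeasure_UN_le:
  assumes I: "countable I" and X: "\<And>i. i \<in> I \<Longrightarrow> X i \<in> sets M"
    and B: "\<And>F. finite F \<Longrightarrow> F \<subseteq> I \<Longrightarrow> (\<Sum>i\<in>F. emeasure M (X i)) \<le> B"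
  shows "emeasure M (\<Union>i\<in>I. X i) \<le> B"
proof -
  define F where "F k = {i \<in> I. to_nat_on I i < k}" for k
  have fin: "finite (F k)" for k
  proof (rule finite_imageD)
    show "inj_on (to_nat_on I) (F k)" using inj_on_to_nat_on[OF I] by (rule inj_on_subset) (auto simp: F_def)
    show "finite (to_nat_on I ` F k)" by (rule finite_subset[of _ "{..<k}"]) (auto simp: F_def)
  qed
  define Y where "Y k = (\<Union>i\<in>F k. X i)" for k
  have Ym: "range Y \<subseteq> sets M" unfolding Y_def using X fin by (auto simp: F_def intro!: sets.finite_UN)
  have "incseq Y" unfolding Y_def F_def by (intro incseq_SucI) fastforce
  then have "emeasure M (\<Union>k. Y k) = (SUP k. emeasure M (Y k))" using SUP_emeasure_incseq[OF Ym] by simp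
  moreover have "(\<Union>k. Y k) = (\<Union>i\<in>I. X i)" unfolding Y_def F_def by auto
  moreover have "emeasure M (Y k) \<le> B" for k
  proof -
    have "emeasure M (Y k) \<le> (\<Sum>i\<in>F k. emeasure M (X i))"
      unfolding Y_def using fin X by (intro emeasure_subadditive_finite) (auto simp: F_def)
    also have "\<dots> \<le> B" using fin by (intro B) (auto simp: F_def)
    finally show ?thesis .
  qed
  ultimately show ?thesis by (simp add: SUP_least)
qed

text \<open>Passes from single pieces to a family: disjoint open pieces are countably many, so both
  sides add up over them.\<close>

lemma emeasure_le_piecewise:
  fixes \<W> :: "'a::euclidean_space set set"
  assumes \<W>: "disjoint \<W>" "\<And>W. W \<in> \<W> \<Longrightarrow> open W"
    and E: "E \<subseteq> \<Union>\<W>" "E \<in> sets borel" and F: "F \<in> sets borel"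
    and le: "\<And>W. W \<in> \<W> \<Longrightarrow> emeasure lborel (E \<inter> W) \<le> c * emeasure lborel (F \<inter> W) + b * emeasure lborel W"
  shows "emeasure lborel E \<le> c * emeasure lborel F + b * emeasure lborel (\<Union>\<W>)"
proof -
  have cW: "countable \<W>" using \<W> countable_disjoint_open_subsets by blast
  have sum: "emeasure lborel (S \<inter> \<Union>\<W>) = (\<integral>\<^sup>+W. emeasure lborel (S \<inter> W) \<partial>count_space \<W>)" if "S \<in> sets borel" for S
  proof -
    have "disjoint_family_on (\<lambda>W. S \<inter> W) \<W>"
      using \<W>(1) unfolding disjoint_family_on_def pairwise_def disjnt_def by blast
    moreover have "S \<inter> \<Union>\<W> = (\<Union>W\<in>\<W>. S \<inter> W)" by auto
    ultimately show ?thesis using emeasure_UN_countable[of \<W> "\<lambda>W. S \<inter> W" lborel] cW that \<W>(2) by auto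
  qed
  have "emeasure lborel E = (\<integral>\<^sup>+W. emeasure lborel (E \<inter> W) \<partial>count_space \<W>)"
    using sum[OF E(2)] E(1) by (simp add: Int_absorb2)
  also have "\<dots> \<le> (\<integral>\<^sup>+W. c * emeasure lborel (F \<inter> W) + b * emeasure lborel W \<partial>count_space \<W>)"
    using le by (intro nn_integral_mono) auto
  also have "\<dots> = c * (\<integral>\<^sup>+W. emeasure lborel (F \<inter> W) \<partial>count_space \<W>) + b * (\<integral>\<^sup>+W. emeasure lborel (UNIV \<inter> W) \<partial>count_space \<W>)"
    by (simp add: nn_integral_add nn_integral_cmult)
  also have "\<dots> = c * emeasure lborel (F \<inter> \<Union>\<W>) + b * emeasure lborel (\<Union>\<W>)"
    using sum[OF F] sum[of UNIV] by simp
  also have "\<dots> \<le> c * emeasure lborel F + b * emeasure lborel (\<Union>\<W>)"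
    using F by (intro add_right_mono mult_left_mono emeasure_mono) auto
  finally show ?thesis .
qed

text \<open>Countability is automatic for disjoint open sets in a separable space.\<close>

lemma open_partition_mod0_iff:
  "open_partition_mod0 W \<V> \<longleftrightarrow>
     disjoint \<V> \<and> (\<forall>V\<in>\<V>. open V \<and> V \<noteq> {} \<and> V \<subseteq> W) \<and> W - \<Union>\<V> \<in> null_sets lebesgue"
  using countable_disjoint_open_subsets[of \<V>] unfolding open_partition_mod0_def by metis

text \<open>The collar is recorded in the domain, though nearness to the boundary is tested in the
  image. Images of different pieces may overlap, but in the domain the collars of disjoint pieces
  are disjoint, so masses add.\<close>

definition collar :: "('a::euclidean_space \<Rightarrow> 'a) \<Rightarrow> 'a set set \<Rightarrow> real \<Rightarrow> 'a set" where
  "collar f \<V> \<epsilon> = {x. \<exists>V\<in>\<V>. x \<in> V \<and> infdist (f x) (frontier (f ` V)) < \<epsilon>}"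

lemma open_partition_mod0D:
  assumes "open_partition_mod0 W \<V>"
  shows "disjoint \<V>" "V \<in> \<V> \<Longrightarrow> open V" "V \<in> \<V> \<Longrightarrow> V \<noteq> {}" "V \<in> \<V> \<Longrightarrow> V \<subseteq> W"
    "W - \<Union>\<V> \<in> null_sets lebesgue"
  using assms unfolding open_partition_mod0_iff by blast+

lemma open_partition_mod0_self: "open W \<Longrightarrow> W \<noteq> {} \<Longrightarrow> open_partition_mod0 W {W}"
  unfolding open_partition_mod0_iff by simp

lemma open_partition_mod0_Union:
  assumes \<W>: "disjoint \<W>" "\<And>W. W \<in> \<W> \<Longrightarrow> open W" and F: "\<And>W. W \<in> \<W> \<Longrightarrow> open_partition_mod0 W (F W)"
  shows "open_partition_mod0 (\<Union>\<W>) (\<Union>W\<in>\<W>. F W)"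
  unfolding open_partition_mod0_iff
proof (intro conjI)
  show "disjoint (\<Union>W\<in>\<W>. F W)"
  proof (rule pairwiseI)
    fix U V assume "U \<in> (\<Union>W\<in>\<W>. F W)" "V \<in> (\<Union>W\<in>\<W>. F W)" and ne: "U \<noteq> V"
    then obtain A B where AB: "A \<in> \<W>" "U \<in> F A" "B \<in> \<W>" "V \<in> F B" by blast
    then have sub: "U \<subseteq> A" "V \<subseteq> B" using open_partition_mod0D(4)[OF F] by blast+
    show "disjnt U V"
    proof (cases "A = B")
      case True
      then show ?thesis using open_partition_mod0D(1)[OF F[OF AB(1)]] AB ne unfolding pairwise_def by blast
    next
      case False
      then have "disjnt A B" using \<W>(1) AB unfolding pairwise_def by blast
      then show ?thesis using sub unfolding disjnt_def by blast
    qed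
  qed
  show "\<forall>V\<in>(\<Union>W\<in>\<W>. F W). open V \<and> V \<noteq> {} \<and> V \<subseteq> \<Union>\<W>"
  proof
    fix V assume "V \<in> (\<Union>W\<in>\<W>. F W)"
    then obtain W where W: "W \<in> \<W>" "V \<in> F W" by blast
    show "open V \<and> V \<noteq> {} \<and> V \<subseteq> \<Union>\<W>"
      using open_partition_mod0D(2-4)[OF F[OF W(1)] W(2)] W(1) by blast
  qed
  have "countable \<W>" using \<W> countable_disjoint_open_subsets by blast
  then have "(\<Union>W\<in>\<W>. W - \<Union>(F W)) \<in> null_sets lebesgue"
    using open_partition_mod0D(5)[OF F] by (intro null_sets_UN') auto
  moreover have "\<Union>\<W> - \<Union>(\<Union>W\<in>\<W>. F W) \<subseteq> (\<Union>W\<in>\<W>. W - \<Union>(F W))" by blast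
  ultimately show "\<Union>\<W> - \<Union>(\<Union>W\<in>\<W>. F W) \<in> null_sets lebesgue"
    by (rule null_sets_completion_subset[rotated])
qed

lemma collar_Union_Int:
  assumes \<W>: "disjoint \<W>" and F: "\<And>W V. W \<in> \<W> \<Longrightarrow> V \<in> F W \<Longrightarrow> V \<subseteq> W" and W: "W \<in> \<W>"
  shows "collar f (\<Union>W\<in>\<W>. F W) \<epsilon> \<inter> W = collar f (F W) \<epsilon>"
proof
  show "collar f (\<Union>W\<in>\<W>. F W) \<epsilon> \<inter> W \<subseteq> collar f (F W) \<epsilon>"
  proof
    fix x assume x: "x \<in> collar f (\<Union>W\<in>\<W>. F W) \<epsilon> \<inter> W"
    then obtain A V where A: "A \<in> \<W>" "V \<in> F A" "x \<in> V" "infdist (f x) (frontier (f ` V)) < \<epsilon>"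
      unfolding collar_def by blast
    then have "x \<in> A" using F by blast
    then have "A = W" using \<W> W A(1) x unfolding pairwise_def disjnt_def by blast
    then show "x \<in> collar f (F W) \<epsilon>" using A unfolding collar_def by blast
  qed
  show "collar f (F W) \<epsilon> \<subseteq> collar f (\<Union>W\<in>\<W>. F W) \<epsilon> \<inter> W"
    using F[OF W] W unfolding collar_def by blast
qed

lemma collar_Int:
  assumes "disjoint \<W>" "W \<in> \<W>"
  shows "collar f \<W> \<epsilon> \<inter> W = collar f {W} \<epsilon>"
  using collar_Union_Int[of \<W> "\<lambda>W. {W}" W f \<epsilon>] assms by simp

lemma collar_subset: "collar f \<V> \<epsilon> \<subseteq> \<Union>\<V>"
  unfolding collar_def by blast

lemma collar_mono: "\<U> \<subseteq> \<V> \<Longrightarrow> collar f \<U> \<epsilon> \<subseteq> collar f \<V> \<epsilon>"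
  unfolding collar_def by blast

lemma open_collar:
  assumes "\<And>V. V \<in> \<V> \<Longrightarrow> open V" "\<And>V. V \<in> \<V> \<Longrightarrow> continuous_on V f"
  shows "open (collar f \<V> \<epsilon>)"
proof -
  have "collar f \<V> \<epsilon> = (\<Union>V\<in>\<V>. V \<inter> f -` {y. infdist y (frontier (f ` V)) < \<epsilon>})"
    unfolding collar_def by auto
  moreover have "open (V \<inter> f -` {y. infdist y (frontier (f ` V)) < \<epsilon>})" if "V \<in> \<V>" for V
    using assms that by (intro open_Int_vimage open_Collect_less continuous_intros)
  ultimately show ?thesis by auto
qed

text \<open>The boundary of an intersection is contained in the union of the boundaries, so a point
  close to the boundary of a cut image is close to the old boundary or to \<Gamma>. The points lost
  are mapped into the null set \<Gamma>.\<close>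

lemma chop:
  assumes b: "branch e \<alpha> l a W f" and bd: "bounded (f ` W)"
    and \<C>: "disjoint \<C>" "\<And>Q. Q \<in> \<C> \<Longrightarrow> open Q" "\<And>Q. Q \<in> \<C> \<Longrightarrow> frontier Q \<subseteq> \<Gamma>"
    and \<Gamma>: "f ` W \<subseteq> \<Union>\<C> \<union> \<Gamma>" "\<Gamma> \<in> null_sets lebesgue"
  defines "\<V> \<equiv> (\<lambda>Q. W \<inter> f -` Q) ` \<C> - {{}}"
  shows "open_partition_mod0 W \<V>"
    "collar f \<V> \<epsilon> \<subseteq> collar f {W} \<epsilon> \<union> W \<inter> f -` {y. \<exists>z\<in>\<Gamma>. dist y z < \<epsilon>}"
proof -
  note bD = branchD[OF b]
  have "W - \<Union>\<V> \<subseteq> W \<inter> f -` \<Gamma>" 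
  proof
    fix x assume x: "x \<in> W - \<Union>\<V>"
    then have "f x \<notin> Q" if "Q \<in> \<C>" for Q using that unfolding \<V>_def by blast
    then show "x \<in> W \<inter> f -` \<Gamma>" using x \<Gamma>(1) by blast
  qed
  then have "W - \<Union>\<V> \<in> null_sets lebesgue"
    using branch_null[OF b \<Gamma>(2)] by (rule null_sets_completion_subset)
  moreover have "disjoint \<V>"
  proof (rule pairwiseI)
    fix A B assume "A \<in> \<V>" "B \<in> \<V>" "A \<noteq> B"
    then obtain Q R where "A = W \<inter> f -` Q" "B = W \<inter> f -` R" "Q \<in> \<C>" "R \<in> \<C>" "Q \<noteq> R"
      unfolding \<V>_def by blast
    moreover have "Q \<inter> R = {}" using \<C>(1) calculation unfolding pairwise_def disjnt_def by blast
    ultimately show "disjnt A B" unfolding disjnt_def by blast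
  qed
  moreover have "open V" if "V \<in> \<V>" for V
    using that \<C>(2) open_Int_vimage[OF bD(1,2)] unfolding \<V>_def by blast
  ultimately show "open_partition_mod0 W \<V>" unfolding open_partition_mod0_iff unfolding \<V>_def by blast
  show "collar f \<V> \<epsilon> \<subseteq> collar f {W} \<epsilon> \<union> W \<inter> f -` {y. \<exists>z\<in>\<Gamma>. dist y z < \<epsilon>}"
  proof
    fix x assume "x \<in> collar f \<V> \<epsilon>"
    then obtain Q where Q: "Q \<in> \<C>" "x \<in> W" "f x \<in> Q" "infdist (f x) (frontier (f ` (W \<inter> f -` Q))) < \<epsilon>"
      unfolding collar_def \<V>_def by blast
    have im: "f ` (W \<inter> f -` Q) = f ` W \<inter> Q" by auto
    \<comment> \<open>Boundedness makes the frontier nonempty; otherwise \<open>infdist\<close>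
      would be 0 without a nearby boundary point.\<close>
    have "frontier (f ` W \<inter> Q) \<noteq> {}"
      using Q bd by (intro frontier_nonempty) (auto intro: bounded_subset)
    then obtain z where z: "z \<in> frontier (f ` W \<inter> Q)" "dist (f x) z < \<epsilon>"
      using Q(4) unfolding im by (auto simp: infdist_less_iff)
    then consider "z \<in> frontier (f ` W)" | "z \<in> frontier Q" using frontier_Int_subset by blast
    then show "x \<in> collar f {W} \<epsilon> \<union> W \<inter> f -` {y. \<exists>z\<in>\<Gamma>. dist y z < \<epsilon>}"
    proof cases
      case 1
      then have "infdist (f x) (frontier (f ` W)) < \<epsilon>" using z infdist_le le_less_trans by blast
      then show ?thesis using Q(2) unfolding collar_def by blast
    next
      case 2
      then show ?thesis using \<C>(3) Q z by blast
    qed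
  qed
qed

section \<open>Iterates of the map, their cylinders, and one block of controlled complexity\<close>

locale expanding_map =
  fixes X :: "'a::euclidean_space set" and P :: "'a set set" and T :: "'a \<Rightarrow> 'a" and e \<Lambda> \<alpha> D :: real
  assumes open_X: "open X" and bounded_X: "bounded X"
    and piecewise: "piecewise_invertible X P T"
    and expansion: "uniform_expansion P T e \<Lambda>"
    and distortion: "bounded_distortion P T \<alpha> D"
begin

text \<open>The fixed point of \<open>a \<mapsto> D + a \<Lambda>\<^sup>\<alpha>\<close>, a distortion constant common to all iterates.\<close>

definition dist_const :: real where
  "dist_const = D / (1 - \<Lambda> powr \<alpha>)"

text \<open>A nonempty \<open>W\<close> of this kind lies in a single element of
  \<open>cylinders X P T n\<close>; not naming that element makes the notion stable under shrinking
  and cutting.\<close>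

definition admissible :: "nat \<Rightarrow> 'a set \<Rightarrow> bool" where
  "admissible n W \<longleftrightarrow> open W \<and> W \<subseteq> X \<and> (\<forall>i<n. \<exists>A\<in>P. (T ^^ i) ` W \<subseteq> A)"

lemma const_facts: "0 < e" "0 < \<Lambda>" "\<Lambda> < 1" "0 < \<alpha>" "0 \<le> D" "0 \<le> dist_const"
  "D + dist_const * \<Lambda> powr \<alpha> = dist_const"
proof -
  show 1: "0 < e" "0 < \<Lambda>" "\<Lambda> < 1" "0 < \<alpha>" "0 \<le> D"
    using expansion distortion unfolding uniform_expansion_def bounded_distortion_def by simp_all
  have "\<Lambda> powr \<alpha> < 1" using 1 powr_less_mono2[of \<alpha> \<Lambda> 1] by simp
  then show "0 \<le> dist_const" "D + dist_const * \<Lambda> powr \<alpha> = dist_const"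
    using 1 unfolding dist_const_def by (simp_all add: field_simps)
qed

lemma P_facts:
  shows "disjoint P" "A \<in> P \<Longrightarrow> open A" "A \<in> P \<Longrightarrow> A \<subseteq> X" "X - \<Union>P \<in> null_sets lebesgue" "T ` X \<subseteq> X"
  using piecewise unfolding piecewise_invertible_def open_partition_mod0_def by blast+

lemma branch_P:
  assumes "A \<in> P"
  shows "branch e \<alpha> \<Lambda> D A T"
proof -
  obtain J where J: "is_jacobian (T ` A) (inv_into A T) J"
    "\<forall>x\<in>T ` A. \<forall>y\<in>T ` A. J x \<le> exp (D * dist x y powr \<alpha>) * J y"
    using distortion assms unfolding bounded_distortion_def by meson
  have nh: "nonsingular_homeo_on A T" using piecewise assms unfolding piecewise_invertible_def by simp
  show ?thesis
    by (rule branch_of_piece[OF P_facts(2)[OF assms] nh _ J(1)])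
      (use expansion assms J(2) in \<open>unfold uniform_expansion_def, blast+\<close>)
qed

lemma funpow_X: "x \<in> X \<Longrightarrow> (T ^^ n) x \<in> X"
  using P_facts(5) by (induction n) auto

text \<open>The next iterate is composed on the outside, so \<open>branch_comp\<close> sends the
  distortion constant to \<open>D + dist_const * \<Lambda> powr \<alpha>\<close>, which is
  \<open>dist_const\<close> again.\<close>

lemma admissible_branch: "admissible n W \<Longrightarrow> branch e \<alpha> (\<Lambda> ^ n) dist_const W (T ^^ n)"
proof (induction n)
  case 0
  then show ?case using branch_id[of W dist_const e \<alpha>] const_facts by (simp add: admissible_def id_def)
next
  case (Suc n)
  then have 1: "branch e \<alpha> (\<Lambda> ^ n) dist_const W (T ^^ n)" unfolding admissible_def by simp
  obtain A where A: "A \<in> P" "(T ^^ n) ` W \<subseteq> A" using Suc.prems unfolding admissible_def by blast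
  have "branch e \<alpha> (\<Lambda> ^ n * \<Lambda>) (D + dist_const * \<Lambda> powr \<alpha>) W (T \<circ> T ^^ n)"
    using branch_comp[OF 1 branch_P[OF A(1)] A(2)] const_facts by simp
  then have "branch e \<alpha> (\<Lambda> ^ n * \<Lambda>) dist_const W (T \<circ> T ^^ n)" unfolding const_facts(7) .
  moreover have "T \<circ> T ^^ n = T ^^ Suc n" "\<Lambda> ^ n * \<Lambda> = \<Lambda> ^ Suc n" by auto
  ultimately show ?case by (simp only:)
qed

lemma admissible_facts:
  assumes "admissible n W"
  shows "open W" "W \<subseteq> X" "continuous_on W (T ^^ n)" "inj_on (T ^^ n) W" "open ((T ^^ n) ` W)"
    "(T ^^ n) ` W \<subseteq> X" "bounded ((T ^^ n) ` W)"
proof -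
  show "open W" "W \<subseteq> X" "continuous_on W (T ^^ n)" "inj_on (T ^^ n) W" "open ((T ^^ n) ` W)"
    using branchD[OF admissible_branch[OF assms]] assms by (simp_all add: admissible_def)
  show "(T ^^ n) ` W \<subseteq> X" using \<open>W \<subseteq> X\<close> funpow_X by blast
  then show "bounded ((T ^^ n) ` W)" using bounded_X bounded_subset by blast
qed

lemma admissible_subset: "admissible n W \<Longrightarrow> V \<subseteq> W \<Longrightarrow> open V \<Longrightarrow> admissible n V"
  unfolding admissible_def by (meson image_mono order_trans)

lemma admissible_Suc:
  assumes "admissible k W" "A \<in> P" "(T ^^ k) ` W \<subseteq> A"
  shows "admissible (Suc k) W"
proof -
  have "\<exists>A\<in>P. (T ^^ i) ` W \<subseteq> A" if "i < Suc k" for i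
  proof (cases "i = k")
    case True
    then show ?thesis using assms by blast
  next
    case False
    then show ?thesis using assms(1) that unfolding admissible_def by simp
  qed
  then show ?thesis using assms(1) unfolding admissible_def by blast
qed

lemma admissible_cylinder:
  assumes "A \<in> cylinders X P T m"
  shows "admissible m A"
proof -
  obtain c where c: "\<And>i. i < m \<Longrightarrow> c i \<in> P" "A = {x \<in> X. \<forall>i<m. (T ^^ i) x \<in> c i}"
    using assms unfolding cylinders_def by blast
  \<comment> \<open>The sequence \<open>c\<close> is kept fixed and only its length grows:
    continuity of T^k on the shorter cylinder makes the longer one open.\<close>
  have "k \<le> m \<Longrightarrow> admissible k {x \<in> X. \<forall>i<k. (T ^^ i) x \<in> c i}" for k
  proof (induction k)
    case 0
    then show ?case using open_X by (simp add: admissible_def)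
  next
    case (Suc k)
    then have k: "admissible k {x \<in> X. \<forall>i<k. (T ^^ i) x \<in> c i}" (is "admissible k ?A") by simp
    note f = admissible_facts[OF k]
    have ck: "c k \<in> P" using c Suc.prems by simp
    have eq: "{x \<in> X. \<forall>i<Suc k. (T ^^ i) x \<in> c i} = ?A \<inter> (T ^^ k) -` c k" by (auto simp: less_Suc_eq)
    have op: "open (?A \<inter> (T ^^ k) -` c k)" using open_Int_vimage[OF f(1,3)] P_facts(2)[OF ck] by blast
    have "admissible k (?A \<inter> (T ^^ k) -` c k)" by (rule admissible_subset[OF k _ op]) blast
    moreover have "(T ^^ k) ` (?A \<inter> (T ^^ k) -` c k) \<subseteq> c k" by blast
    ultimately show ?case unfolding eq by (rule admissible_Suc[OF _ ck])
  qed
  from this[of m] show ?thesis using c(2) by simp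
qed

lemma disjoint_cylinders: "disjoint (cylinders X P T m)"
proof (rule pairwiseI)
  fix A B assume A: "A \<in> cylinders X P T m" and B: "B \<in> cylinders X P T m" and ne: "A \<noteq> B"
  obtain c where c: "\<And>i. i < m \<Longrightarrow> c i \<in> P" "A = {x \<in> X. \<forall>i<m. (T ^^ i) x \<in> c i}"
    using A unfolding cylinders_def by blast
  obtain d where d: "\<And>i. i < m \<Longrightarrow> d i \<in> P" "B = {x \<in> X. \<forall>i<m. (T ^^ i) x \<in> d i}"
    using B unfolding cylinders_def by blast
  show "disjnt A B"
  proof (rule ccontr)
    assume "\<not> disjnt A B"
    then obtain x where x: "x \<in> A" "x \<in> B" unfolding disjnt_def by blast
    have "c i = d i" if "i < m" for i
    proof -
      have "(T ^^ i) x \<in> c i" "(T ^^ i) x \<in> d i" using x c d that by auto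
      then show ?thesis using P_facts(1) c(1) d(1) that unfolding pairwise_def disjnt_def by blast
    qed
    then show False using c d ne by auto
  qed
qed

text \<open>A point of a cylinder of order m is lost at the next step only if T^m maps it into the
  null set left uncovered by \<open>P\<close>; each of the countably many branches pulls this back
  to a null set.\<close>

lemma cylinders_cover: "X - \<Union>(cylinders X P T m) \<in> null_sets lebesgue"
proof (induction m)
  case 0
  have "X \<subseteq> \<Union>(cylinders X P T 0)" unfolding cylinders_def by auto
  then have "X - \<Union>(cylinders X P T 0) = {}" by blast
  then show ?case by (simp only: null_sets.empty_sets)
next
  case (Suc m)
  let ?C = "cylinders X P T m"
  have op: "\<And>A. A \<in> ?C \<Longrightarrow> open A" using admissible_cylinder unfolding admissible_def by blast
  have "countable ?C" using countable_disjoint_open_subsets[OF op disjoint_cylinders] .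
  then have n: "(\<Union>A\<in>?C. A \<inter> (T ^^ m) -` (X - \<Union>P)) \<in> null_sets lebesgue"
    using branch_null[OF admissible_branch[OF admissible_cylinder] P_facts(4)] by (intro null_sets_UN') auto
  have "X - \<Union>(cylinders X P T (Suc m)) \<subseteq> (X - \<Union>?C) \<union> (\<Union>A\<in>?C. A \<inter> (T ^^ m) -` (X - \<Union>P))"
  proof
    fix x assume x: "x \<in> X - \<Union>(cylinders X P T (Suc m))"
    show "x \<in> (X - \<Union>?C) \<union> (\<Union>A\<in>?C. A \<inter> (T ^^ m) -` (X - \<Union>P))"
    proof (rule ccontr)
      assume no: "\<not> ?thesis"
      then obtain A where A: "A \<in> ?C" "x \<in> A" using x by auto
      then have "(T ^^ m) x \<notin> X - \<Union>P" using no by auto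
      then obtain B where B: "B \<in> P" "(T ^^ m) x \<in> B" using x funpow_X[of x m] by auto
      obtain c where c: "\<And>i. i < m \<Longrightarrow> c i \<in> P" "A = {x \<in> X. \<forall>i<m. (T ^^ i) x \<in> c i}"
        using A unfolding cylinders_def by blast
      let ?S = "{x \<in> X. \<forall>i<Suc m. (T ^^ i) x \<in> (c(m := B)) i}"
      have "x \<in> ?S" using A(2) B c(2) by (auto simp: less_Suc_eq)
      moreover have "\<forall>i<Suc m. (c(m := B)) i \<in> P" using c(1) B by (auto simp: less_Suc_eq)
      ultimately have "?S \<in> cylinders X P T (Suc m)" unfolding cylinders_def by blast
      then show False using x \<open>x \<in> ?S\<close> by blast
    qed
  qed
  then show ?case by (rule null_sets_completion_subset) (intro null_sets.Un Suc n)
qed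

lemma admissible_Int_vimage:
  assumes W: "admissible n W" and A: "admissible m A"
  shows "admissible (n + m) (W \<inter> (T ^^ n) -` A)"
  unfolding admissible_def
proof (intro conjI allI impI)
  note f = admissible_facts[OF W]
  show "open (W \<inter> (T ^^ n) -` A)" using open_Int_vimage[OF f(1,3)] A unfolding admissible_def by blast
  show "W \<inter> (T ^^ n) -` A \<subseteq> X" using f(2) by blast
  fix i assume i: "i < n + m"
  show "\<exists>B\<in>P. (T ^^ i) ` (W \<inter> (T ^^ n) -` A) \<subseteq> B"
  proof (cases "i < n")
    case True
    then show ?thesis using W unfolding admissible_def by (meson Int_lower1 image_mono order_trans)
  next
    case False
    then obtain j where j: "i = j + n" "j < m" using i by (metis add.commute add_less_cancel_left le_add_diff_inverse not_less)
    then obtain B where "B \<in> P" "(T ^^ j) ` A \<subseteq> B" using A unfolding admissible_def by blast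
    then show ?thesis unfolding j(1) by (intro bexI[of _ B]) (auto simp: funpow_add)
  qed
qed

lemma dynamic_partition:
  fixes m :: nat
  assumes W: "admissible n W"
  defines "\<V> \<equiv> (\<lambda>A. W \<inter> (T ^^ n) -` A) ` cylinders X P T m - {{}}"
  shows "open_partition_mod0 W \<V>" "V \<in> \<V> \<Longrightarrow> admissible (n + m) V"
proof -
  note f = admissible_facts[OF W]
  show adm: "admissible (n + m) V" if "V \<in> \<V>" for V
    using that admissible_Int_vimage[OF W admissible_cylinder] unfolding \<V>_def by blast
  have "W - \<Union>\<V> \<subseteq> W \<inter> (T ^^ n) -` (X - \<Union>(cylinders X P T m))"

  proof
    fix x assume x: "x \<in> W - \<Union>\<V>"
    then have "(T ^^ n) x \<notin> A" if "A \<in> cylinders X P T m" for A using that unfolding \<V>_def by blast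
    then show "x \<in> W \<inter> (T ^^ n) -` (X - \<Union>(cylinders X P T m))" using x f(6) by blast
  qed
  then have "W - \<Union>\<V> \<in> null_sets lebesgue"
    using branch_null[OF admissible_branch[OF W] cylinders_cover] by (rule null_sets_completion_subset)
  moreover have "disjoint \<V>"
  proof (rule pairwiseI)
    fix A B assume "A \<in> \<V>" "B \<in> \<V>" "A \<noteq> B"
    then obtain Q R where "A = W \<inter> (T ^^ n) -` Q" "B = W \<inter> (T ^^ n) -` R" "Q \<in> cylinders X P T m" "R \<in> cylinders X P T m" "Q \<noteq> R"
      unfolding \<V>_def by blast
    moreover have "Q \<inter> R = {}" using disjoint_cylinders[of m] calculation unfolding pairwise_def disjnt_def by blast
    ultimately show "disjnt A B" unfolding disjnt_def by blast
  qed
  moreover have "\<And>V. V \<in> \<V> \<Longrightarrow> open V" using adm unfolding admissible_def by blast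
  ultimately show "open_partition_mod0 W \<V>" unfolding open_partition_mod0_iff unfolding \<V>_def by blast
qed

text \<open>In the image I of \<open>W\<close> under T^n, the points that become \<epsilon>-close to
  a boundary after \<open>m\<close> more steps lie in the inner collar C of I of width
  \<open>\<Lambda> ^ m * \<epsilon>\<close> or in a remainder N of volume at most \<sigma> times
  that of C. Pulled back to \<open>W\<close>, C is exactly the old collar, while comparing N with C
  costs the distortion factor.\<close>

lemma dynamic_collar:
  assumes W: "admissible n W" "W \<noteq> {}"
    and r: "\<And>x y. x \<in> (T ^^ n) ` W \<Longrightarrow> y \<in> (T ^^ n) ` W \<Longrightarrow> dist x y \<le> r" "r \<le> e" "r \<le> \<epsilon>\<^sub>2"
    and cc: "\<And>I \<epsilon>. open I \<Longrightarrow> I \<noteq> {} \<Longrightarrow> I \<subseteq> X \<Longrightarrow> diameter I \<le> \<epsilon>\<^sub>2 \<Longrightarrow> 0 < \<epsilon> \<Longrightarrow> \<epsilon> < \<epsilon>\<^sub>2 \<Longrightarrow>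
      complexity_sum X P T \<Lambda> m I \<epsilon> \<le> ennreal \<sigma>"
    and \<sigma>: "0 \<le> \<sigma>" and \<epsilon>: "0 < \<epsilon>" "\<epsilon> < \<epsilon>\<^sub>2"
  defines "\<V> \<equiv> (\<lambda>A. W \<inter> (T ^^ n) -` A) ` cylinders X P T m - {{}}"
  shows "emeasure lborel (collar (T ^^ (n + m)) \<V> \<epsilon>)
    \<le> ennreal (1 + exp (dist_const * r powr \<alpha>) * \<sigma>) * emeasure lborel (collar (T ^^ n) {W} (\<Lambda> ^ m * \<epsilon>))"
proof -
  note f = admissible_facts[OF W(1)]
  let ?f = "T ^^ n" and ?g = "T ^^ m"
  define I where "I = ?f ` W"
  have I: "open I" "I \<noteq> {}" "I \<subseteq> X" "bounded I" using f W(2) unfolding I_def by auto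
  have dI: "diameter I \<le> \<epsilon>\<^sub>2"
    using r I(2) order_trans[OF r(1) r(3)] by (intro diameter_le) (auto simp: I_def dist_norm)
  define \<delta> where "\<delta> = \<Lambda> ^ m * \<epsilon>"
  have \<delta>: "0 < \<delta>" unfolding \<delta>_def using const_facts \<epsilon> by simp
  define C where "C = inner_collar \<delta> I"
  have Co: "open C" unfolding C_def using I(1) by (rule open_inner_collar)
  \<comment> \<open>Complexity bounds quotients by the volume of C, which must be positive and
    finite before they can be multiplied out.\<close>
  have "C \<noteq> {}"
  proof -
    obtain z where z: "z \<in> frontier I" using frontier_nonempty I by blast
    then have "z \<in> closure I" unfolding frontier_def by blast
    then obtain y where "y \<in> I" "dist y z < \<delta>" using \<delta> closure_approachable by blast
    then have "infdist y (frontier I) < \<delta>" using z infdist_le le_less_trans by blast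
    then show ?thesis using \<open>y \<in> I\<close> unfolding C_def inner_collar_def by blast
  qed
  then have C0: "emeasure lborel C \<noteq> 0" using emeasure_open_pos[OF Co] by simp
  have CI: "C \<subseteq> I" unfolding C_def inner_collar_def by blast
  have Cfin: "emeasure lborel C \<noteq> top"
    using emeasure_bounded_finite[of C] bounded_subset[OF I(4) CI] by simp
  \<comment> \<open>The collar, after \<open>m\<close> steps, of the part of I in the cylinder A,
    seen as a subset of I.\<close>
  define E where "E A = {y \<in> I \<inter> A. infdist (?g y) (frontier (?g ` (I \<inter> A))) < \<epsilon>}" for A
  let ?cyl = "cylinders X P T m"
  have Eo: "open (E A)" if "A \<in> ?cyl" for A
  proof -
    note fA = admissible_facts[OF admissible_cylinder[OF that]]
    have "E A = collar ?g {I \<inter> A} \<epsilon>" unfolding E_def collar_def by auto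
    moreover have "open (collar ?g {I \<inter> A} \<epsilon>)"
      using I(1) fA by (intro open_collar) (auto intro: continuous_on_subset)
    ultimately show ?thesis by simp
  qed
  have Einv: "E A = inv_into A ?g ` inner_collar \<epsilon> (?g ` (I \<inter> A))" if "A \<in> ?cyl" for A
  proof -
    note fA = admissible_facts[OF admissible_cylinder[OF that]]
    have "inv_into A ?g ` inner_collar \<epsilon> (?g ` (I \<inter> A)) = A \<inter> ?g -` inner_collar \<epsilon> (?g ` (I \<inter> A))"
      by (rule inv_into_image_eq[OF fA(4)]) (auto simp: inner_collar_def)
    also have "\<dots> = E A"
      using fA(4) unfolding E_def inner_collar_def by (auto simp: inj_on_def)
    finally show ?thesis by simp
  qed
  have ccyl: "countable ?cyl"
    by (rule countable_disjoint_open_subsets[OF _ disjoint_cylinders])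
      (rule admissible_facts(1)[OF admissible_cylinder])
  define N where "N = (\<Union>A\<in>?cyl. E A - C)"
  have Nle: "emeasure lborel N \<le> ennreal \<sigma> * emeasure lborel C"
    unfolding N_def
  proof (rule emeasure_UN_le[OF ccyl])
    show "E A - C \<in> sets lborel" if "A \<in> ?cyl" for A using Eo[OF that] Co by simp
    fix F assume F: "finite F" "F \<subseteq> ?cyl"
    let ?S = "{A \<in> ?cyl. emeasure lebesgue (I \<inter> A) > 0}"
    let ?q = "\<lambda>A. emeasure lebesgue (inv_into A ?g ` inner_collar \<epsilon> (?g ` (I \<inter> A)) - inner_collar (\<Lambda> ^ m * \<epsilon>) I)
        / emeasure lebesgue (inner_collar (\<Lambda> ^ m * \<epsilon>) I)"
    have q: "?q A = emeasure lborel (E A - C) / emeasure lborel C" if "A \<in> ?cyl" for A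
      using Eo[OF that] Co unfolding Einv[OF that, symmetric] \<delta>_def[symmetric] C_def[symmetric] by simp
    \<comment> \<open>The complexity sum runs over cylinders meeting I in positive measure; the
      others miss I altogether, as an open null set is empty.\<close>
    have z: "emeasure lborel (E A - C) = 0" if "A \<in> ?cyl" "A \<notin> ?S" for A
    proof -
      have op: "open (I \<inter> A)" using I(1) admissible_facts(1)[OF admissible_cylinder[OF that(1)]] by blast
      then have "emeasure lborel (I \<inter> A) = 0" using that by simp
      then have "I \<inter> A = {}" using emeasure_open_pos[OF op] by auto
      then show ?thesis unfolding E_def by simp
    qed
    have "(\<Sum>A\<in>F. emeasure lborel (E A - C)) = (\<Sum>A\<in>F \<inter> ?S. emeasure lborel (E A - C))"
    proof (rule sum.mono_neutral_right)
      show "\<forall>A\<in>F - F \<inter> ?S. emeasure lborel (E A - C) = 0" using z F(2) by blast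
    qed (use F in auto)
    also have "\<dots> = (\<Sum>A\<in>F \<inter> ?S. ?q A * emeasure lborel C)"
    proof (intro sum.cong refl)
      fix A assume "A \<in> F \<inter> ?S"
      then have "?q A * emeasure lborel C = emeasure lborel (E A - C) / emeasure lborel C * emeasure lborel C"
        using q by simp
      also have "\<dots> = emeasure lborel (E A - C)" using C0 Cfin by (simp add: ennreal_divide_times ennreal_divide_self less_top)
      finally show "emeasure lborel (E A - C) = ?q A * emeasure lborel C" by simp
    qed
    also have "\<dots> = (\<Sum>A\<in>F \<inter> ?S. ?q A) * emeasure lborel C" by (simp add: sum_distrib_right)
    also have "\<dots> \<le> ennreal \<sigma> * emeasure lborel C"
    proof (rule mult_right_mono)
      have "(\<Sum>A\<in>F \<inter> ?S. ?q A) \<le> infsum ?q ?S"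
        using F(1) by (intro ennreal_sum_le_infsum) auto
      also have "infsum ?q ?S \<le> ennreal \<sigma>"
        using cc[OF I(1-3) dI \<epsilon>] unfolding complexity_sum_def .
      finally show "(\<Sum>A\<in>F \<inter> ?S. ?q A) \<le> ennreal \<sigma>" .
    qed simp
    finally show "(\<Sum>A\<in>F. emeasure lborel (E A - C)) \<le> ennreal \<sigma> * emeasure lborel C" .
  qed
  have Nm: "N \<in> sets borel" unfolding N_def
    using Eo Co ccyl by (intro sets.countable_UN') auto
  have NI: "N \<subseteq> I" unfolding N_def E_def by auto
  define K where "K = exp (dist_const * r powr \<alpha>)"
  let ?\<nu> = "\<lambda>B. emeasure lborel (W \<inter> ?f -` B)"
  \<comment> \<open>Here the proportion of N to C is transported from I to \<open>W\<close>; the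
    volume of C is carried on both sides and cancelled at the end.\<close>
  have "emeasure lborel C * ?\<nu> N = ?\<nu> N * emeasure lborel C" by (rule mult.commute)
  also have "\<dots> \<le> ennreal K * (emeasure lborel N * ?\<nu> C)"
    unfolding K_def
    by (rule branch_distortion[OF admissible_branch[OF W(1)]])
      (use const_facts r NI CI Nm Co in \<open>auto simp: I_def\<close>)
  also have "\<dots> \<le> ennreal K * ((ennreal \<sigma> * emeasure lborel C) * ?\<nu> C)"
    using Nle by (intro mult_left_mono mult_right_mono) auto
  also have "\<dots> = emeasure lborel C * (ennreal (K * \<sigma>) * ?\<nu> C)"
    using \<sigma> unfolding K_def by (simp add: ennreal_mult mult_ac)
  finally have \<nu>N: "?\<nu> N \<le> ennreal (K * \<sigma>) * ?\<nu> C"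
    using C0 Cfin by (simp add: ennreal_mult_le_mult_iff)
  have m1: "W \<inter> ?f -` N \<in> sets borel" "W \<inter> ?f -` C \<in> sets borel"
    using borel_Int_vimage[OF f(1,3)] Nm Co by auto
  have "collar (T ^^ (n + m)) \<V> \<epsilon> \<subseteq> (W \<inter> ?f -` N) \<union> (W \<inter> ?f -` C)"
  proof
    fix x assume "x \<in> collar (T ^^ (n + m)) \<V> \<epsilon>"
    then obtain A where A: "A \<in> ?cyl" "x \<in> W" "?f x \<in> A"
      "infdist ((T ^^ (n + m)) x) (frontier ((T ^^ (n + m)) ` (W \<inter> ?f -` A))) < \<epsilon>"
      unfolding collar_def \<V>_def by blast
    have "T ^^ (n + m) = ?g \<circ> ?f" by (simp add: add.commute funpow_add)
    moreover have "(?g \<circ> ?f) ` (W \<inter> ?f -` A) = ?g ` (I \<inter> A)" unfolding I_def by auto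
    ultimately have "?f x \<in> E A" using A unfolding E_def I_def by auto
    then show "x \<in> (W \<inter> ?f -` N) \<union> (W \<inter> ?f -` C)" using A unfolding N_def by blast
  qed
  then have "emeasure lborel (collar (T ^^ (n + m)) \<V> \<epsilon>) \<le> emeasure lborel ((W \<inter> ?f -` N) \<union> (W \<inter> ?f -` C))"
    using m1 by (intro emeasure_mono) auto
  also have "\<dots> \<le> ?\<nu> N + ?\<nu> C" using m1 by (intro emeasure_subadditive) auto
  also have "\<dots> \<le> ennreal (K * \<sigma>) * ?\<nu> C + ?\<nu> C" using \<nu>N by (rule add_right_mono)
  also have "\<dots> = ennreal (1 + K * \<sigma>) * ?\<nu> C"
    using \<sigma> unfolding K_def by (simp add: ennreal_plus distrib_right add.commute)
  also have "W \<inter> ?f -` C = collar ?f {W} \<delta>"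
    unfolding C_def I_def inner_collar_def collar_def by auto
  finally show ?thesis unfolding K_def \<delta>_def .
qed

end

text \<open>The push-forward of Lebesgue measure on \<open>W\<close> as a measure on the whole
  space, the input for choosing thin cuts adapted to \<open>W\<close>.\<close>

lemma pullback_measure_exists:
  fixes f :: "'a::euclidean_space \<Rightarrow> 'a"
  assumes W: "open W" "bounded W" "continuous_on W f"
  obtains \<mu> :: "'a measure" where "finite_measure \<mu>" "sets \<mu> = sets borel"
    "\<And>B. B \<in> sets borel \<Longrightarrow> emeasure \<mu> B = emeasure lborel (W \<inter> f -` B)"
proof -
  let ?\<mu> = "distr (restrict_space lborel W) borel f"
  have m [measurable]: "f \<in> measurable (restrict_space lborel W) borel"
    using borel_measurable_continuous_on_restrict[OF W(3)]
    by (simp add: measurable_def space_restrict_space sets_restrict_space)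
  have em: "emeasure ?\<mu> B = emeasure lborel (W \<inter> f -` B)" if "B \<in> sets borel" for B
    using that W by (simp add: emeasure_distr space_restrict_space emeasure_restrict_space Int_commute)
  have "finite_measure ?\<mu>"
  proof
    have "emeasure ?\<mu> (space ?\<mu>) = emeasure lborel W" using em[of UNIV] by simp
    also have "\<dots> \<noteq> \<infinity>" using emeasure_bounded_finite[OF W(2)] by simp
    finally show "emeasure ?\<mu> (space ?\<mu>) \<noteq> \<infinity>" .
  qed
  then show thesis using that[of ?\<mu>] em by simp
qed

definition finer :: "'a::euclidean_space set set \<Rightarrow> 'a set set \<Rightarrow> bool" where
  "finer \<V> \<W> \<longleftrightarrow> open_partition_mod0 (\<Union>\<W>) \<V> \<and> (\<forall>V\<in>\<V>. \<exists>W\<in>\<W>. V \<subseteq> W)"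

lemma finerD:
  assumes "finer \<V> \<W>"
  shows "open_partition_mod0 (\<Union>\<W>) \<V>" "V \<in> \<V> \<Longrightarrow> \<exists>W\<in>\<W>. V \<subseteq> W" "\<Union>\<V> \<subseteq> \<Union>\<W>" "\<Union>\<W> - \<Union>\<V> \<in> null_sets lebesgue"
proof -
  show 1: "open_partition_mod0 (\<Union>\<W>) \<V>" and "V \<in> \<V> \<Longrightarrow> \<exists>W\<in>\<W>. V \<subseteq> W" using assms unfolding finer_def by blast+
  show "\<Union>\<V> \<subseteq> \<Union>\<W>" using open_partition_mod0D(4)[OF 1] by blast
  show "\<Union>\<W> - \<Union>\<V> \<in> null_sets lebesgue" using open_partition_mod0D(5)[OF 1] .
qed

lemma finer_refl: "disjoint \<W> \<Longrightarrow> (\<And>W. W \<in> \<W> \<Longrightarrow> open W \<and> W \<noteq> {}) \<Longrightarrow> finer \<W> \<W>"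
  unfolding finer_def open_partition_mod0_iff by auto

lemma finer_trans:
  assumes 1: "finer \<V> \<W>" and 2: "finer \<U> \<V>"
  shows "finer \<U> \<W>"
proof -
  have "\<Union>\<W> - \<Union>\<U> \<subseteq> (\<Union>\<W> - \<Union>\<V>) \<union> (\<Union>\<V> - \<Union>\<U>)" by blast
  then have "\<Union>\<W> - \<Union>\<U> \<in> null_sets lebesgue"
    by (rule null_sets_completion_subset) (intro null_sets.Un finerD(4) 1 2)
  moreover have "\<exists>W\<in>\<W>. U \<subseteq> W" if "U \<in> \<U>" for U
    using finerD(2)[OF 2 that] finerD(2)[OF 1] by (meson order_trans)
  moreover have "U \<subseteq> \<Union>\<W>" if "U \<in> \<U>" for U
    using finerD(3)[OF 1] finerD(3)[OF 2] that by blast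
  ultimately show ?thesis
    using open_partition_mod0D[OF finerD(1)[OF 2]] unfolding finer_def open_partition_mod0_iff by simp
qed

lemma finer_Union:
  assumes "disjoint \<W>" "\<And>W. W \<in> \<W> \<Longrightarrow> open W" "\<And>W. W \<in> \<W> \<Longrightarrow> open_partition_mod0 W (F W)"
  shows "finer (\<Union>W\<in>\<W>. F W) \<W>"
proof -
  have "\<exists>W\<in>\<W>. V \<subseteq> W" if "V \<in> (\<Union>W\<in>\<W>. F W)" for V
  proof -
    obtain W where "W \<in> \<W>" "V \<in> F W" using \<open>V \<in> (\<Union>W\<in>\<W>. F W)\<close> by blast
    then show ?thesis using open_partition_mod0D(4)[OF assms(3)] by blast
  qed
  then show ?thesis unfolding finer_def using open_partition_mod0_Union[of \<W> F, OF assms] by simp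
qed

text \<open>Lets every refinement be estimated on single pieces. Two maps and two widths are allowed
  because the new collar may belong to a later iterate than the old one.\<close>

lemma collar_Union_le:
  assumes \<W>: "disjoint \<W>" "\<And>W. W \<in> \<W> \<Longrightarrow> open W" and F: "\<And>W. W \<in> \<W> \<Longrightarrow> open_partition_mod0 W (F W)"
    and g: "\<And>W V. W \<in> \<W> \<Longrightarrow> V \<in> F W \<Longrightarrow> continuous_on V g" and f: "\<And>W. W \<in> \<W> \<Longrightarrow> continuous_on W f"
    and le: "\<And>W. W \<in> \<W> \<Longrightarrow>
      emeasure lborel (collar g (F W) \<epsilon>) \<le> c * emeasure lborel (collar f {W} \<delta>) + b * emeasure lborel W"
  shows "emeasure lborel (collar g (\<Union>W\<in>\<W>. F W) \<epsilon>) \<le> c * emeasure lborel (collar f \<W> \<delta>) + b * emeasure lborel (\<Union>\<W>)"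
proof (rule emeasure_le_piecewise[OF \<W>])
  have sub: "V \<subseteq> W" "open V" if "W \<in> \<W>" "V \<in> F W" for W V
    using open_partition_mod0D(2,4)[OF F] that by simp_all
  show "collar g (\<Union>W\<in>\<W>. F W) \<epsilon> \<subseteq> \<Union>\<W>"
    using collar_subset[of g "\<Union>W\<in>\<W>. F W" \<epsilon>] sub(1) by fast
  show "collar g (\<Union>W\<in>\<W>. F W) \<epsilon> \<in> sets borel"
    using sub(2) g by (intro borel_open open_collar) blast+
  show "collar f \<W> \<delta> \<in> sets borel" using \<W>(2) f by (intro borel_open open_collar)
  show "emeasure lborel (collar g (\<Union>W\<in>\<W>. F W) \<epsilon> \<inter> W) \<le> c * emeasure lborel (collar f \<W> \<delta> \<inter> W) + b * emeasure lborel W"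
    if "W \<in> \<W>" for W
    using le[OF that] collar_Union_Int[OF \<W>(1), of F W g \<epsilon>] sub(1) collar_Int[OF \<W>(1) that, of f \<delta>] that by simp
qed

lemma open_slab: "open {y :: 'a::euclidean_space. \<exists>z\<in>\<Gamma>. dist y z < \<epsilon>}"
proof -
  have "{y. \<exists>z\<in>\<Gamma>. dist y z < \<epsilon>} = (\<Union>z\<in>\<Gamma>. ball z \<epsilon>)" by (auto simp: dist_commute)
  then show ?thesis by auto
qed

text \<open>A ball is connected, so if it met \<open>V\<close> without lying inside, it would
  contain a boundary point of \<open>V\<close>.\<close>

lemma ball_subset_of_infdist:
  fixes V :: "'a::euclidean_space set"
  assumes y: "y \<in> V" and d: "\<delta> \<le> infdist y (frontier V)"
  shows "ball y \<delta> \<subseteq> V"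
proof (rule ccontr)
  assume no: "\<not> ball y \<delta> \<subseteq> V"
  then have "0 < \<delta>" by (metis ball_empty empty_subsetI not_less)
  then have "y \<in> ball y \<delta> \<inter> V" using y by simp
  then have "ball y \<delta> \<inter> V \<noteq> {}" "ball y \<delta> - V \<noteq> {}" using no by blast+
  then obtain w where "w \<in> ball y \<delta>" "w \<in> frontier V"
    using connected_Int_frontier[of "ball y \<delta>" V] by auto
  then have "infdist y (frontier V) < \<delta>" using infdist_le[of w "frontier V" y] by auto
  then show False using d by simp
qed

section \<open>Growth: contraction of collars over blocks of iterates\<close>

locale controlled_map = expanding_map +
  fixes m :: nat and \<epsilon>\<^sub>2 \<sigma> \<beta> r :: real
  assumes m_pos: "0 < m" and \<sigma>_nonneg: "0 \<le> \<sigma>" and \<epsilon>\<^sub>2_pos: "0 < \<epsilon>\<^sub>2"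
    and complexity: "\<And>I \<epsilon>. open I \<Longrightarrow> I \<noteq> {} \<Longrightarrow> I \<subseteq> X \<Longrightarrow> diameter I \<le> \<epsilon>\<^sub>2 \<Longrightarrow> 0 < \<epsilon> \<Longrightarrow> \<epsilon> < \<epsilon>\<^sub>2 \<Longrightarrow>
      complexity_sum X P T \<Lambda> m I \<epsilon> \<le> ennreal \<sigma>"
    and r: "0 < r" "r \<le> e" "r \<le> \<epsilon>\<^sub>2" and \<beta>: "0 < \<beta>" "\<beta> < 1"
    and contraction: "(1 + exp (dist_const * r powr \<alpha>) * \<sigma>) * (\<Lambda> ^ m) powr \<beta> < 1"
begin

text \<open>The first factor is the loss in \<open>dynamic_collar\<close>; the second comes from
  evaluating the old bound, a multiple of the \<beta>-th power of the width, at the width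
  \<open>\<Lambda> ^ m * \<epsilon>\<close>.\<close>

definition \<theta> :: real where "\<theta> = (1 + exp (dist_const * r powr \<alpha>) * \<sigma>) * (\<Lambda> ^ m) powr \<beta>"

lemma \<theta>: "0 < \<theta>" "\<theta> < 1"
  using contraction const_facts \<sigma>_nonneg unfolding \<theta>_def by (auto intro!: mult_pos_pos add_pos_nonneg)

text \<open>Images of diameter at most \<open>r\<close> meet the size condition of controlled
  complexity and keep the distortion on a piece within the factor
  \<open>exp (dist_const * r powr \<alpha>)\<close>.\<close>

definition family :: "nat \<Rightarrow> 'a set set \<Rightarrow> bool" where
  "family n \<W> \<longleftrightarrow> disjoint \<W> \<and>
     (\<forall>W\<in>\<W>. W \<noteq> {} \<and> admissible n W \<and> (\<forall>x\<in>(T ^^ n) ` W. \<forall>y\<in>(T ^^ n) ` W. dist x y \<le> r))"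

text \<open>Such a \<open>B\<close> plays the part of the Z-function of a standard family in growth
  lemmas for hyperbolic maps. The widths are those for which both complexity and the thin cuts are
  under control.\<close>

definition collar_bound :: "nat \<Rightarrow> 'a set set \<Rightarrow> real \<Rightarrow> bool" where
  "collar_bound n \<W> B \<longleftrightarrow>
     (\<forall>\<epsilon>. 0 < \<epsilon> \<and> \<epsilon> < \<epsilon>\<^sub>2 \<and> \<epsilon> < 1 \<longrightarrow> emeasure lborel (collar (T ^^ n) \<W> \<epsilon>) \<le> ennreal (B * \<epsilon> powr \<beta>))"

lemma collar_boundD:
  assumes "collar_bound n \<W> B" "0 < \<epsilon>" "\<epsilon> < \<epsilon>\<^sub>2" "\<epsilon> < 1"
  shows "emeasure lborel (collar (T ^^ n) \<W> \<epsilon>) \<le> ennreal (B * \<epsilon> powr \<beta>)"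
  using assms unfolding collar_bound_def by simp

lemma familyD:
  assumes "family n \<W>"
  shows "disjoint \<W>" "W \<in> \<W> \<Longrightarrow> admissible n W" "W \<in> \<W> \<Longrightarrow> W \<noteq> {}"
    "W \<in> \<W> \<Longrightarrow> x \<in> (T ^^ n) ` W \<Longrightarrow> y \<in> (T ^^ n) ` W \<Longrightarrow> dist x y \<le> r"
    "W \<in> \<W> \<Longrightarrow> open W" "W \<in> \<W> \<Longrightarrow> continuous_on W (T ^^ n)"
proof -
  show "disjoint \<W>" using assms unfolding family_def by simp
  show a: "W \<in> \<W> \<Longrightarrow> admissible n W" using assms unfolding family_def by simp
  show "W \<in> \<W> \<Longrightarrow> W \<noteq> {}" using assms unfolding family_def by simp
  show "W \<in> \<W> \<Longrightarrow> x \<in> (T ^^ n) ` W \<Longrightarrow> y \<in> (T ^^ n) ` W \<Longrightarrow> dist x y \<le> r"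
    using assms unfolding family_def by blast
  show "W \<in> \<W> \<Longrightarrow> open W" "W \<in> \<W> \<Longrightarrow> continuous_on W (T ^^ n)"
    using admissible_facts[OF a] by simp_all
qed

lemma familyI:
  assumes "disjoint \<W>" "\<And>W. W \<in> \<W> \<Longrightarrow> W \<noteq> {}" "\<And>W. W \<in> \<W> \<Longrightarrow> admissible n W"
    "\<And>W x y. W \<in> \<W> \<Longrightarrow> x \<in> (T ^^ n) ` W \<Longrightarrow> y \<in> (T ^^ n) ` W \<Longrightarrow> dist x y \<le> r"
  shows "family n \<W>"
  unfolding family_def using assms by simp

lemma family_subset: "family n \<W> \<Longrightarrow> \<V> \<subseteq> \<W> \<Longrightarrow> family n \<V>"
  unfolding family_def using pairwise_subset by blast

lemma family_bounded:
  assumes "family n \<W>"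
  shows "\<Union>\<W> \<subseteq> X" "open (\<Union>\<W>)" "emeasure lborel (\<Union>\<W>) < \<infinity>"
proof -
  show 1: "\<Union>\<W> \<subseteq> X" using admissible_facts(2)[OF familyD(2)[OF assms]] by blast
  show "open (\<Union>\<W>)" using familyD(5)[OF assms] by blast
  show "emeasure lborel (\<Union>\<W>) < \<infinity>"
    using emeasure_bounded_finite bounded_subset[OF bounded_X 1] by simp
qed

lemma admissible_chop:
  assumes W: "admissible n W" and \<C>: "cell_system X s \<C> \<Gamma>"
  defines "\<V> \<equiv> (\<lambda>Q. W \<inter> (T ^^ n) -` Q) ` \<C> - {{}}"
  shows "open_partition_mod0 W \<V>" "V \<in> \<V> \<Longrightarrow> admissible n V"
    "emeasure lborel (collar (T ^^ n) \<V> \<epsilon>) \<le> emeasure lborel (collar (T ^^ n) {W} \<epsilon>)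
       + emeasure lborel (W \<inter> (T ^^ n) -` {y. \<exists>z\<in>\<Gamma>. dist y z < \<epsilon>})"
proof -
  note f = admissible_facts[OF W]
  have c: "(T ^^ n) ` W \<subseteq> \<Union>\<C> \<union> \<Gamma>" using f(6) cell_systemD(6)[OF \<C>] by blast
  note ch = chop[OF admissible_branch[OF W] f(7) cell_systemD(2-4)[OF \<C>] c cell_systemD(7)[OF \<C>], folded \<V>_def]
  show R: "open_partition_mod0 W \<V>" by (rule ch(1))
  show "admissible n V" if "V \<in> \<V>"
    using admissible_subset[OF W] open_partition_mod0D(2,4)[OF R that] by simp
  have o: "open {y. \<exists>z\<in>\<Gamma>. dist y z < \<epsilon>}" by (rule open_slab)
  have oc: "open (collar (T ^^ n) {W} \<epsilon>)" using f by (intro open_collar) auto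
  have "emeasure lborel (collar (T ^^ n) \<V> \<epsilon>)
      \<le> emeasure lborel (collar (T ^^ n) {W} \<epsilon> \<union> W \<inter> (T ^^ n) -` {y. \<exists>z\<in>\<Gamma>. dist y z < \<epsilon>})"
    using ch(2)[of \<epsilon>] oc open_Int_vimage[OF f(1,3) o] by (intro emeasure_mono) auto
  also have "\<dots> \<le> emeasure lborel (collar (T ^^ n) {W} \<epsilon>)
       + emeasure lborel (W \<inter> (T ^^ n) -` {y. \<exists>z\<in>\<Gamma>. dist y z < \<epsilon>})"
    using oc open_Int_vimage[OF f(1,3) o] by (intro emeasure_subadditive) auto
  finally show "emeasure lborel (collar (T ^^ n) \<V> \<epsilon>) \<le> emeasure lborel (collar (T ^^ n) {W} \<epsilon>)
       + emeasure lborel (W \<inter> (T ^^ n) -` {y. \<exists>z\<in>\<Gamma>. dist y z < \<epsilon>})" .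
qed

text \<open>The cutting spheres are chosen afresh for every piece, thin for its push-forward under
  T^n. As the constant of \<open>cells_exist\<close> is the same for all finite measures, the cost
  is a fixed multiple of the mass, however small the image.\<close>

lemma coarse_chop:
  obtains C :: real where "0 \<le> C"
    "\<And>n \<W>. disjoint \<W> \<Longrightarrow> (\<And>W. W \<in> \<W> \<Longrightarrow> admissible n W) \<Longrightarrow>
      \<exists>\<V>. family n \<V> \<and> finer \<V> \<W> \<and> (\<forall>\<epsilon>. 0 < \<epsilon> \<and> \<epsilon> < 1 \<longrightarrow>
        emeasure lborel (collar (T ^^ n) \<V> \<epsilon>) \<le> emeasure lborel (collar (T ^^ n) \<W> \<epsilon>)
          + ennreal (C * \<epsilon> powr \<beta>) * emeasure lborel (\<Union>\<W>))"
proof -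
  obtain C :: real where C: "0 \<le> C"
    "\<And>\<mu> :: 'a measure. finite_measure \<mu> \<Longrightarrow> sets \<mu> = sets borel \<Longrightarrow>
      \<exists>\<C> \<Gamma>. cell_system X r \<C> \<Gamma> \<and>
        (\<forall>\<epsilon>. 0 < \<epsilon> \<and> \<epsilon> \<le> 1 \<longrightarrow> emeasure \<mu> {y. \<exists>z\<in>\<Gamma>. dist y z < \<epsilon>} \<le> ennreal (C * \<epsilon> powr \<beta>) * emeasure \<mu> UNIV)"
    using cells_exist[OF bounded_X r(1) \<beta>] by blast
  show thesis
  proof (rule that[OF C(1)])
    fix n :: nat and \<W> :: "'a set set"
    assume \<W>: "disjoint \<W>" and adm: "\<And>W. W \<in> \<W> \<Longrightarrow> admissible n W"
    let ?f = "T ^^ n"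
    have op: "\<And>W. W \<in> \<W> \<Longrightarrow> open W" and cont: "\<And>W. W \<in> \<W> \<Longrightarrow> continuous_on W ?f"
      using admissible_facts[OF adm] by simp_all
    have "\<exists>\<V>. open_partition_mod0 W \<V> \<and> (\<forall>V\<in>\<V>. admissible n V \<and> (\<forall>x\<in>?f ` V. \<forall>y\<in>?f ` V. dist x y \<le> r)) \<and>
        (\<forall>\<epsilon>. 0 < \<epsilon> \<and> \<epsilon> < 1 \<longrightarrow> emeasure lborel (collar ?f \<V> \<epsilon>)
          \<le> 1 * emeasure lborel (collar ?f {W} \<epsilon>) + ennreal (C * \<epsilon> powr \<beta>) * emeasure lborel W)"
      if W: "W \<in> \<W>" for W
    proof -
      note f = admissible_facts[OF adm[OF W]]
      obtain \<mu> :: "'a measure" where \<mu>: "finite_measure \<mu>" "sets \<mu> = sets borel"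
        "\<And>B. B \<in> sets borel \<Longrightarrow> emeasure \<mu> B = emeasure lborel (W \<inter> ?f -` B)"
        using pullback_measure_exists[OF f(1) bounded_subset[OF bounded_X f(2)] f(3)] by blast
      obtain \<C> \<Gamma> where c: "cell_system X r \<C> \<Gamma>"
        and thin: "\<forall>\<epsilon>. 0 < \<epsilon> \<and> \<epsilon> \<le> 1 \<longrightarrow> emeasure \<mu> {y. \<exists>z\<in>\<Gamma>. dist y z < \<epsilon>} \<le> ennreal (C * \<epsilon> powr \<beta>) * emeasure \<mu> UNIV"
        using C(2)[OF \<mu>(1,2)] by (elim exE conjE)
      let ?V = "(\<lambda>Q. W \<inter> ?f -` Q) ` \<C> - {{}}"
      note ch = admissible_chop[OF adm[OF W] c]
      have "emeasure lborel (collar ?f ?V \<epsilon>) \<le> 1 * emeasure lborel (collar ?f {W} \<epsilon>) + ennreal (C * \<epsilon> powr \<beta>) * emeasure lborel W"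
        if "0 < \<epsilon>" "\<epsilon> < 1" for \<epsilon>
      proof -
        have "emeasure lborel (W \<inter> ?f -` {y. \<exists>z\<in>\<Gamma>. dist y z < \<epsilon>}) \<le> ennreal (C * \<epsilon> powr \<beta>) * emeasure lborel W"
          using thin[rule_format, of \<epsilon>] that \<mu>(3)[of UNIV] \<mu>(3)[OF borel_open[OF open_slab[of \<Gamma> \<epsilon>]]] by simp
        then show ?thesis using ch(3)[of \<epsilon>] by (simp add: add_left_mono order_trans)
      qed
      moreover have "dist x y \<le> r" if "V \<in> ?V" "x \<in> ?f ` V" "y \<in> ?f ` V" for V x y
        using that cell_systemD(5)[OF c] by auto
      ultimately show ?thesis using ch(1,2) by (intro exI[of _ ?V]) simp
    qed
    then have "\<forall>W\<in>\<W>. \<exists>\<V>. open_partition_mod0 W \<V> \<and> (\<forall>V\<in>\<V>. admissible n V \<and> (\<forall>x\<in>?f ` V. \<forall>y\<in>?f ` V. dist x y \<le> r)) \<and>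
        (\<forall>\<epsilon>. 0 < \<epsilon> \<and> \<epsilon> < 1 \<longrightarrow> emeasure lborel (collar ?f \<V> \<epsilon>)
          \<le> 1 * emeasure lborel (collar ?f {W} \<epsilon>) + ennreal (C * \<epsilon> powr \<beta>) * emeasure lborel W)" by (rule ballI)
    from bchoice[OF this] obtain F where F0: "\<forall>W\<in>\<W>. open_partition_mod0 W (F W) \<and>
        (\<forall>V\<in>F W. admissible n V \<and> (\<forall>x\<in>?f ` V. \<forall>y\<in>?f ` V. dist x y \<le> r)) \<and>
        (\<forall>\<epsilon>. 0 < \<epsilon> \<and> \<epsilon> < 1 \<longrightarrow> emeasure lborel (collar ?f (F W) \<epsilon>)
          \<le> 1 * emeasure lborel (collar ?f {W} \<epsilon>) + ennreal (C * \<epsilon> powr \<beta>) * emeasure lborel W)"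
      by (elim exE)
    have F: "\<And>W. W \<in> \<W> \<Longrightarrow> open_partition_mod0 W (F W)"
      "\<And>W V. W \<in> \<W> \<Longrightarrow> V \<in> F W \<Longrightarrow> admissible n V"
      "\<And>W V x y. W \<in> \<W> \<Longrightarrow> V \<in> F W \<Longrightarrow> x \<in> ?f ` V \<Longrightarrow> y \<in> ?f ` V \<Longrightarrow> dist x y \<le> r"
      "\<And>W \<epsilon>. W \<in> \<W> \<Longrightarrow> 0 < \<epsilon> \<Longrightarrow> \<epsilon> < 1 \<Longrightarrow> emeasure lborel (collar ?f (F W) \<epsilon>)
          \<le> 1 * emeasure lborel (collar ?f {W} \<epsilon>) + ennreal (C * \<epsilon> powr \<beta>) * emeasure lborel W"
      using F0 by (meson, meson, meson, blast)
    let ?V = "\<Union>W\<in>\<W>. F W"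
    have fin: "finer ?V \<W>" by (rule finer_Union[OF \<W> op F(1)])
    note R = open_partition_mod0D[OF finerD(1)[OF fin]]
    have "family n ?V"
    proof (rule familyI[OF R(1,3)])
      fix V assume "V \<in> ?V"
      then obtain W where W: "W \<in> \<W>" "V \<in> F W" by (elim UN_E)
      show "admissible n V" by (rule F(2)[OF W])
      show "dist x y \<le> r" if "x \<in> ?f ` V" "y \<in> ?f ` V" for x y by (rule F(3)[OF W that])
    qed
    moreover have "emeasure lborel (collar ?f ?V \<epsilon>)
        \<le> emeasure lborel (collar ?f \<W> \<epsilon>) + ennreal (C * \<epsilon> powr \<beta>) * emeasure lborel (\<Union>\<W>)"
      if "0 < \<epsilon>" "\<epsilon> < 1" for \<epsilon>
    proof -
      have cV: "continuous_on V ?f" if "W \<in> \<W>" "V \<in> F W" for W V using admissible_facts(3)[OF F(2)[OF that]] .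
      show ?thesis
        using collar_Union_le[of \<W> F ?f ?f \<epsilon> 1 \<epsilon> "ennreal (C * \<epsilon> powr \<beta>)", OF \<W> op F(1) cV cont F(4)] that by simp
    qed
    ultimately show "\<exists>\<V>. family n \<V> \<and> finer \<V> \<W> \<and> (\<forall>\<epsilon>. 0 < \<epsilon> \<and> \<epsilon> < 1 \<longrightarrow>
        emeasure lborel (collar (T ^^ n) \<V> \<epsilon>) \<le> emeasure lborel (collar (T ^^ n) \<W> \<epsilon>)
          + ennreal (C * \<epsilon> powr \<beta>) * emeasure lborel (\<Union>\<W>))"
      using fin by blast
  qed
qed

text \<open>The dynamics comes first, since complexity applies to pieces with small images; after
  \<open>m\<close> steps images can be large again, and \<open>coarse_chop\<close> cuts them at the
  cost of the term with M.\<close>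

lemma growth_step:
  obtains C :: real where "0 \<le> C"
    "\<And>n \<W> B M. family n \<W> \<Longrightarrow> collar_bound n \<W> B \<Longrightarrow> 0 \<le> B \<Longrightarrow> 0 \<le> M \<Longrightarrow> emeasure lborel (\<Union>\<W>) \<le> ennreal M \<Longrightarrow>
      \<exists>\<V>. family (n + m) \<V> \<and> finer \<V> \<W> \<and> collar_bound (n + m) \<V> (\<theta> * B + C * M)"
proof -
  obtain C :: real where C: "0 \<le> C"
    "\<And>n \<W>. disjoint \<W> \<Longrightarrow> (\<And>W. W \<in> \<W> \<Longrightarrow> admissible n W) \<Longrightarrow>
      \<exists>\<V>. family n \<V> \<and> finer \<V> \<W> \<and> (\<forall>\<epsilon>. 0 < \<epsilon> \<and> \<epsilon> < 1 \<longrightarrow>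
        emeasure lborel (collar (T ^^ n) \<V> \<epsilon>) \<le> emeasure lborel (collar (T ^^ n) \<W> \<epsilon>)
          + ennreal (C * \<epsilon> powr \<beta>) * emeasure lborel (\<Union>\<W>))"
    using coarse_chop by blast
  show thesis
  proof (rule that[OF C(1)])
    fix n \<W> B M assume fam: "family n \<W>" and cb: "collar_bound n \<W> B" and B: "0 \<le> B" and M: "0 \<le> M"
      and mass: "emeasure lborel (\<Union>\<W>) \<le> ennreal M"
    note fD = familyD[OF fam]
    let ?F = "\<lambda>W. (\<lambda>A. W \<inter> (T ^^ n) -` A) ` cylinders X P T m - {{}}"
    let ?K = "1 + exp (dist_const * r powr \<alpha>) * \<sigma>"
    have R: "open_partition_mod0 W (?F W)" if "W \<in> \<W>" for W using dynamic_partition(1)[OF fD(2)[OF that]] .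
    have adm: "admissible (n + m) V" if "W \<in> \<W>" "V \<in> ?F W" for W V
      using dynamic_partition(2)[OF fD(2)[OF that(1)] that(2)] .
    define \<U> where "\<U> = (\<Union>W\<in>\<W>. ?F W)"
    have fU: "finer \<U> \<W>" unfolding \<U>_def by (rule finer_Union[OF fD(1,5) R])
    have cU: "emeasure lborel (collar (T ^^ (n + m)) \<U> \<epsilon>) \<le> ennreal ?K * emeasure lborel (collar (T ^^ n) \<W> (\<Lambda> ^ m * \<epsilon>))"
      if \<epsilon>: "0 < \<epsilon>" "\<epsilon> < \<epsilon>\<^sub>2" for \<epsilon>
    proof -
      have "emeasure lborel (collar (T ^^ (n + m)) (?F W) \<epsilon>)
          \<le> ennreal ?K * emeasure lborel (collar (T ^^ n) {W} (\<Lambda> ^ m * \<epsilon>)) + 0 * emeasure lborel W" if "W \<in> \<W>" for W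
        using dynamic_collar[OF fD(2)[OF that] fD(3)[OF that] fD(4)[OF that] r(2,3) complexity \<sigma>_nonneg \<epsilon>] by simp
      from collar_Union_le[of \<W> ?F, OF fD(1,5) R admissible_facts(3)[OF adm] fD(6) this]
      show ?thesis unfolding \<U>_def by simp
    qed
    have admU: "admissible (n + m) V" if "V \<in> \<U>" for V
      using that unfolding \<U>_def by (elim UN_E) (rule adm)
    obtain \<V> where V: "family (n + m) \<V>" "finer \<V> \<U>"
      "\<And>\<epsilon>. 0 < \<epsilon> \<Longrightarrow> \<epsilon> < 1 \<Longrightarrow> emeasure lborel (collar (T ^^ (n + m)) \<V> \<epsilon>) \<le> emeasure lborel (collar (T ^^ (n + m)) \<U> \<epsilon>)
          + ennreal (C * \<epsilon> powr \<beta>) * emeasure lborel (\<Union>\<U>)"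
      using C(2)[of \<U> "n + m", OF open_partition_mod0D(1)[OF finerD(1)[OF fU]] admU] by blast
    have "collar_bound (n + m) \<V> (\<theta> * B + C * M)"
      unfolding collar_bound_def
    proof (intro allI impI, elim conjE)
      fix \<epsilon> :: real assume \<epsilon>: "0 < \<epsilon>" "\<epsilon> < \<epsilon>\<^sub>2" "\<epsilon> < 1"
      have l: "0 < \<Lambda> ^ m" "\<Lambda> ^ m \<le> 1" using const_facts by (auto intro: power_le_one)
      \<comment> \<open>The old bound is evaluated at the smaller width
        \<open>\<Lambda> ^ m * \<epsilon>\<close>, which therefore stays in its range.\<close>
      have le: "\<Lambda> ^ m * \<epsilon> \<le> \<epsilon>" using l \<epsilon> mult_right_mono[of "\<Lambda> ^ m" 1 \<epsilon>] by simp
      have K0: "0 \<le> ?K" using \<sigma>_nonneg by simp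
      have "emeasure lborel (collar (T ^^ n) \<W> (\<Lambda> ^ m * \<epsilon>)) \<le> ennreal (B * (\<Lambda> ^ m * \<epsilon>) powr \<beta>)"
      proof (rule collar_boundD[OF cb])
        show "0 < \<Lambda> ^ m * \<epsilon>" using l \<epsilon> by (intro mult_pos_pos)
        show "\<Lambda> ^ m * \<epsilon> < \<epsilon>\<^sub>2" "\<Lambda> ^ m * \<epsilon> < 1" using le \<epsilon> by linarith+
      qed
      then have "emeasure lborel (collar (T ^^ (n + m)) \<U> \<epsilon>) \<le> ennreal ?K * ennreal (B * (\<Lambda> ^ m * \<epsilon>) powr \<beta>)"
        using cU[OF \<epsilon>(1,2)] by (meson mult_left_mono order_trans zero_le)
      also have "\<dots> = ennreal (\<theta> * B * \<epsilon> powr \<beta>)"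
        using K0 B l \<epsilon> unfolding \<theta>_def by (simp add: ennreal_mult[symmetric] powr_mult mult_ac)
      finally have 1: "emeasure lborel (collar (T ^^ (n + m)) \<U> \<epsilon>) \<le> ennreal (\<theta> * B * \<epsilon> powr \<beta>)" .
      have "emeasure lborel (\<Union>\<U>) \<le> emeasure lborel (\<Union>\<W>)"
        using finerD(3)[OF fU] family_bounded(2)[OF fam] by (intro emeasure_mono) auto
      then have "emeasure lborel (\<Union>\<U>) \<le> ennreal M" using mass by (rule order_trans)
      then have 2: "ennreal (C * \<epsilon> powr \<beta>) * emeasure lborel (\<Union>\<U>) \<le> ennreal (C * \<epsilon> powr \<beta>) * ennreal M"
        by (rule mult_left_mono) simp
      have "emeasure lborel (collar (T ^^ (n + m)) \<V> \<epsilon>) \<le> ennreal (\<theta> * B * \<epsilon> powr \<beta>) + ennreal (C * \<epsilon> powr \<beta>) * ennreal M"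
        using V(3)[OF \<epsilon>(1,3)] add_mono[OF 1 2] by (rule order_trans)
      also have "\<dots> = ennreal ((\<theta> * B + C * M) * \<epsilon> powr \<beta>)"
        using \<theta> B C(1) M
        by (simp add: ennreal_mult[symmetric] ennreal_plus[symmetric] algebra_simps del: ennreal_plus)
      finally show "emeasure lborel (collar (T ^^ (n + m)) \<V> \<epsilon>) \<le> ennreal ((\<theta> * B + C * M) * \<epsilon> powr \<beta>)" .
    qed
    then show "\<exists>\<V>. family (n + m) \<V> \<and> finer \<V> \<W> \<and> collar_bound (n + m) \<V> (\<theta> * B + C * M)"
      using V(1) finer_trans[OF fU V(2)] by blast
  qed
qed

lemma growth:
  obtains A :: real where "0 \<le> A"
    "\<And>N n \<W> B M. family n \<W> \<Longrightarrow> collar_bound n \<W> B \<Longrightarrow> 0 \<le> B \<Longrightarrow> 0 \<le> M \<Longrightarrow> emeasure lborel (\<Union>\<W>) \<le> ennreal M \<Longrightarrow>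
      \<exists>\<V>. family (n + N * m) \<V> \<and> finer \<V> \<W> \<and> collar_bound (n + N * m) \<V> (\<theta> ^ N * B + A * M)"
proof -
  obtain C :: real where C: "0 \<le> C"
    "\<And>n \<W> B M. family n \<W> \<Longrightarrow> collar_bound n \<W> B \<Longrightarrow> 0 \<le> B \<Longrightarrow> 0 \<le> M \<Longrightarrow> emeasure lborel (\<Union>\<W>) \<le> ennreal M \<Longrightarrow>
      \<exists>\<V>. family (n + m) \<V> \<and> finer \<V> \<W> \<and> collar_bound (n + m) \<V> (\<theta> * B + C * M)"
    using growth_step by blast
  \<comment> \<open>The sum of the costs C \<theta>^i over all blocks, that is, the fixed point of x
    \<mapsto> \<theta> x + C; it does not depend on the number of blocks.\<close>
  define A where "A = C / (1 - \<theta>)"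
  have A: "0 \<le> A" "\<theta> * A + C = A" unfolding A_def using C(1) \<theta> by (auto simp: field_simps)
  show thesis
  proof (rule that[OF A(1)])
    fix N n \<W> B M assume fam: "family n \<W>" and cb: "collar_bound n \<W> B" and B: "0 \<le> B" and M: "0 \<le> M"
      and mass: "emeasure lborel (\<Union>\<W>) \<le> ennreal M"
    show "\<exists>\<V>. family (n + N * m) \<V> \<and> finer \<V> \<W> \<and> collar_bound (n + N * m) \<V> (\<theta> ^ N * B + A * M)"
    proof (induction N)
      case 0
      have "collar_bound n \<W> (B + A * M)"
        unfolding collar_bound_def
      proof (intro allI impI)
        fix \<epsilon> :: real assume "0 < \<epsilon> \<and> \<epsilon> < \<epsilon>\<^sub>2 \<and> \<epsilon> < 1"
        then have "emeasure lborel (collar (T ^^ n) \<W> \<epsilon>) \<le> ennreal (B * \<epsilon> powr \<beta>)" using cb unfolding collar_bound_def by simp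
        also have "\<dots> \<le> ennreal ((B + A * M) * \<epsilon> powr \<beta>)" using A M by (intro ennreal_leI mult_right_mono) auto
        finally show "emeasure lborel (collar (T ^^ n) \<W> \<epsilon>) \<le> ennreal ((B + A * M) * \<epsilon> powr \<beta>)" .
      qed
      moreover have "finer \<W> \<W>" using familyD[OF fam] by (intro finer_refl) auto
      ultimately show ?case using fam by auto
    next
      case (Suc N)
      then obtain \<V> where V: "family (n + N * m) \<V>" "finer \<V> \<W>" "collar_bound (n + N * m) \<V> (\<theta> ^ N * B + A * M)" by blast
      have mV: "emeasure lborel (\<Union>\<V>) \<le> ennreal M"
      proof -
        have "emeasure lborel (\<Union>\<V>) \<le> emeasure lborel (\<Union>\<W>)"
          using finerD(3)[OF V(2)] family_bounded(2)[OF fam] by (intro emeasure_mono) auto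
        then show ?thesis using mass by simp
      qed
      have "0 \<le> \<theta> ^ N * B + A * M" using \<theta> B A M by simp
      then obtain \<U> where U: "family (n + N * m + m) \<U>" "finer \<U> \<V>"
        "collar_bound (n + N * m + m) \<U> (\<theta> * (\<theta> ^ N * B + A * M) + C * M)"
        using C(2)[OF V(1,3) _ M mV] by blast
      have "\<theta> * (\<theta> ^ N * B + A * M) + C * M = \<theta> ^ Suc N * B + (\<theta> * A + C) * M" by (simp add: algebra_simps)
      moreover have "n + N * m + m = n + Suc N * m" by simp
      ultimately have "family (n + Suc N * m) \<U>" "collar_bound (n + Suc N * m) \<U> (\<theta> ^ Suc N * B + A * M)"
        using U(1,3) A(2) by (simp_all only:)
      then show ?case using finer_trans[OF V(2) U(2)] by blast
    qed
  qed
qed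

end

section \<open>Stopping on full cells\<close>

context controlled_map
begin

text \<open>The cells are fixed beforehand and not adapted to the piece. An image containing a full
  cell has volume at least \<open>c\<close>, so slabs around \<Gamma> fill at most the proportion
  \<open>C\<^sub>1 * \<epsilon> powr \<beta> / c\<close> of it, and distortion transfers this to the
  piece. For almost every point outside the collar of width \<delta>, the whole cell of its image
  point, of diameter at most \<delta>/2, meets \<open>X\<close> only inside the image.\<close>

lemma stop:
  fixes c C\<^sub>1 \<delta> :: real
  assumes cs: "cell_system X (\<delta> / 2) \<C> \<Gamma>" and \<delta>: "0 < \<delta>"
    and thin: "\<forall>\<epsilon>. 0 < \<epsilon> \<and> \<epsilon> < 1 \<longrightarrow> emeasure lborel (X \<inter> {y. \<exists>z\<in>\<Gamma>. dist y z < \<epsilon>}) \<le> ennreal (C\<^sub>1 * \<epsilon> powr \<beta>)"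
    and C\<^sub>1: "0 \<le> C\<^sub>1" and c: "0 < c" "\<forall>Q\<in>(\<lambda>Q. X \<inter> Q) ` \<C> - {{}}. ennreal c \<le> emeasure lborel Q"
    and fam: "family n \<W>"
  shows "\<exists>\<V>. family n \<V> \<and> finer \<V> \<W> \<and>
      (\<forall>\<epsilon>. 0 < \<epsilon> \<and> \<epsilon> < 1 \<longrightarrow> emeasure lborel (collar (T ^^ n) \<V> \<epsilon>) \<le> emeasure lborel (collar (T ^^ n) \<W> \<epsilon>)
        + ennreal (exp (dist_const * r powr \<alpha>) * C\<^sub>1 / c * \<epsilon> powr \<beta>) * emeasure lborel (\<Union>\<W>)) \<and>
      emeasure lborel (\<Union>{V \<in> \<V>. (T ^^ n) ` V \<notin> (\<lambda>Q. X \<inter> Q) ` \<C> - {{}}}) \<le> emeasure lborel (collar (T ^^ n) \<W> \<delta>)"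
proof -
  note fD = familyD[OF fam] and csD = cell_systemD[OF cs]
  let ?f = "T ^^ n"
  let ?R = "(\<lambda>Q. X \<inter> Q) ` \<C> - {{}}"
  let ?K = "exp (dist_const * r powr \<alpha>)"
  let ?slab = "\<lambda>\<epsilon>. {y. \<exists>z\<in>\<Gamma>. dist y z < \<epsilon>}"
  \<comment> \<open>Only these pieces are cut: an image without a full cell has no lower volume
    bound, and there is no cell in it to stop on.\<close>
  define full where "full W \<longleftrightarrow> (\<exists>Q\<in>?R. Q \<subseteq> ?f ` W)" for W
  define F where "F W = (if full W then (\<lambda>Q. W \<inter> ?f -` Q) ` \<C> - {{}} else {W})" for W
  have R: "open_partition_mod0 W (F W)" if "W \<in> \<W>" for W
    using admissible_chop(1)[OF fD(2)[OF that] cs] open_partition_mod0_self[OF fD(5)[OF that] fD(3)[OF that]]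
    unfolding F_def by simp
  have adm: "admissible n V" if "W \<in> \<W>" "V \<in> F W" for W V
    by (rule admissible_subset[OF fD(2)[OF that(1)] open_partition_mod0D(4,2)[OF R[OF that(1)] that(2)]])
  have fullV: "emeasure lborel (W \<inter> ?f -` ?slab \<epsilon>) \<le> ennreal (?K * C\<^sub>1 / c * \<epsilon> powr \<beta>) * emeasure lborel W"
    if W: "W \<in> \<W>" "full W" and \<epsilon>: "0 < \<epsilon>" "\<epsilon> < 1" for W \<epsilon>
  proof -
    note f = admissible_facts[OF fD(2)[OF W(1)]]
    obtain Q where Q: "Q \<in> ?R" "Q \<subseteq> ?f ` W" using W(2) unfolding full_def by blast
    have "ennreal c \<le> emeasure lborel Q" using c(2) Q(1) by (rule bspec)
    also have "\<dots> \<le> emeasure lborel (?f ` W)" using Q(2) f(5) by (intro emeasure_mono) auto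
    finally have cV: "ennreal c \<le> emeasure lborel (?f ` W)" .
    have e1: "W \<inter> ?f -` (?f ` W \<inter> ?slab \<epsilon>) = W \<inter> ?f -` ?slab \<epsilon>" and e2: "W \<inter> ?f -` (?f ` W) = W" by auto
    \<comment> \<open>Multiplying by \<open>c\<close> replaces division by the volume of the image;
      \<open>c\<close> is cancelled at the end.\<close>
    have "ennreal c * emeasure lborel (W \<inter> ?f -` ?slab \<epsilon>) \<le> emeasure lborel (W \<inter> ?f -` (?f ` W \<inter> ?slab \<epsilon>)) * emeasure lborel (?f ` W)"
      unfolding e1 using cV by (subst mult.commute) (rule mult_left_mono, simp_all)
    also have "emeasure lborel (W \<inter> ?f -` (?f ` W \<inter> ?slab \<epsilon>)) * emeasure lborel (?f ` W)
        \<le> ennreal ?K * (emeasure lborel (?f ` W \<inter> ?slab \<epsilon>) * emeasure lborel (W \<inter> ?f -` (?f ` W)))"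
    proof (rule branch_distortion[OF admissible_branch[OF fD(2)[OF W(1)]]])
      show "?f ` W \<inter> ?slab \<epsilon> \<in> sets borel" using f(5) open_slab by (intro borel_open open_Int)
      show "\<And>x y. x \<in> ?f ` W \<Longrightarrow> y \<in> ?f ` W \<Longrightarrow> dist x y \<le> r" by (rule fD(4)[OF W(1)])
    qed (use const_facts r f(5) in auto)
    also have "\<dots> \<le> ennreal ?K * (ennreal (C\<^sub>1 * \<epsilon> powr \<beta>) * emeasure lborel W)"
      unfolding e2
    proof (intro mult_left_mono mult_right_mono)
      have "emeasure lborel (?f ` W \<inter> ?slab \<epsilon>) \<le> emeasure lborel (X \<inter> ?slab \<epsilon>)"
        using f(6) open_X open_slab[of \<Gamma> \<epsilon>] by (intro emeasure_mono) auto
      then show "emeasure lborel (?f ` W \<inter> ?slab \<epsilon>) \<le> ennreal (C\<^sub>1 * \<epsilon> powr \<beta>)"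
        using thin[rule_format, OF conjI[OF \<epsilon>]] by (rule order_trans)
    qed simp_all
    also have "\<dots> = ennreal c * (ennreal (?K * C\<^sub>1 / c * \<epsilon> powr \<beta>) * emeasure lborel W)"
      using c(1) C\<^sub>1 by (simp add: ennreal_mult[symmetric] mult.assoc[symmetric])
    finally show ?thesis using c(1) by (simp add: ennreal_mult_le_mult_iff)
  qed
  have colF: "emeasure lborel (collar ?f (F W) \<epsilon>)
      \<le> 1 * emeasure lborel (collar ?f {W} \<epsilon>) + ennreal (?K * C\<^sub>1 / c * \<epsilon> powr \<beta>) * emeasure lborel W"
    if W: "W \<in> \<W>" and \<epsilon>: "0 < \<epsilon>" "\<epsilon> < 1" for W \<epsilon>
  proof (cases "full W")
    case True
    then show ?thesis
      using admissible_chop(3)[OF fD(2)[OF W] cs, of \<epsilon>] fullV[OF W True \<epsilon>]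
      unfolding F_def by (simp add: add_left_mono order_trans)
  qed (simp add: F_def)
  let ?V = "\<Union>W\<in>\<W>. F W"
  have fin: "finer ?V \<W>" by (rule finer_Union[OF fD(1,5) R])
  note RV = open_partition_mod0D[OF finerD(1)[OF fin]]
  have "family n ?V"
  proof (rule familyI[OF RV(1,3)])
    fix V assume "V \<in> ?V"
    then obtain W where W: "W \<in> \<W>" "V \<in> F W" by (elim UN_E)
    show "admissible n V" by (rule adm[OF W])
    have "V \<subseteq> W" by (rule open_partition_mod0D(4)[OF R[OF W(1)] W(2)])
    then show "dist x y \<le> r" if "x \<in> ?f ` V" "y \<in> ?f ` V" for x y
      using fD(4)[OF W(1)] that by blast
  qed
  moreover have "emeasure lborel (collar ?f ?V \<epsilon>) \<le> emeasure lborel (collar ?f \<W> \<epsilon>)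
      + ennreal (?K * C\<^sub>1 / c * \<epsilon> powr \<beta>) * emeasure lborel (\<Union>\<W>)" if \<epsilon>: "0 < \<epsilon>" "\<epsilon> < 1" for \<epsilon>
    using collar_Union_le[of \<W> F ?f ?f \<epsilon> 1 \<epsilon> "ennreal (?K * C\<^sub>1 / c * \<epsilon> powr \<beta>)",
        OF fD(1,5) R admissible_facts(3)[OF adm] fD(6) colF] \<epsilon> by simp
  moreover have "emeasure lborel (\<Union>{V \<in> ?V. ?f ` V \<notin> ?R}) \<le> emeasure lborel (collar ?f \<W> \<delta>)"
  proof -
    \<comment> \<open>Points mapped into \<Gamma> may belong to no cell, but they form a null
      set.\<close>
    define Z where "Z = (\<Union>W\<in>\<W>. W \<inter> ?f -` \<Gamma>)"
    have "countable \<W>" using countable_disjoint_open_subsets[OF fD(5,1)] .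
    then have Z: "Z \<in> null_sets lebesgue"
      unfolding Z_def using branch_null[OF admissible_branch[OF fD(2)] csD(7)] by (intro null_sets_UN') auto
    have deep: "\<exists>Q\<in>\<C>. ?f x \<in> Q \<and> X \<inter> Q \<in> ?R \<and> X \<inter> Q \<subseteq> ?f ` W"
      if W: "W \<in> \<W>" "x \<in> W" and x: "x \<notin> Z" "x \<notin> collar ?f \<W> \<delta>" for W x
    proof -
      note f = admissible_facts[OF fD(2)[OF W(1)]]
      have y: "?f x \<in> ?f ` W" "?f x \<in> X" using W(2) f(6) by blast+
      have "?f x \<notin> \<Gamma>" using x(1) W unfolding Z_def by blast
      then obtain Q where Q: "Q \<in> \<C>" "?f x \<in> Q" using csD(6) y(2) by blast
      have "\<delta> \<le> infdist (?f x) (frontier (?f ` W))" using x(2) W unfolding collar_def by force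
      then have b: "ball (?f x) \<delta> \<subseteq> ?f ` W" by (rule ball_subset_of_infdist[OF y(1)])
      have "Q \<subseteq> ball (?f x) \<delta>"
      proof
        fix z assume "z \<in> Q"
        then have "dist (?f x) z \<le> \<delta> / 2" using csD(5)[OF Q] by simp
        then show "z \<in> ball (?f x) \<delta>" using \<delta> by simp
      qed
      then have "X \<inter> Q \<subseteq> ?f ` W" using b by blast
      moreover have "X \<inter> Q \<noteq> {}" using y(2) Q(2) by blast
      ultimately show ?thesis using Q by blast
    qed
    have sub: "\<Union>{V \<in> ?V. ?f ` V \<notin> ?R} \<subseteq> collar ?f \<W> \<delta> \<union> Z"
    proof
      fix x assume "x \<in> \<Union>{V \<in> ?V. ?f ` V \<notin> ?R}"
      then obtain V where V: "V \<in> ?V" "?f ` V \<notin> ?R" "x \<in> V" by blast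
      from V(1) obtain W where W: "W \<in> \<W>" "V \<in> F W" by (elim UN_E)
      have xW: "x \<in> W" using open_partition_mod0D(4)[OF R[OF W(1)] W(2)] V(3) by blast
      show "x \<in> collar ?f \<W> \<delta> \<union> Z"
      proof (rule ccontr)
        assume "x \<notin> collar ?f \<W> \<delta> \<union> Z"
        then obtain Q where Q: "Q \<in> \<C>" "?f x \<in> Q" "X \<inter> Q \<in> ?R" "X \<inter> Q \<subseteq> ?f ` W"
          using deep[OF W(1) xW] by auto
        then have "full W" unfolding full_def by blast
        then obtain Q' where Q': "Q' \<in> \<C>" "V = W \<inter> ?f -` Q'" using W(2) unfolding F_def by auto
        have "?f x \<in> Q'" using V(3) Q' by blast
        then have "Q' = Q" using csD(2) Q(1,2) Q'(1) unfolding pairwise_def disjnt_def by blast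
        have fX: "?f ` W \<subseteq> X" using admissible_facts(6)[OF fD(2)[OF W(1)]] .
        \<comment> \<open>All of \<open>X \<inter> Q\<close> lies inside the image and the image
          inside \<open>X\<close>, so the cut piece maps exactly onto \<open>X \<inter> Q\<close>
          and is stopped.\<close>
        have "?f ` V = ?f ` W \<inter> Q" unfolding Q'(2) \<open>Q' = Q\<close> by auto
        also have "\<dots> = X \<inter> Q" using Q(4) fX by blast
        finally show False using V(2) Q(3) by simp
      qed
    qed
    have op: "open (\<Union>{V \<in> ?V. ?f ` V \<notin> ?R})" using RV(2) by (intro open_Union) auto
    have oc: "open (collar ?f \<W> \<delta>)" by (rule open_collar[OF fD(5,6)])
    \<comment> \<open>\<open>Z\<close> is only known to be Lebesgue measurable, hence the detour
      through \<open>lebesgue\<close>.\<close>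
    have "emeasure lebesgue (\<Union>{V \<in> ?V. ?f ` V \<notin> ?R}) \<le> emeasure lebesgue (collar ?f \<W> \<delta> \<union> Z)"
      using sub oc Z by (intro emeasure_mono sets.Un) auto
    also have "\<dots> = emeasure lebesgue (collar ?f \<W> \<delta>)"
      using oc Z by (intro emeasure_Un_null_set) auto
    finally show ?thesis using op oc by simp
  qed
  ultimately show ?thesis using fin by (intro exI[of _ ?V]) simp
qed

text \<open>M and B are upper bounds, not the exact mass and best constant, so a round becomes an
  inequality between numbers; \<eta> is the exchange rate between mass and boundary.\<close>

definition state :: "real \<Rightarrow> real \<Rightarrow> nat \<Rightarrow> 'a set set \<Rightarrow> bool" where
  "state \<eta> L n \<W> \<longleftrightarrow> family n \<W> \<and> (\<exists>M B. 0 \<le> M \<and> 0 \<le> B \<and>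
     emeasure lborel (\<Union>\<W>) \<le> ennreal M \<and> collar_bound n \<W> B \<and> M + \<eta> * B \<le> L)"

lemma stateE:
  assumes "state \<eta> L n \<W>"
  obtains M B where "family n \<W>" "0 \<le> M" "0 \<le> B" "emeasure lborel (\<Union>\<W>) \<le> ennreal M"
    "collar_bound n \<W> B" "M + \<eta> * B \<le> L"
  using assms unfolding state_def by (elim conjE exE)

lemma collar_bound_subset:
  assumes fam: "family n \<V>" and b: "collar_bound n \<V> B" and sub: "\<U> \<subseteq> \<V>"
  shows "collar_bound n \<U> B"
  unfolding collar_bound_def
proof (intro allI impI, elim conjE)
  fix \<epsilon> :: real assume \<epsilon>: "0 < \<epsilon>" "\<epsilon> < \<epsilon>\<^sub>2" "\<epsilon> < 1"
  have "emeasure lborel (collar (T ^^ n) \<U> \<epsilon>) \<le> emeasure lborel (collar (T ^^ n) \<V> \<epsilon>)"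
    using open_collar[OF familyD(5,6)[OF fam], where \<epsilon>=\<epsilon>] collar_mono[OF sub] by (intro emeasure_mono) auto
  then show "emeasure lborel (collar (T ^^ n) \<U> \<epsilon>) \<le> ennreal (B * \<epsilon> powr \<beta>)"
    using collar_boundD[OF b \<epsilon>] by (rule order_trans)
qed

text \<open>Here the regularity of the boundary of \<open>X\<close> enters: the cells are
  \<open>X\<close> cut at time 0, and K \<epsilon> \<le> K \<epsilon>^\<beta> since \<epsilon> < 1.
  Finitely many nonempty open cells have a common positive lower volume bound.\<close>

lemma initial_cells:
  fixes \<delta> K :: real
  assumes \<delta>: "0 < \<delta>" "\<delta> \<le> r" and K: "0 \<le> K" "\<forall>\<epsilon>. 0 < \<epsilon> \<and> \<epsilon> < 1 \<longrightarrow> emeasure lborel (inner_collar \<epsilon> X) \<le> ennreal (K * \<epsilon>)"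
  shows "\<exists>\<C> \<Gamma> c C\<^sub>1 B. cell_system X (\<delta> / 2) \<C> \<Gamma> \<and> 0 < c \<and> 0 \<le> C\<^sub>1 \<and> 0 \<le> B \<and>
    (\<forall>\<epsilon>. 0 < \<epsilon> \<and> \<epsilon> < 1 \<longrightarrow> emeasure lborel (X \<inter> {y. \<exists>z\<in>\<Gamma>. dist y z < \<epsilon>}) \<le> ennreal (C\<^sub>1 * \<epsilon> powr \<beta>)) \<and>
    (\<forall>Q\<in>(\<lambda>Q. X \<inter> Q) ` \<C> - {{}}. ennreal c \<le> emeasure lborel Q) \<and>
    open_partition_mod0 X ((\<lambda>Q. X \<inter> Q) ` \<C> - {{}}) \<and>
    family 0 ((\<lambda>Q. X \<inter> Q) ` \<C> - {{}}) \<and> collar_bound 0 ((\<lambda>Q. X \<inter> Q) ` \<C> - {{}}) B"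
proof -
  obtain \<mu> :: "'a measure" where \<mu>: "finite_measure \<mu>" "sets \<mu> = sets borel"
    "\<And>B. B \<in> sets borel \<Longrightarrow> emeasure \<mu> B = emeasure lborel (X \<inter> (\<lambda>x. x) -` B)"
    using pullback_measure_exists[OF open_X bounded_X continuous_on_id] by blast
  have "0 < \<delta> / 2" using \<delta> by simp
  then obtain C :: real where C: "0 \<le> C"
    "\<And>\<mu> :: 'a measure. finite_measure \<mu> \<Longrightarrow> sets \<mu> = sets borel \<Longrightarrow>
      \<exists>\<C> \<Gamma>. cell_system X (\<delta> / 2) \<C> \<Gamma> \<and>
        (\<forall>\<epsilon>. 0 < \<epsilon> \<and> \<epsilon> \<le> 1 \<longrightarrow> emeasure \<mu> {y. \<exists>z\<in>\<Gamma>. dist y z < \<epsilon>} \<le> ennreal (C * \<epsilon> powr \<beta>) * emeasure \<mu> UNIV)"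
    using cells_exist[OF bounded_X _ \<beta>] by blast
  obtain \<C> \<Gamma> where cs: "cell_system X (\<delta> / 2) \<C> \<Gamma>"
    and thin: "\<forall>\<epsilon>. 0 < \<epsilon> \<and> \<epsilon> \<le> 1 \<longrightarrow> emeasure \<mu> {y. \<exists>z\<in>\<Gamma>. dist y z < \<epsilon>} \<le> ennreal (C * \<epsilon> powr \<beta>) * emeasure \<mu> UNIV"
    using C(2)[OF \<mu>(1,2)] by (elim exE conjE)
  note csD = cell_systemD[OF cs]
  let ?R = "(\<lambda>Q. X \<inter> Q) ` \<C> - {{}}"
  have admX: "admissible 0 X" using open_X unfolding admissible_def by simp
  have im: "(\<lambda>Q. X \<inter> (T ^^ 0) -` Q) ` \<C> - {{}} = ?R" by simp
  note ch = admissible_chop[OF admX cs, unfolded im]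
  define mX where "mX = measure lborel X"
  have mX: "emeasure lborel X = ennreal mX" "0 \<le> mX"
    unfolding mX_def using emeasure_bounded_finite[OF bounded_X] by (simp_all add: emeasure_eq_ennreal_measure less_top)
  define C\<^sub>1 where "C\<^sub>1 = C * mX"
  have C\<^sub>1: "0 \<le> C\<^sub>1" unfolding C\<^sub>1_def using C(1) mX by simp
  have th: "emeasure lborel (X \<inter> {y. \<exists>z\<in>\<Gamma>. dist y z < \<epsilon>}) \<le> ennreal (C\<^sub>1 * \<epsilon> powr \<beta>)" if \<epsilon>: "0 < \<epsilon>" "\<epsilon> < 1" for \<epsilon>
  proof -
    have "emeasure lborel (X \<inter> {y. \<exists>z\<in>\<Gamma>. dist y z < \<epsilon>}) = emeasure \<mu> {y. \<exists>z\<in>\<Gamma>. dist y z < \<epsilon>}"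
      using \<mu>(3)[OF borel_open[OF open_slab[of \<Gamma> \<epsilon>]]] by simp
    also have "\<dots> \<le> ennreal (C * \<epsilon> powr \<beta>) * emeasure \<mu> UNIV" using thin \<epsilon> by auto
    also have "\<dots> = ennreal (C\<^sub>1 * \<epsilon> powr \<beta>)"
      using \<mu>(3)[of UNIV] mX C(1) unfolding C\<^sub>1_def by (simp add: ennreal_mult[symmetric] mult_ac)
    finally show ?thesis .
  qed
  have Rpos: "0 < measure lborel Q" "emeasure lborel Q = ennreal (measure lborel Q)" if "Q \<in> ?R" for Q
  proof -
    have Q: "open Q" "Q \<noteq> {}" "bounded Q" using that csD(3) open_X bounded_X by auto
    show e: "emeasure lborel Q = ennreal (measure lborel Q)"
      using emeasure_bounded_finite[OF Q(3)] by (simp add: emeasure_eq_ennreal_measure less_top)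
    then show "0 < measure lborel Q" using emeasure_open_pos[OF Q(1,2)] by simp
  qed
  have finR: "finite ?R" using csD(1) by simp
  \<comment> \<open>The extra 1 keeps the minimum defined when \<open>X\<close> is empty and there
    are no cells.\<close>
  define c where "c = Min (insert 1 (measure lborel ` ?R))"
  have c0: "0 < c" unfolding c_def using finR Rpos(1) by (subst Min_gr_iff) auto
  have cQ: "ennreal c \<le> emeasure lborel Q" if "Q \<in> ?R" for Q
  proof -
    have "c \<le> measure lborel Q" unfolding c_def using finR that by (intro Min_le) auto
    then show ?thesis using Rpos(2)[OF that] by (simp add: ennreal_leI)
  qed
  have fam: "family 0 ?R"
  proof (rule familyI[OF open_partition_mod0D(1,3)[OF ch(1)]])
    show "admissible 0 Q" if "Q \<in> ?R" for Q using ch(2)[OF that] .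
    show "dist x y \<le> r" if q: "Q \<in> ?R" "x \<in> (T ^^ 0) ` Q" "y \<in> (T ^^ 0) ` Q" for Q x y
    proof -
      obtain Q' where "Q' \<in> \<C>" "x \<in> Q'" "y \<in> Q'" using q by auto
      then have "dist x y \<le> \<delta> / 2" by (rule csD(5))
      then show ?thesis using \<delta> by simp
    qed
  qed
  have "collar_bound 0 ?R (K + C\<^sub>1)"
    unfolding collar_bound_def
  proof (intro allI impI, elim conjE)
    fix \<epsilon> :: real assume \<epsilon>: "0 < \<epsilon>" "\<epsilon> < \<epsilon>\<^sub>2" "\<epsilon> < 1"
    have eq: "collar (T ^^ 0) {X} \<epsilon> = inner_collar \<epsilon> X" unfolding collar_def inner_collar_def by auto
    have "\<epsilon> powr 1 \<le> \<epsilon> powr \<beta>" using \<epsilon> \<beta> by (intro powr_mono') auto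
    then have "K * \<epsilon> \<le> K * \<epsilon> powr \<beta>" using K(1) \<epsilon> by (intro mult_left_mono) auto
    then have 1: "emeasure lborel (inner_collar \<epsilon> X) \<le> ennreal (K * \<epsilon> powr \<beta>)"
      using K(2) \<epsilon> by (meson ennreal_leI order_trans)
    have "emeasure lborel (collar (T ^^ 0) ?R \<epsilon>) \<le> emeasure lborel (inner_collar \<epsilon> X)
        + emeasure lborel (X \<inter> {y. \<exists>z\<in>\<Gamma>. dist y z < \<epsilon>})"
      using ch(3)[of \<epsilon>] unfolding eq by simp
    also have "\<dots> \<le> ennreal (K * \<epsilon> powr \<beta>) + ennreal (C\<^sub>1 * \<epsilon> powr \<beta>)"
      using 1 th[OF \<epsilon>(1,3)] by (rule add_mono)
    also have "\<dots> = ennreal ((K + C\<^sub>1) * \<epsilon> powr \<beta>)"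
      using K(1) C\<^sub>1 by (simp add: ennreal_plus[symmetric] distrib_right del: ennreal_plus)
    finally show "emeasure lborel (collar (T ^^ 0) ?R \<epsilon>) \<le> ennreal ((K + C\<^sub>1) * \<epsilon> powr \<beta>)" .
  qed
  moreover have "0 \<le> K + C\<^sub>1" using K(1) C\<^sub>1 by simp
  ultimately show ?thesis
    using cs c0 C\<^sub>1 th cQ ch(1) fam
    by (intro exI[of _ \<C>] exI[of _ \<Gamma>] exI[of _ c] exI[of _ C\<^sub>1] exI[of _ "K + C\<^sub>1"] conjI ballI allI impI; (elim conjE)?)
qed

text \<open>\<open>f j\<close> collects the pieces still running after j rounds of \<open>p\<close>
  steps, \<open>\<V> j\<close> their refinement one round later, and \<open>R\<close> the cells on
  which pieces are stopped. The mass bound is what remains of the halving of M + \<eta> B.\<close>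

lemma inducing_scheme:
  fixes K :: real
  assumes K: "0 \<le> K" "\<forall>\<epsilon>. 0 < \<epsilon> \<and> \<epsilon> < 1 \<longrightarrow> emeasure lborel (inner_collar \<epsilon> X) \<le> ennreal (K * \<epsilon>)"
  shows "\<exists>R p L f \<V>. finite R \<and> open_partition_mod0 X R \<and> 0 < p \<and> 0 \<le> L \<and> f 0 = R \<and> family 0 R \<and>
    (\<forall>j. family (Suc j * p) (\<V> j) \<and> finer (\<V> j) (f j) \<and>
      f (Suc j) = {V \<in> \<V> j. (T ^^ (Suc j * p)) ` V \<notin> R} \<and>
      emeasure lborel (\<Union>(f j)) \<le> ennreal (L / 2 ^ j))"
proof -
  obtain A :: real where A: "0 \<le> A"
    "\<And>N n \<W> B M. family n \<W> \<Longrightarrow> collar_bound n \<W> B \<Longrightarrow> 0 \<le> B \<Longrightarrow> 0 \<le> M \<Longrightarrow> emeasure lborel (\<Union>\<W>) \<le> ennreal M \<Longrightarrow>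
      \<exists>\<V>. family (n + N * m) \<V> \<and> finer \<V> \<W> \<and> collar_bound (n + N * m) \<V> (\<theta> ^ N * B + A * M)"
    using growth by blast
  obtain \<delta> where \<delta>: "0 < \<delta>" "\<delta> < 1" "\<delta> < \<epsilon>\<^sub>2" "\<delta> \<le> r" "A * \<delta> powr \<beta> \<le> 1 / 4"
  proof -
    \<comment> \<open>Chosen so that A d^\<beta> = A / (4 (A + 1)) \<le> 1/4, which bounds the
      unstopped mass caused by the term A M. The other entries of the minimum put \<delta> into the
      range of \<open>collar_bound\<close> and make the cells small enough for a family.\<close>
    define d where "d = (1 / (4 * (A + 1))) powr (1 / \<beta>)"
    have d: "0 < d" "d powr \<beta> = 1 / (4 * (A + 1))" unfolding d_def using A(1) \<beta> by (auto simp: powr_powr)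
    define \<delta> where "\<delta> = Min {1/2, \<epsilon>\<^sub>2 / 2, r, d}"
    have \<delta>: "0 < \<delta>" "\<delta> \<le> 1/2" "\<delta> \<le> \<epsilon>\<^sub>2 / 2" "\<delta> \<le> r" "\<delta> \<le> d"
      unfolding \<delta>_def using \<epsilon>\<^sub>2_pos r(1) d(1) by auto
    have "\<delta> powr \<beta> \<le> 1 / (4 * (A + 1))" using powr_mono2[of \<beta> \<delta> d] \<delta> \<beta> d(2) by simp
    then have "A * \<delta> powr \<beta> \<le> A * (1 / (4 * (A + 1)))" using A(1) by (intro mult_left_mono)
    also have "\<dots> \<le> 1 / 4" using A(1) by (simp add: field_simps)
    finally show thesis using that[of \<delta>] \<delta> \<epsilon>\<^sub>2_pos by simp
  qed
  obtain \<C> \<Gamma> c C\<^sub>1 B\<^sub>0 where cells: "cell_system X (\<delta> / 2) \<C> \<Gamma>" "0 < c" "0 \<le> C\<^sub>1" "0 \<le> B\<^sub>0"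
    "\<forall>\<epsilon>. 0 < \<epsilon> \<and> \<epsilon> < 1 \<longrightarrow> emeasure lborel (X \<inter> {y. \<exists>z\<in>\<Gamma>. dist y z < \<epsilon>}) \<le> ennreal (C\<^sub>1 * \<epsilon> powr \<beta>)"
    "\<forall>Q\<in>(\<lambda>Q. X \<inter> Q) ` \<C> - {{}}. ennreal c \<le> emeasure lborel Q"
    "open_partition_mod0 X ((\<lambda>Q. X \<inter> Q) ` \<C> - {{}})"
    "family 0 ((\<lambda>Q. X \<inter> Q) ` \<C> - {{}})" "collar_bound 0 ((\<lambda>Q. X \<inter> Q) ` \<C> - {{}}) B\<^sub>0"
    
    using initial_cells[OF \<delta>(1,4) K] by (elim exE conjE)
  define R where "R = (\<lambda>Q. X \<inter> Q) ` \<C> - {{}}"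
  define C\<^sub>R where "C\<^sub>R = exp (dist_const * r powr \<alpha>) * C\<^sub>1 / c"
  have C\<^sub>R: "0 \<le> C\<^sub>R" unfolding C\<^sub>R_def using cells(2,3) by simp
  \<comment> \<open>The boundary created per unit of mass, \<open>A + C\<^sub>R\<close>, then weighs
    at most 1/4; \<eta> depends on \<delta> through \<open>C\<^sub>R\<close>.\<close>
  define \<eta> where "\<eta> = 1 / (4 * (A + C\<^sub>R + 1))"
  have \<eta>: "0 < \<eta>" "\<eta> * (A + C\<^sub>R) \<le> 1 / 4" unfolding \<eta>_def using A(1) C\<^sub>R by (auto simp: field_simps)
  have d0: "0 < \<delta> powr \<beta>" using \<delta> by simp
  \<comment> \<open>Old boundary is paid for twice, as unstopped mass with factor \<delta>^\<beta>
    and as new boundary with weight \<eta>; N blocks of contraction reduce the total to half of its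
    old weight \<eta>.\<close>
  obtain N where N: "0 < N" "\<theta> ^ N * (\<delta> powr \<beta> + \<eta>) \<le> \<eta> / 2"
  proof -
    have "0 < \<eta> / (2 * (\<delta> powr \<beta> + \<eta>))"
      using \<eta>(1) d0 by (intro divide_pos_pos mult_pos_pos add_pos_pos) auto
    then obtain N where N: "\<theta> ^ N < \<eta> / (2 * (\<delta> powr \<beta> + \<eta>))" using real_arch_pow_inv[OF _ \<theta>(2)] by blast
    \<comment> \<open>Passing to \<open>Suc N\<close> makes the number of blocks positive, and hence
      \<open>p\<close> as well.\<close>
    have "\<theta> ^ Suc N \<le> \<theta> ^ N" using \<theta> by (intro power_decreasing) auto
    then have "\<theta> ^ Suc N \<le> \<eta> / (2 * (\<delta> powr \<beta> + \<eta>))" using N by simp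
    then have "\<theta> ^ Suc N * (\<delta> powr \<beta> + \<eta>) \<le> \<eta> / (2 * (\<delta> powr \<beta> + \<eta>)) * (\<delta> powr \<beta> + \<eta>)"
      using \<eta> d0 by (intro mult_right_mono) auto
    also have "\<dots> = \<eta> / 2"
    proof -
      have "\<delta> powr \<beta> + \<eta> \<noteq> 0" using \<eta>(1) d0 by linarith
      then show ?thesis by (simp add: divide_simps)
    qed
    finally show thesis using that[of "Suc N"] by simp
  qed
  define p where "p = N * m"
  have p: "0 < p" unfolding p_def using N(1) m_pos by simp
  have round: "\<exists>\<V>. family (n + p) \<V> \<and> finer \<V> \<W> \<and> state \<eta> (L / 2) (n + p) {V \<in> \<V>. (T ^^ (n + p)) ` V \<notin> R}"
    if st: "state \<eta> L n \<W>" for L n \<W>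
  proof -
    obtain M B where MB: "family n \<W>" "0 \<le> M" "0 \<le> B" "emeasure lborel (\<Union>\<W>) \<le> ennreal M"
      "collar_bound n \<W> B" "M + \<eta> * B \<le> L" using st by (rule stateE)
    define B\<^sub>1 where "B\<^sub>1 = \<theta> ^ N * B + A * M"
    have B\<^sub>1: "0 \<le> B\<^sub>1" unfolding B\<^sub>1_def using \<theta> MB A(1) by simp
    obtain \<U> where U: "family (n + p) \<U>" "finer \<U> \<W>" "collar_bound (n + p) \<U> B\<^sub>1"
      using A(2)[OF MB(1,5,3,2,4), of N] unfolding p_def B\<^sub>1_def by blast
    have mU: "emeasure lborel (\<Union>\<U>) \<le> ennreal M"
    proof -
      have "emeasure lborel (\<Union>\<U>) \<le> emeasure lborel (\<Union>\<W>)"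
        using finerD(3)[OF U(2)] family_bounded(2)[OF MB(1)] by (intro emeasure_mono) auto
      then show ?thesis using MB(4) by (rule order_trans)
    qed
    obtain \<V> where V: "family (n + p) \<V>" "finer \<V> \<U>"
      "\<And>\<epsilon>. 0 < \<epsilon> \<Longrightarrow> \<epsilon> < 1 \<Longrightarrow> emeasure lborel (collar (T ^^ (n + p)) \<V> \<epsilon>) \<le> emeasure lborel (collar (T ^^ (n + p)) \<U> \<epsilon>)
        + ennreal (C\<^sub>R * \<epsilon> powr \<beta>) * emeasure lborel (\<Union>\<U>)"
      "emeasure lborel (\<Union>{V \<in> \<V>. (T ^^ (n + p)) ` V \<notin> R}) \<le> emeasure lborel (collar (T ^^ (n + p)) \<U> \<delta>)"
      using stop[OF cells(1) \<delta>(1) cells(5) cells(3) cells(2) cells(6) U(1)] unfolding R_def C\<^sub>R_def by blast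
    let ?U = "{V \<in> \<V>. (T ^^ (n + p)) ` V \<notin> R}"
    have 1: "emeasure lborel (\<Union>?U) \<le> ennreal (B\<^sub>1 * \<delta> powr \<beta>)"
      using V(4) collar_boundD[OF U(3) \<delta>(1,3,2)] by (rule order_trans)
    have "collar_bound (n + p) \<V> (B\<^sub>1 + C\<^sub>R * M)"
      unfolding collar_bound_def
    proof (intro allI impI, elim conjE)
      fix \<epsilon> :: real assume \<epsilon>: "0 < \<epsilon>" "\<epsilon> < \<epsilon>\<^sub>2" "\<epsilon> < 1"
      have "emeasure lborel (collar (T ^^ (n + p)) \<V> \<epsilon>) \<le> ennreal (B\<^sub>1 * \<epsilon> powr \<beta>) + ennreal (C\<^sub>R * \<epsilon> powr \<beta>) * ennreal M"
        using V(3)[OF \<epsilon>(1,3)] add_mono[OF collar_boundD[OF U(3) \<epsilon>] mult_left_mono[OF mU zero_le]]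
        by (rule order_trans)
      also have "\<dots> = ennreal ((B\<^sub>1 + C\<^sub>R * M) * \<epsilon> powr \<beta>)"
        using B\<^sub>1 C\<^sub>R MB(2) by (simp add: ennreal_mult[symmetric] ennreal_plus[symmetric] algebra_simps del: ennreal_plus)
      finally show "emeasure lborel (collar (T ^^ (n + p)) \<V> \<epsilon>) \<le> ennreal ((B\<^sub>1 + C\<^sub>R * M) * \<epsilon> powr \<beta>)" .
    qed
    then have 2: "collar_bound (n + p) ?U (B\<^sub>1 + C\<^sub>R * M)" by (rule collar_bound_subset[OF V(1)]) auto
    \<comment> \<open>New mass plus \<eta> times new collar constant, sorted by the old B and M: the
      coefficients are at most \<eta>/2 and 1/4 + 1/4, half of the old ones.\<close>
    have "B\<^sub>1 * \<delta> powr \<beta> + \<eta> * (B\<^sub>1 + C\<^sub>R * M)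
        = \<theta> ^ N * (\<delta> powr \<beta> + \<eta>) * B + (A * \<delta> powr \<beta> + \<eta> * (A + C\<^sub>R)) * M"
      unfolding B\<^sub>1_def by (simp add: algebra_simps)
    also have "\<dots> \<le> \<eta> / 2 * B + (1 / 4 + 1 / 4) * M"
      using N(2) \<delta>(5) \<eta>(2) MB(2,3) by (intro add_mono mult_right_mono) auto
    also have "\<dots> \<le> L / 2" using MB(6) by simp
    finally have 3: "B\<^sub>1 * \<delta> powr \<beta> + \<eta> * (B\<^sub>1 + C\<^sub>R * M) \<le> L / 2" .
    have "family (n + p) ?U" by (rule family_subset[OF V(1)]) auto
    moreover have "0 \<le> B\<^sub>1 * \<delta> powr \<beta>" "0 \<le> B\<^sub>1 + C\<^sub>R * M" using B\<^sub>1 C\<^sub>R MB(2) by simp_all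
    ultimately have "state \<eta> (L / 2) (n + p) ?U" unfolding state_def using 1 2 3 by blast
    then show ?thesis using V(1) finer_trans[OF U(2) V(2)] by blast
  qed
  define M\<^sub>0 where "M\<^sub>0 = measure lborel (\<Union>R)"
  have famR: "family 0 R" using cells(8) unfolding R_def .
  have M\<^sub>0: "emeasure lborel (\<Union>R) = ennreal M\<^sub>0"
    unfolding M\<^sub>0_def using family_bounded(3)[OF famR] by (simp add: emeasure_eq_ennreal_measure less_top)
  define L where "L = M\<^sub>0 + \<eta> * B\<^sub>0"
  have L: "0 \<le> L" unfolding L_def M\<^sub>0_def using \<eta> cells(4) by simp
  have st0: "state \<eta> (L / 2 ^ 0) (0 * p) R"
  proof -
    have "0 \<le> M\<^sub>0" unfolding M\<^sub>0_def by simp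
    moreover have "collar_bound 0 R B\<^sub>0" using cells(9) unfolding R_def .
    ultimately show ?thesis unfolding state_def L_def using famR M\<^sub>0 cells(4)
      by (simp, intro exI[of _ M\<^sub>0] conjI exI[of _ B\<^sub>0]) simp_all
  qed
  define stp where "stp j \<W> \<V> \<longleftrightarrow> family (Suc j * p) \<V> \<and> finer \<V> \<W>" for j \<W> \<V>
  define uns where "uns j \<V> = {V \<in> \<V>. (T ^^ (Suc j * p)) ` V \<notin> R}" for j \<V>
  \<comment> \<open>The clause for j = 0 pins the start of the sequence to \<open>R\<close>; the
    refinements, hidden under an existential, are extracted afterwards by
    \<open>choice\<close>.\<close>
  have "\<exists>f. \<forall>j. (state \<eta> (L / 2 ^ j) (j * p) (f j) \<and> (j = 0 \<longrightarrow> f j = R)) \<and> (\<exists>\<V>. stp j (f j) \<V> \<and> f (Suc j) = uns j \<V>)"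
  proof (rule dependent_nat_choice)
    show "\<exists>\<W>. state \<eta> (L / 2 ^ 0) (0 * p) \<W> \<and> (0 = 0 \<longrightarrow> \<W> = R)" using st0 by blast
    fix \<W> j assume "state \<eta> (L / 2 ^ j) (j * p) \<W> \<and> (j = 0 \<longrightarrow> \<W> = R)"
    then obtain \<V> where V: "family (j * p + p) \<V>" "finer \<V> \<W>"
      "state \<eta> (L / 2 ^ j / 2) (j * p + p) {V \<in> \<V>. (T ^^ (j * p + p)) ` V \<notin> R}"
      using round by blast
    have e: "j * p + p = Suc j * p" "L / 2 ^ j / 2 = L / 2 ^ Suc j" by simp_all
    show "\<exists>\<W>'. (state \<eta> (L / 2 ^ Suc j) (Suc j * p) \<W>' \<and> (Suc j = 0 \<longrightarrow> \<W>' = R)) \<and> (\<exists>\<V>. stp j \<W> \<V> \<and> \<W>' = uns j \<V>)"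
      using V unfolding e stp_def uns_def by blast
  qed
  then obtain f where f: "\<And>j. state \<eta> (L / 2 ^ j) (j * p) (f j)" "f 0 = R"
    "\<forall>j. \<exists>\<V>. stp j (f j) \<V> \<and> f (Suc j) = uns j \<V>" by blast
  from choice[OF f(3)] obtain \<V> where V: "\<And>j. stp j (f j) (\<V> j)" "\<And>j. f (Suc j) = uns j (\<V> j)" by blast
  have "emeasure lborel (\<Union>(f j)) \<le> ennreal (L / 2 ^ j)" for j
  proof -
    obtain M B where "0 \<le> B" "emeasure lborel (\<Union>(f j)) \<le> ennreal M" "M + \<eta> * B \<le> L / 2 ^ j"
      using f(1)[of j] by (rule stateE)
    moreover have "M \<le> L / 2 ^ j" using calculation \<eta>(1) mult_nonneg_nonneg[of \<eta> B] by linarith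
    ultimately show ?thesis by (meson ennreal_leI order_trans)
  qed
  moreover have "finite R" unfolding R_def using cell_systemD(1)[OF cells(1)] by simp
  moreover have "open_partition_mod0 X R" using cells(7) unfolding R_def .
  ultimately show ?thesis
    using p L f(2) famR V unfolding stp_def uns_def
    by (intro exI[of _ R] exI[of _ p] exI[of _ L] exI[of _ f] exI[of _ \<V>]) simp
qed

end

section \<open>The induced map\<close>

text \<open>As r tends to 0 from the right, the expression tends to (1 + \<sigma>) q, which is below
  1 by the strict bound on \<sigma>. One parameter r serves both as diameter bound and as 1 -
  \<beta>.\<close>

lemma exists_scale:
  fixes c \<sigma> \<alpha> q u :: real
  assumes \<sigma>: "0 \<le> \<sigma>" "\<sigma> < 1 / q - 1" and q: "0 < q" and \<alpha>: "0 < \<alpha>" and u: "0 < u"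
  obtains r where "0 < r" "r < u" "(1 + exp (c * r powr \<alpha>) * \<sigma>) * q powr (1 - r) < 1"
proof -
  have id: "((\<lambda>r::real. r) \<longlongrightarrow> 0) (at_right 0)" by (rule tendsto_ident_at)
  have "((\<lambda>r::real. r powr \<alpha>) \<longlongrightarrow> 0) (at_right 0)"
    by (rule tendsto_zero_powrI[OF id tendsto_const _ \<alpha>]) (auto simp: eventually_at_filter)
  then have "((\<lambda>r. (1 + exp (c * r powr \<alpha>) * \<sigma>) * q powr (1 - r)) \<longlongrightarrow> (1 + exp (c * 0) * \<sigma>) * q powr (1 - 0)) (at_right 0)"
    using q id by (intro tendsto_intros) auto
  moreover have "(1 + exp (c * 0) * \<sigma>) * q powr (1 - 0) < 1" using \<sigma> q by (simp add: field_simps)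
  ultimately have "\<forall>\<^sub>F r in at_right 0. (1 + exp (c * r powr \<alpha>) * \<sigma>) * q powr (1 - r) < 1"
    by (rule order_tendstoD(2))
  moreover have "\<forall>\<^sub>F r in at_right 0. r < u" by (rule order_tendstoD(2)[OF id u])
  moreover have "\<forall>\<^sub>F r in at_right (0::real). 0 < r" by (rule eventually_at_right_less)
  ultimately have "\<forall>\<^sub>F r in at_right 0. 0 < r \<and> r < u \<and> (1 + exp (c * r powr \<alpha>) * \<sigma>) * q powr (1 - r) < 1"
    by eventually_elim simp
  then show thesis using that eventually_happens[of _ "at_right (0::real)"] by (auto simp: trivial_limit_at_right_real)
qed

context controlled_map
begin

text \<open>The partition consists of the pieces stopped in any round, and \<tau> is the time of
  stopping. A piece stops when its image is one of the finitely many cells, and the decay of the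
  running mass makes the points that never stop a null set.\<close>

lemma exists_Gibbs_Markov:
  fixes K :: real
  assumes K: "0 \<le> K" "\<forall>\<epsilon>. 0 < \<epsilon> \<and> \<epsilon> < 1 \<longrightarrow> emeasure lborel (inner_collar \<epsilon> X) \<le> ennreal (K * \<epsilon>)"
  shows "\<exists>P' (\<tau> :: 'a \<Rightarrow> nat).
           open_refinement_mod0 X P P' \<and>
           (\<forall>x\<in>X. 1 \<le> \<tau> x) \<and> (\<forall>a\<in>P'. \<tau> constant_on a) \<and>
           Gibbs_Markov X P' (\<lambda>x. (T ^^ \<tau> x) x) \<and>
           finite {(\<lambda>x. (T ^^ \<tau> x) x) ` a | a. a \<in> P'} \<and>
           (\<exists>\<kappa> C :: real. 0 < \<kappa> \<and> \<kappa> < 1 \<and>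
              (\<forall>n. measure lebesgue {x \<in> X. \<tau> x > n} \<le> C * \<kappa> ^ n))"
proof -
  obtain R p L f \<V> where R: "finite R" "open_partition_mod0 X R" and p: "0 < p" and L: "0 \<le> L" and f0: "f 0 = R"
    and fR: "family 0 R" and steps: "\<forall>j. family (Suc j * p) (\<V> j) \<and> finer (\<V> j) (f j) \<and>
      f (Suc j) = {V \<in> \<V> j. (T ^^ (Suc j * p)) ` V \<notin> R} \<and> emeasure lborel (\<Union>(f j)) \<le> ennreal (L / 2 ^ j)"
    using inducing_scheme[OF K] by (elim exE conjE)
  define k where "k j = Suc j * p" for j
  define S where "S j = {V \<in> \<V> j. (T ^^ k j) ` V \<in> R}" for j
  have famV: "family (k j) (\<V> j)" and finV: "finer (\<V> j) (f j)"
    and fSuc: "f (Suc j) = {V \<in> \<V> j. (T ^^ k j) ` V \<notin> R}"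
    and mass: "emeasure lborel (\<Union>(f j)) \<le> ennreal (L / 2 ^ j)" for j
    using steps unfolding k_def by simp_all
  note RD = open_partition_mod0D[OF R(2)]
  have SV: "S j \<subseteq> \<V> j" and fV: "f (Suc j) \<subseteq> \<V> j" and split: "\<V> j = S j \<union> f (Suc j)" "S j \<inter> f (Suc j) = {}" for j
    unfolding S_def fSuc by auto
  have k1: "1 \<le> k j" for j unfolding k_def using p by simp
  have "\<Union>(f (Suc j)) \<subseteq> \<Union>(f j)" for j
    using finerD(3)[OF finV[of j]] Union_mono[OF fV[of j]] by (rule order_trans[rotated])
  then have anti: "i \<le> j \<Longrightarrow> \<Union>(f j) \<subseteq> \<Union>(f i)" for i j by (rule lift_Suc_antimono_le)
  have Vf: "V \<subseteq> \<Union>(f j)" if "V \<in> \<V> j" for V j using finerD(3)[OF finV[of j]] that by blast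
  \<comment> \<open>Pieces stopped later lie in the union of those that kept running after round i,
    and these are disjoint from the ones stopped in that round.\<close>
  have disj: "U \<inter> V = {}" if "U \<in> S i" "V \<in> S j" "i < j" for U V i j
  proof (rule ccontr)
    assume "U \<inter> V \<noteq> {}"
    then obtain x where x: "x \<in> U" "x \<in> V" by blast
    have "V \<in> \<V> j" using that(2) SV by blast
    then have "x \<in> \<Union>(f j)" using Vf x(2) by blast
    then have "x \<in> \<Union>(f (Suc i))" using anti[of "Suc i" j] that(3) by auto
    then obtain W where W: "W \<in> f (Suc i)" "x \<in> W" by blast
    have "U \<noteq> W" using that(1) W(1) split(2)[of i] by blast
    moreover have "U \<in> \<V> i" "W \<in> \<V> i" using that(1) W(1) split(1)[of i] by blast+
    ultimately have "disjnt U W" using familyD(1)[OF famV[of i]] unfolding pairwise_def by blast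
    then show False using x(1) W(2) unfolding disjnt_def by blast
  qed
  have same: "i = j" if "U \<in> S i" "V \<in> S j" "x \<in> U" "x \<in> V" for U V i j x
    using disj[OF that(1,2)] disj[OF that(2,1)] that(3,4) by (cases i j rule: linorder_cases) auto
  define P' where "P' = (\<Union>j. S j)"
  have op: "open V" and ne: "V \<noteq> {}" and adm: "admissible (k j) V" if "V \<in> S j" for V j
    using familyD(2,3,5)[OF famV[of j]] that SV by blast+
  \<comment> \<open>Refinement starts from \<open>R\<close>, so every piece stays inside one cell;
    the Markov property rests on this.\<close>
  have below: "(\<forall>V\<in>f j. \<exists>Q\<in>R. V \<subseteq> Q) \<and> (\<forall>V\<in>\<V> j. \<exists>Q\<in>R. V \<subseteq> Q)" for j
  proof -
    have 1: "\<forall>V\<in>\<V> j. \<exists>Q\<in>R. V \<subseteq> Q" if fj: "\<forall>V\<in>f j. \<exists>Q\<in>R. V \<subseteq> Q" for j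
    proof
      fix V assume "V \<in> \<V> j"
      then obtain W where W: "W \<in> f j" "V \<subseteq> W" using finerD(2)[OF finV[of j]] by blast
      then obtain Q where "Q \<in> R" "W \<subseteq> Q" using fj by blast
      then show "\<exists>Q\<in>R. V \<subseteq> Q" using W(2) by (intro bexI[of _ Q]) simp_all
    qed
    have "\<forall>V\<in>f j. \<exists>Q\<in>R. V \<subseteq> Q"
    proof (induction j)
      case 0
      show ?case unfolding f0 by blast
    next
      case (Suc j)
      show ?case using 1[OF Suc] fV[of j] by (meson subsetD)
    qed
    then show ?thesis using 1 by simp
  qed
  define Z where "Z = (X - \<Union>R) \<union> (\<Union>j. \<Union>(f j) - \<Union>(\<V> j))"
  have Z: "Z \<in> null_sets lebesgue"
    unfolding Z_def using RD(5) finerD(4)[OF finV] by (intro null_sets.Un null_sets_UN) auto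
  have cover: "x \<in> \<Union>(f n) \<or> (\<exists>j<n. \<exists>V\<in>S j. x \<in> V)" if x: "x \<in> X" "x \<notin> Z" for x n
  proof (induction n)
    case 0
    show ?case using x unfolding f0 Z_def by blast
  next
    case (Suc n)
    show ?case
    proof (cases "\<exists>j<n. \<exists>V\<in>S j. x \<in> V")
      case True
      then show ?thesis by (meson less_SucI)
    next
      case False
      then have "x \<in> \<Union>(f n)" using Suc by blast
      then have "x \<in> \<Union>(\<V> n)" using x(2) unfolding Z_def by blast
      then obtain V where "V \<in> \<V> n" "x \<in> V" by blast
      then have "V \<in> S n \<or> V \<in> f (Suc n)" using split(1)[of n] by blast
      then show ?thesis using \<open>x \<in> V\<close> by blast
    qed
  qed
  \<comment> \<open>Points still running after every round; the bounds L / 2^n force this set to be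
    null.\<close>
  define I where "I = (\<Inter>n. \<Union>(f n))"
  have of: "open (\<Union>(f n))" for n
    using family_bounded(2)[OF fR] family_bounded(2)[OF family_subset[OF famV fV]] f0 by (cases n) auto
  have Im: "I \<in> sets borel" unfolding I_def using of by (intro sets.countable_INT') auto
  have "emeasure lborel I \<le> ennreal 0"
  proof (rule LIMSEQ_le_const)
    have "(\<lambda>n. L * (1 / 2) ^ n) \<longlonglongrightarrow> L * 0" by (intro tendsto_mult tendsto_const LIMSEQ_power_zero) simp
    then show "(\<lambda>n. ennreal (L * (1 / 2) ^ n)) \<longlonglongrightarrow> ennreal 0" by (intro tendsto_ennrealI) simp
    have "emeasure lborel I \<le> ennreal (L * (1 / 2) ^ n)" for n
    proof -
      have "emeasure lborel I \<le> emeasure lborel (\<Union>(f n))"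
        using of by (intro emeasure_mono) (auto simp: I_def)
      also have "\<dots> \<le> ennreal (L / 2 ^ n)" by (rule mass)
      also have "L / 2 ^ n = L * (1 / 2) ^ n" by (simp add: power_one_over)
      finally show ?thesis .
    qed
    then show "\<exists>N. \<forall>n\<ge>N. emeasure lborel I \<le> ennreal (L * (1 / 2) ^ n)" by blast
  qed
  then have I: "I \<in> null_sets lebesgue" using Im by (intro null_sets_completionI null_setsI) auto
  have "X - \<Union>P' \<subseteq> Z \<union> I"
  proof
    fix x assume x: "x \<in> X - \<Union>P'"
    show "x \<in> Z \<union> I"
    proof (cases "x \<in> Z")
      case False
      have "x \<in> \<Union>(f n)" for n using cover[of x n] x False unfolding P'_def by blast
      then show ?thesis unfolding I_def by blast
    qed simp
  qed
  then have null: "X - \<Union>P' \<in> null_sets lebesgue"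
    by (rule null_sets_completion_subset) (intro null_sets.Un Z I)
  have P'D: "open a \<and> a \<noteq> {} \<and> a \<subseteq> X" if "a \<in> P'" for a
  proof -
    obtain j where j: "a \<in> S j" using \<open>a \<in> P'\<close> unfolding P'_def by blast
    show ?thesis using op[OF j] ne[OF j] admissible_facts(2)[OF adm[OF j]] by simp
  qed
  have disjP': "disjoint P'"
  proof (rule pairwiseI)
    fix U V assume UV: "U \<in> P'" "V \<in> P'" "U \<noteq> V"
    then obtain i j where ij: "U \<in> S i" "V \<in> S j" unfolding P'_def by blast
    show "disjnt U V"
    proof (cases "i = j")
      case True
      then have "U \<in> \<V> j" "V \<in> \<V> j" using ij SV by blast+
      then show ?thesis using familyD(1)[OF famV[of j]] UV(3) unfolding pairwise_def by blast
    next
      case False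
      then show ?thesis using disj[OF ij] disj[OF ij(2,1)] unfolding disjnt_def by (cases i j rule: linorder_cases) auto
    qed
  qed
  have "countable P'" using countable_disjoint_open_subsets[OF _ disjP'] P'D by blast
  then have part: "open_partition_mod0 X P'"
    unfolding open_partition_mod0_def using disjP' P'D null by simp
  have ref: "open_refinement_mod0 X P P'"
    unfolding open_refinement_mod0_def
  proof (intro conjI part ballI)
    fix a assume "a \<in> P'"
    then obtain j where j: "a \<in> S j" unfolding P'_def by blast
    have "0 < k j" using k1[of j] by simp
    then obtain A where "A \<in> P" "(T ^^ 0) ` a \<subseteq> A" using adm[OF j] unfolding admissible_def by blast
    then show "\<exists>A\<in>P. a \<subseteq> A" by auto
  qed
  \<comment> \<open>The value 1 off the partition keeps \<tau> positive everywhere; within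
    \<open>X\<close> it concerns only a null set.\<close>
  define \<tau> where "\<tau> x = (if x \<in> \<Union>P' then k (LEAST j. \<exists>V\<in>S j. x \<in> V) else 1)" for x
  have \<tau>: "\<tau> x = k j" if "V \<in> S j" "x \<in> V" for x V j
  proof -
    have "(LEAST j. \<exists>V\<in>S j. x \<in> V) = j"
      using that same by (intro Least_equality) blast+
    moreover have "x \<in> \<Union>P'" using that unfolding P'_def by blast
    ultimately show ?thesis unfolding \<tau>_def by simp
  qed
  have \<tau>1: "1 \<le> \<tau> x" for x unfolding \<tau>_def using k1 by simp
  let ?G = "\<lambda>x. (T ^^ \<tau> x) x"
  have G: "branch e \<alpha> \<Lambda> dist_const a ?G" "?G ` a \<in> R" if a: "a \<in> P'" for a
  proof -
    obtain j where j: "a \<in> S j" using a unfolding P'_def by blast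
    have eq: "(T ^^ k j) x = ?G x" if "x \<in> a" for x using \<tau>[OF j that] by simp
    \<comment> \<open>Stopping times are at least 1, so the single factor \<Lambda> bounds all
      contraction rates.\<close>
    have "\<Lambda> ^ k j \<le> \<Lambda> ^ 1" using const_facts k1[of j] by (intro power_decreasing) auto
    then have "branch e \<alpha> \<Lambda> dist_const a (T ^^ k j)"
      by (intro branch_weaken[OF admissible_branch[OF adm[OF j]]]) simp_all
    then show "branch e \<alpha> \<Lambda> dist_const a ?G" using eq by (rule branch_cong)
    have "?G ` a = (T ^^ k j) ` a" using eq by (intro image_cong) simp_all
    then show "?G ` a \<in> R" using j unfolding S_def by simp
  qed
  \<comment> \<open>Images are cells of diameter at most \<open>r \<le> e\<close>, so contraction
    and distortion hold for all pairs of their points.\<close>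
  have diamR: "dist x y \<le> e" if "Q \<in> R" "x \<in> Q" "y \<in> Q" for Q x y
    using familyD(4)[OF fR that(1), of x y] that r(2) by simp
  have pc: "nonsingular_homeo_on a ?G"
    "\<forall>x\<in>?G ` a. \<forall>y\<in>?G ` a. dist (inv_into a ?G x) (inv_into a ?G y) \<le> \<Lambda> * dist x y"
    "\<exists>J. is_jacobian (?G ` a) (inv_into a ?G) J \<and>
      (\<forall>x\<in>?G ` a. \<forall>y\<in>?G ` a. J x \<le> exp (dist_const * dist x y powr \<alpha>) * J y)" if "a \<in> P'" for a
    by (rule piece_of_branch[OF G(1)[OF that] diamR[OF G(2)[OF that]]]; assumption)+
  have GM: "Gibbs_Markov X P' ?G"
    unfolding Gibbs_Markov_def
  proof (intro conjI open_X part ballI)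
    fix a assume a: "a \<in> P'"
    show "?G ` a \<subseteq> X" by (rule RD(4)[OF G(2)[OF a]])
    show "nonsingular_homeo_on a ?G" by (rule pc(1)[OF a])
    \<comment> \<open>The elements inside the image cell. An element meeting the image lies in some
      cell, and by disjointness of the cells this is the image itself, so only points outside the
      partition are missed.\<close>
    let ?R' = "{b \<in> P'. b \<subseteq> ?G ` a}"
    have "?G ` a - \<Union>?R' \<subseteq> X - \<Union>P'"
    proof
      fix x assume x: "x \<in> ?G ` a - \<Union>?R'"
      then have xX: "x \<in> X" using RD(4)[OF G(2)[OF a]] by blast
      have "x \<notin> b" if b: "b \<in> P'" for b
      proof
        assume xb: "x \<in> b"
        obtain j where "b \<in> S j" using b unfolding P'_def by blast
        then obtain Q where Q: "Q \<in> R" "b \<subseteq> Q" using below[of j] SV[of j] by blast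
        have xQ: "x \<in> Q" "x \<in> ?G ` a" using xb Q(2) x by blast+
        have "Q = ?G ` a"
        proof (rule ccontr)
          assume "Q \<noteq> ?G ` a"
          then have "disjnt Q (?G ` a)" by (rule pairwiseD[OF RD(1) Q(1) G(2)[OF a]])
          then show False using xQ unfolding disjnt_iff by simp
        qed
        then show False using x b xb Q(2) by blast
      qed
      then show "x \<in> X - \<Union>P'" using xX by blast
    qed
    moreover have "sym_diff (?G ` a) (\<Union>?R') = ?G ` a - \<Union>?R'" by blast
    ultimately have "sym_diff (?G ` a) (\<Union>?R') \<in> null_sets lebesgue"
      using null_sets_completion_subset[OF _ null] by simp
    then show "\<exists>R\<subseteq>P'. sym_diff (?G ` a) (\<Union>R) \<in> null_sets lebesgue" by (intro exI[of _ ?R']) simp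
  next
    have "uniform_expansion P' ?G e \<Lambda>"
      unfolding uniform_expansion_def using const_facts(1-3) pc(2) by blast
    then show "\<exists>\<epsilon> \<Lambda>. uniform_expansion P' ?G \<epsilon> \<Lambda>" by blast
    have "\<alpha> \<le> 1" using distortion unfolding bounded_distortion_def by simp
    then have "bounded_distortion P' ?G \<alpha> dist_const"
      unfolding bounded_distortion_def using const_facts(4,6) pc(3) by blast
    then show "\<exists>\<alpha> D. bounded_distortion P' ?G \<alpha> D" by blast
  qed
  have const: "\<forall>a\<in>P'. \<tau> constant_on a"
  proof
    fix a assume "a \<in> P'"
    then obtain j where j: "a \<in> S j" unfolding P'_def by blast
    show "\<tau> constant_on a" unfolding constant_on_def using \<tau>[OF j] by blast
  qed
  have "{?G ` a | a. a \<in> P'} \<subseteq> R" using G(2) by auto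
  then have fin: "finite {?G ` a | a. a \<in> P'}" using R(1) by (rule finite_subset)
  \<comment> \<open>One round takes \<open>p\<close> steps and halves the bound, hence \<kappa>^p =
    1/2.\<close>
  define \<kappa> :: real where "\<kappa> = (1 / 2) powr (1 / p)"
  have "(1 / 2 :: real) powr (1 / p) < 1 powr (1 / p)" using p by (intro powr_less_mono2) auto
  then have \<kappa>: "0 < \<kappa>" "\<kappa> < 1" unfolding \<kappa>_def by auto
  have tail: "measure lebesgue {x \<in> X. \<tau> x > n} \<le> 2 * L * \<kappa> ^ n" for n
  proof -
    \<comment> \<open>A stopping time (i + 1) p above n forces i \<ge> n div p, so the point was
      still running after j rounds.\<close>
    define j where "j = n div p"
    have sub: "{x \<in> X. \<tau> x > n} \<subseteq> \<Union>(f j) \<union> (X - \<Union>P')"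
    proof
      fix x assume x: "x \<in> {x \<in> X. \<tau> x > n}"
      show "x \<in> \<Union>(f j) \<union> (X - \<Union>P')"
      proof (cases "x \<in> \<Union>P'")
        case True
        then obtain i V where V: "V \<in> S i" "x \<in> V" unfolding P'_def by blast
        have "n < Suc i * p" using \<tau>[OF V] x unfolding k_def by simp
        then have "j < Suc i" unfolding j_def by (rule less_mult_imp_div_less)
        then have "\<Union>(f i) \<subseteq> \<Union>(f j)" by (intro anti) simp
        moreover have "V \<subseteq> \<Union>(f i)" using V(1) SV[of i] by (intro Vf) blast
        ultimately show ?thesis using V(2) by blast
      next
        case False
        then show ?thesis using x by blast
      qed
    qed
    have "emeasure lebesgue {x \<in> X. \<tau> x > n} \<le> emeasure lebesgue (\<Union>(f j) \<union> (X - \<Union>P'))"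
      using sub of[of j] null by (intro emeasure_mono sets.Un) auto
    also have "\<dots> = emeasure lebesgue (\<Union>(f j))"
      using of[of j] null by (intro emeasure_Un_null_set) auto
    also have "\<dots> \<le> ennreal (L / 2 ^ j)" using mass[of j] of[of j] by simp
    finally have "measure lebesgue {x \<in> X. \<tau> x > n} \<le> L / 2 ^ j"
      unfolding measure_def using L by (intro enn2real_leI) auto
    also have "\<dots> \<le> 2 * L * \<kappa> ^ n"
    proof -
      \<comment> \<open>Rounding n up to (j + 1) p loses one halving, which accounts for the factor
        2.\<close>
      have "real n = real (j * p + n mod p)" unfolding j_def by simp
      also have "\<dots> \<le> real ((j + 1) * p)" using p mod_less_divisor[of p n] by (intro of_nat_mono) simp
      finally have "real n / p \<le> real (j + 1)" using p by (simp add: divide_le_eq algebra_simps)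
      then have "(1 / 2 :: real) powr real (j + 1) \<le> (1 / 2) powr (real n / p)" by (intro powr_mono') auto
      also have "\<dots> = \<kappa> ^ n" unfolding \<kappa>_def by (simp add: powr_realpow[symmetric] powr_powr)
      finally have "1 / 2 ^ j \<le> 2 * \<kappa> ^ n"
        by (subst (asm) powr_realpow) (simp_all add: power_one_over)
      then show ?thesis using mult_left_mono[OF _ L, of "1 / 2 ^ j" "2 * \<kappa> ^ n"] by simp
    qed
    finally show ?thesis .
  qed
  have "\<exists>\<kappa> C :: real. 0 < \<kappa> \<and> \<kappa> < 1 \<and> (\<forall>n. measure lebesgue {x \<in> X. \<tau> x > n} \<le> C * \<kappa> ^ n)"
    using \<kappa> tail by blast
  then show ?thesis
    using ref \<tau>1 const GM fin by (intro exI[of _ P'] exI[of _ \<tau>] conjI) simp_all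
qed

end

theorem theorem1:
  fixes X :: "'a::euclidean_space set" and P :: "'a set set" and T :: "'a \<Rightarrow> 'a"
    and \<epsilon>\<^sub>1 \<Lambda> \<alpha> D :: real
  assumes "open X" and "bounded X"
    and "bdd_above ((\<lambda>\<epsilon>. measure lebesgue (inner_collar \<epsilon> X) / \<epsilon>) ` {0<..})"
    and "piecewise_invertible X P T"
    and "uniform_expansion P T \<epsilon>\<^sub>1 \<Lambda>"
    and "bounded_distortion P T \<alpha> D"
    and "controlled_complexity X P T \<Lambda>"
  shows "\<exists>P' (\<tau> :: 'a \<Rightarrow> nat).
           open_refinement_mod0 X P P' \<and>
           (\<forall>x\<in>X. 1 \<le> \<tau> x) \<and> (\<forall>a\<in>P'. \<tau> constant_on a) \<and>
           Gibbs_Markov X P' (\<lambda>x. (T ^^ \<tau> x) x) \<and>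
           finite {(\<lambda>x. (T ^^ \<tau> x) x) ` a | a. a \<in> P'} \<and>
           (\<exists>\<kappa> C :: real. 0 < \<kappa> \<and> \<kappa> < 1 \<and>
              (\<forall>n. measure lebesgue {x \<in> X. \<tau> x > n} \<le> C * \<kappa> ^ n))"
proof -
  interpret expanding_map X P T \<epsilon>\<^sub>1 \<Lambda> \<alpha> D
    using assms(1,2,4-6) by unfold_locales
  obtain n\<^sub>0 \<epsilon>\<^sub>2 \<sigma> where \<epsilon>\<^sub>2: "0 < \<epsilon>\<^sub>2" and \<sigma>: "0 \<le> \<sigma>" "\<sigma> < 1 / \<Lambda> ^ n\<^sub>0 - 1"
    and cc: "\<forall>I \<epsilon>. open I \<and> I \<noteq> {} \<and> I \<subseteq> X \<and> diameter I \<le> \<epsilon>\<^sub>2 \<and> 0 < \<epsilon> \<and> \<epsilon> < \<epsilon>\<^sub>2 \<longrightarrow>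
           complexity_sum X P T \<Lambda> n\<^sub>0 I \<epsilon> \<le> ennreal \<sigma>"
    using assms(7) unfolding controlled_complexity_def by (elim exE conjE)
  \<comment> \<open>For block length 0 no \<sigma> could satisfy 0 \<le> \<sigma> < 0.\<close>
  have n0: "0 < n\<^sub>0" using \<sigma> by (cases n\<^sub>0) auto
  have "0 < \<Lambda> ^ n\<^sub>0" using const_facts(2) by simp
  moreover have "0 < min (min \<epsilon>\<^sub>1 \<epsilon>\<^sub>2) 1" using \<epsilon>\<^sub>2 const_facts(1) by simp
  ultimately obtain r where r: "0 < r" "r < min (min \<epsilon>\<^sub>1 \<epsilon>\<^sub>2) 1"
    "(1 + exp (dist_const * r powr \<alpha>) * \<sigma>) * (\<Lambda> ^ n\<^sub>0) powr (1 - r) < 1"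
    using exists_scale[OF \<sigma> _ const_facts(4)] by blast
  \<comment> \<open>The exponent \<beta> is 1 - r; the bounds on r put it strictly between 0 and 1
    and make r smaller than the scales of expansion and complexity.\<close>
  interpret controlled_map X P T \<epsilon>\<^sub>1 \<Lambda> \<alpha> D n\<^sub>0 \<epsilon>\<^sub>2 \<sigma> "1 - r" r
    using n0 \<sigma>(1) \<epsilon>\<^sub>2 cc r by unfold_locales auto
  obtain K where K: "\<And>\<epsilon>. 0 < \<epsilon> \<Longrightarrow> measure lebesgue (inner_collar \<epsilon> X) / \<epsilon> \<le> K"
    using assms(3) by (auto simp: bdd_above_def)
  have "emeasure lborel (inner_collar \<epsilon> X) \<le> ennreal (max 0 K * \<epsilon>)" if \<epsilon>: "0 < \<epsilon>" for \<epsilon>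
  proof -
    have o: "open (inner_collar \<epsilon> X)" by (rule open_inner_collar[OF assms(1)])
    have "inner_collar \<epsilon> X \<subseteq> X" unfolding inner_collar_def by blast
    then have "emeasure lborel (inner_collar \<epsilon> X) < \<infinity>"
      using bounded_subset[OF assms(2)] emeasure_bounded_finite by blast
    then have "emeasure lborel (inner_collar \<epsilon> X) = ennreal (measure lborel (inner_collar \<epsilon> X))"
      by (simp add: emeasure_eq_ennreal_measure less_top)
    moreover have "measure lborel (inner_collar \<epsilon> X) \<le> max 0 K * \<epsilon>"
    proof -
      have "measure lborel (inner_collar \<epsilon> X) / \<epsilon> \<le> max 0 K"
        using K[OF \<epsilon>] o by (simp add: measure_completion)
      then show ?thesis using \<epsilon> by (simp add: divide_le_eq)
    qed
    ultimately show ?thesis by (simp add: ennreal_leI)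
  qed
  then show ?thesis using exists_Gibbs_Markov[of "max 0 K"] by simp
qed

end
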